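(* Let $\theta\subset\mathbb R^N$ be a non-empty open set with compact closure satisfying $(A_\theta)$, let $H:\mathbb R^N\times\mathbb R^N\times\mathcal S^N\to\mathbb R$ be a uniformly continuous function satisfying $(A_H)$, and suppose that hypothesis (H) holds with constant $M_0>0$. Suppose in addition that $H$ satisfies the radial monotonicity condition $$H(x,lp,lA)\ge H(x,p,A)\quad\text{for all real } l\ge 1,\ (x,p,A)\in\overline\theta\times\mathbb R^N\times\mathcal S^N.$$ For every $\lambda>0$ let $V_\lambda$ be the constrained viscosity solution of $$\lambda V(x)+H(x,DV(x),D^2V(x))=0,\quad x\in\overline\theta,$$ such that $\lambda V_\lambda\in \mathrm{Lip}_{M_0}(\overline\theta)$. Then: (i) $\lambda\mapsto\lambda V_\lambda(x)$ is nondecreasing, for every $x\in\overline\theta$; (ii) the limit $\lim_{\lambda\to0^+}\lambda V_\lambda(x)$ exists, for every $x\in\overline\theta$; (iii) the convergence in (ii) is uniform on $\overline\theta$.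
   Context: $\mathcal S^N$ is the set of symmetric $N\times N$ real matrices with its usual order. $B(x,s)$ is the open ball of $\mathbb R^N$ with center $x$ and radius $s$. $(A_\theta)$: there exist a bounded, uniformly continuous function $m:\overline\theta\to\mathbb R^N$ with $|m|\le1$ and a constant $r>0$ such that $B(x+s\,m(x),rs)\subset\theta$ for all $x\in\overline\theta$, $s\in(0,r]$. $(A_H)$: (i) $H(x,p,A)\le H(x,p,B)$ for all $(x,p)\in\mathbb R^N\times\mathbb R^N$ and $A,B\in\mathcal S^N$ with $B\le A$. (ii) There is a modulus of continuity $\rho:\mathbb R_+\to\mathbb R_+$, $\rho(0+)=0$, such that $|H(x,p,A)-H(x,q,B)|\le\rho(|p-q|+|A-B|)$ for all $x,p,q\in\mathbb R^N$, $A,B\in\mathcal S^N$, and $$H(y,p,B)-H(x,p,A)\le\rho\big(\tfrac1\varepsilon|x-y|^2+|x-y|(|p|+1)\big)$$ for all $x,y,p\in\mathbb R^N$, $\varepsilon>0$ and $A,B\in\mathcal S^N$ such that $$-\frac3\varepsilon\begin{pmatrix}I&0\\0&I\end{pmatrix}\le\begin{pmatrix}A&0\\0&-B\end{pmatrix}\le\frac3\varepsilon\begin{pmatrix}I&-I\\-I&I\end{pmatrix}.$$ For a bounded measurable $V:\overline\theta\to\mathbb R$, put $V^*(x)=\limsup_{y\to x}V(y)$, $V_*(x)=\liminf_{y\to x}V(y)$, $x\in\overline\theta$. $V$ is a viscosity subsolution of $\lambda V+H(x,DV,D^2V)=0$ on $\theta$ if for all $x\in\theta$ and $\varphi\in C^2(\mathbb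 R^N)$ such that $V^*-\varphi$ has a local maximum on $\theta$ at $x$, $\lambda V^*(x)+H(x,D\varphi(x),D^2\varphi(x))\le0$. It is a viscosity supersolution on $\overline\theta$ if for all $x\in\overline\theta$ and $\varphi\in C^2(\mathbb R^N)$ such that $V_*-\varphi$ has a local minimum on $\overline\theta$ at $x$, $\lambda V_*(x)+H(x,D\varphi(x),D^2\varphi(x))\ge0$. $V$ is a constrained viscosity solution if it is a viscosity subsolution on $\theta$ and a viscosity supersolution on $\overline\theta$. For $M_0>0$, $\mathrm{Lip}_{M_0}(\overline\theta)$ is the set of functions $u:\overline\theta\to\mathbb R$ with $|u(x)|\le M_0$ and $|u(x)-u(y)|\le M_0|x-y|$ for all $x,y\in\overline\theta$. Hypothesis (H): ($M_0$ being large enough) for every $\lambda>0$ the PDE $\lambda V+H(x,DV,D^2V)=0$ on $\overline\theta$ has a constrained viscosity solution $V_\lambda$ with $\lambda V_\lambda\in\mathrm{Lip}_{M_0}(\overline\theta)$. *)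

theory Defs
  imports "HOL-Analysis.Analysis"
begin

definition sym_matrices :: "(real ^ 'n ^ 'n) set" where
  "sym_matrices = {A. transpose A = A}"

text \<open>The usual (Loewner) order. The product order of \<^typ>\<open>real ^ 'n ^ 'n\<close>, written \<open>\<le>\<close>,
  is entrywise and therefore not used for matrices.\<close>

definition loewner_le :: "real ^ 'n ^ 'n \<Rightarrow> real ^ 'n ^ 'n \<Rightarrow> bool" (infix "\<preceq>" 50) where
  "A \<preceq> B \<longleftrightarrow> (\<forall>v. v \<bullet> (A *v v) \<le> v \<bullet> (B *v v))"

definition block_matrix ::
    "real ^ 'n ^ 'n \<Rightarrow> real ^ 'n ^ 'n \<Rightarrow> real ^ 'n ^ 'n \<Rightarrow> real ^ 'n ^ 'n
      \<Rightarrow> real ^ ('n + 'n) ^ ('n + 'n)" where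
  "block_matrix A B C D =
    (\<chi> i j. case i of
        Inl a \<Rightarrow> (case j of Inl b \<Rightarrow> A $ a $ b | Inr b \<Rightarrow> B $ a $ b)
      | Inr a \<Rightarrow> (case j of Inl b \<Rightarrow> C $ a $ b | Inr b \<Rightarrow> D $ a $ b))"

definition domain_condition :: "(real ^ 'n) set \<Rightarrow> bool" where
  "domain_condition \<theta> \<longleftrightarrow>
    (\<exists>(m :: real ^ 'n \<Rightarrow> real ^ 'n) r.
       bounded (m ` closure \<theta>) \<and> uniformly_continuous_on (closure \<theta>) m \<and>
       (\<forall>x\<in>closure \<theta>. norm (m x) \<le> 1) \<and> r > 0 \<and>
       (\<forall>x\<in>closure \<theta>. \<forall>s\<in>{0<..r}. ball (x + s *\<^sub>R m x) (r * s) \<subseteq> \<theta>))"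

text \<open>A Hamiltonian on \<open>\<real>\<^sup>N \<times> \<real>\<^sup>N \<times> S\<^sup>N\<close> is a curried function on all square matrices;
  hypotheses restrict it to \<^const>\<open>sym_matrices\<close>, and its other values are irrelevant.
  The norm on matrices is the Euclidean one of \<^typ>\<open>real ^ 'n ^ 'n\<close>.\<close>

definition hamiltonian_condition ::
    "(real ^ 'n \<Rightarrow> real ^ 'n \<Rightarrow> real ^ 'n ^ 'n \<Rightarrow> real) \<Rightarrow> bool" where
  "hamiltonian_condition H \<longleftrightarrow>
    (\<forall>x p. \<forall>A\<in>sym_matrices. \<forall>B\<in>sym_matrices. B \<preceq> A \<longrightarrow> H x p A \<le> H x p B) \<and>
    (\<exists>\<rho> :: real \<Rightarrow> real.
       (\<forall>t\<ge>0. \<rho> t \<ge> 0) \<and> (\<rho> \<longlongrightarrow> 0) (at_right 0) \<and>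
       (\<forall>x p q. \<forall>A\<in>sym_matrices. \<forall>B\<in>sym_matrices.
          \<bar>H x p A - H x q B\<bar> \<le> \<rho> (norm (p - q) + norm (A - B))) \<and>
       (\<forall>x y p. \<forall>\<epsilon>>0. \<forall>A\<in>sym_matrices. \<forall>B\<in>sym_matrices.
          - (3 / \<epsilon>) *\<^sub>R block_matrix (mat 1) 0 0 (mat 1) \<preceq> block_matrix A 0 0 (- B) \<and>
          block_matrix A 0 0 (- B)
            \<preceq> (3 / \<epsilon>) *\<^sub>R block_matrix (mat 1) (- mat 1) (- mat 1) (mat 1)
          \<longrightarrow> H y p B - H x p A
                \<le> \<rho> (1 / \<epsilon> * (norm (x - y))\<^sup>2 + norm (x - y) * (norm p + 1))))"

definition radial_monotonicity ::
    "(real ^ 'n) set \<Rightarrow> (real ^ 'n \<Rightarrow> real ^ 'n \<Rightarrow> real ^ 'n ^ 'n \<Rightarrow> real) \<Rightarrow> bool" where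
  "radial_monotonicity \<theta> H \<longleftrightarrow>
    (\<forall>l\<ge>1. \<forall>x\<in>closure \<theta>. \<forall>p. \<forall>A\<in>sym_matrices. H x (l *\<^sub>R p) (l *\<^sub>R A) \<ge> H x p A)"

definition gradient :: "(real ^ 'n \<Rightarrow> real) \<Rightarrow> real ^ 'n \<Rightarrow> real ^ 'n" where
  "gradient \<phi> x = (\<chi> i. frechet_derivative \<phi> (at x) (axis i 1))"

definition hessian :: "(real ^ 'n \<Rightarrow> real) \<Rightarrow> real ^ 'n \<Rightarrow> real ^ 'n ^ 'n" where
  "hessian \<phi> x = matrix (frechet_derivative (gradient \<phi>) (at x))"

definition C2 :: "(real ^ 'n \<Rightarrow> real) \<Rightarrow> bool" where
  "C2 \<phi> \<longleftrightarrow> (\<forall>x. \<phi> differentiable at x) \<and> (\<forall>x. gradient \<phi> differentiable at x) \<and>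
    continuous_on UNIV (hessian \<phi>)"

text \<open>Semicontinuous envelopes on \<open>S\<close>. As usual for viscosity solutions, the filter of points
  \<open>y \<rightarrow> x\<close> in \<open>S\<close> does not exclude \<open>y = x\<close>. For \<open>V\<close> bounded on \<open>S\<close> and \<open>x \<in> closure S\<close> the
  extended limits are finite.\<close>

definition upper_envelope :: "(real ^ 'n) set \<Rightarrow> (real ^ 'n \<Rightarrow> real) \<Rightarrow> real ^ 'n \<Rightarrow> real" where
  "upper_envelope S V x = real_of_ereal (Limsup (inf (nhds x) (principal S)) (\<lambda>y. ereal (V y)))"

definition lower_envelope :: "(real ^ 'n) set \<Rightarrow> (real ^ 'n \<Rightarrow> real) \<Rightarrow> real ^ 'n \<Rightarrow> real" where
  "lower_envelope S V x = real_of_ereal (Liminf (inf (nhds x) (principal S)) (\<lambda>y. ereal (V y)))"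

definition local_max_on :: "(real ^ 'n) set \<Rightarrow> (real ^ 'n \<Rightarrow> real) \<Rightarrow> real ^ 'n \<Rightarrow> bool" where
  "local_max_on S f x \<longleftrightarrow> x \<in> S \<and> (\<forall>\<^sub>F y in at x within S. f y \<le> f x)"

definition local_min_on :: "(real ^ 'n) set \<Rightarrow> (real ^ 'n \<Rightarrow> real) \<Rightarrow> real ^ 'n \<Rightarrow> bool" where
  "local_min_on S f x \<longleftrightarrow> x \<in> S \<and> (\<forall>\<^sub>F y in at x within S. f x \<le> f y)"

definition viscosity_subsolution ::
    "(real ^ 'n) set \<Rightarrow> (real ^ 'n \<Rightarrow> real ^ 'n \<Rightarrow> real ^ 'n ^ 'n \<Rightarrow> real) \<Rightarrow> real
      \<Rightarrow> (real ^ 'n \<Rightarrow> real) \<Rightarrow> bool" where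
  "viscosity_subsolution \<theta> H lam V \<longleftrightarrow>
    (\<forall>x\<in>\<theta>. \<forall>\<phi>. C2 \<phi> \<and> local_max_on \<theta> (\<lambda>y. upper_envelope (closure \<theta>) V y - \<phi> y) x \<longrightarrow>
       lam * upper_envelope (closure \<theta>) V x + H x (gradient \<phi> x) (hessian \<phi> x) \<le> 0)"

definition viscosity_supersolution ::
    "(real ^ 'n) set \<Rightarrow> (real ^ 'n \<Rightarrow> real ^ 'n \<Rightarrow> real ^ 'n ^ 'n \<Rightarrow> real) \<Rightarrow> real
      \<Rightarrow> (real ^ 'n \<Rightarrow> real) \<Rightarrow> bool" where
  "viscosity_supersolution \<theta> H lam V \<longleftrightarrow>
    (\<forall>x\<in>closure \<theta>. \<forall>\<phi>.
       C2 \<phi> \<and> local_min_on (closure \<theta>) (\<lambda>y. lower_envelope (closure \<theta>) V y - \<phi> y) x \<longrightarrow>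
       lam * lower_envelope (closure \<theta>) V x + H x (gradient \<phi> x) (hessian \<phi> x) \<ge> 0)"

text \<open>Functions on the closure of \<open>\<theta>\<close> are total functions whose values elsewhere are irrelevant.\<close>

definition constrained_viscosity_solution ::
    "(real ^ 'n) set \<Rightarrow> (real ^ 'n \<Rightarrow> real ^ 'n \<Rightarrow> real ^ 'n ^ 'n \<Rightarrow> real) \<Rightarrow> real
      \<Rightarrow> (real ^ 'n \<Rightarrow> real) \<Rightarrow> bool" where
  "constrained_viscosity_solution \<theta> H lam V \<longleftrightarrow>
    bounded (V ` closure \<theta>) \<and> V \<in> borel_measurable (lebesgue_on (closure \<theta>)) \<and>
    viscosity_subsolution \<theta> H lam V \<and> viscosity_supersolution \<theta> H lam V"

definition Lip :: "real \<Rightarrow> (real ^ 'n) set \<Rightarrow> (real ^ 'n \<Rightarrow> real) set" where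
  "Lip M S = {u. (\<forall>x\<in>S. \<bar>u x\<bar> \<le> M) \<and> (\<forall>x\<in>S. \<forall>y\<in>S. \<bar>u x - u y\<bar> \<le> M * norm (x - y))}"

definition solvability_hypothesis ::
    "(real ^ 'n) set \<Rightarrow> (real ^ 'n \<Rightarrow> real ^ 'n \<Rightarrow> real ^ 'n ^ 'n \<Rightarrow> real) \<Rightarrow> real \<Rightarrow> bool" where
  "solvability_hypothesis \<theta> H M \<longleftrightarrow>
    (\<forall>lam>0. \<exists>V. constrained_viscosity_solution \<theta> H lam V \<and>
       (\<lambda>x. lam * V x) \<in> Lip M (closure \<theta>))"

end

theory Submission
  imports Defs "HOL-Complex_Analysis.Great_Picard"
begin

text \<open>The function \<open>u = \<lambda> V\<^sub>\<lambda>\<close> solves \<open>u + H(x, Du/\<lambda>, D\<^sup>2u/\<lambda>) = 0\<close>. For \<open>\<lambda> \<le> \<mu>\<close>, radial monotonicity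
  makes it a subsolution of the equation for \<open>\<mu>\<close>, so comparison of constrained solutions gives
  \<open>\<lambda> V\<^sub>\<lambda> \<le> \<mu> V\<^sub>\<mu>\<close>; monotonicity and the common Lipschitz bound then give uniform convergence.

  The comparison principle needs second-order jets of a sum \<open>f + g\<close> of semiconvex functions near
  its maximum. Alexandrov's theorem is avoided as follows. By Jensen's argument the contact set of
  \<open>f + g\<close> with planes of small slope has positive measure, hence is almost dense in some small
  balls, and rescaling there produces a limit pair with globally bounded second differences and
  concave sum. The family of all such limit pairs is invariant under translation, scaling and
  locally uniform limits. A member that maximises a second difference can be blown up to one that
  is exactly quadratic in that direction, and finitely many directions determine a quadratic
  polynomial. Being close to quadratics on one small ball is enough to test viscosity
  inequalities.\<close>

section \<open>Functions of one variable and asymptotic equicontinuity\<close>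

text \<open>The comparison argument needs less than a second-order expansion at a common point: for
  each tolerance, one upper test quadratic for f and one for g, at two nearby points, with almost
  opposite slopes and Hessians whose sum is almost nonpositive. Hence no expansion has to persist as
  the scale tends to zero. The pair is carried as one map into \<open>real \<times> real\<close>
  because the sign condition couples the summands: centre, scale and subsequence must be common to
  both, while slopes and Hessians are separate. The obstacle is that a semiconvex function is
  bounded by paraboloids from below everywhere, but from above only where the sum touches a plane,
  so rescalings are compact only once contact points become dense in the limit. The Hessians found
  here may be as large as the inverse of the sup-convolution parameter, so no limit is taken in
  them; only the differences between the two tests are small, and the uniform continuity of
  \<open>H\<close> is applied to those differences.\<close>

lemma concave_eq_zero:
  fixes g :: "real \<Rightarrow> real"
  assumes cont: "continuous_on {-R..R} g" and R: "R > 0"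
    and conc: "\<And>a t. \<bar>a\<bar> + \<bar>t\<bar> \<le> R \<Longrightarrow> g (a + t) + g (a - t) \<le> 2 * g a"
    and z: "g 0 = 0" "g R = 0" "g (- R) = 0"
    and t: "\<bar>t\<bar> \<le> R"
  shows "g t = 0"
proof -
  have nonneg: "g t \<ge> 0" if "\<bar>t\<bar> \<le> R" for t
  proof (rule ccontr)
    assume neg: "\<not> g t \<ge> 0"
    obtain m where m: "m \<in> {-R..R}" "\<And>y. y \<in> {-R..R} \<Longrightarrow> g m \<le> g y"
      using continuous_attains_inf[OF compact_Icc _ cont] R by (metis atLeastAtMost_iff empty_iff less_eq_real_def neg_le_0_iff_le order_trans)
    have gm: "g m < 0" using m(2)[of t] neg that by (auto simp: abs_le_iff)
    define S where "S = {y \<in> {-R..R}. g y = g m}"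
    have "closed S" unfolding S_def
      by (intro continuous_closed_preimage_constant[OF cont] closed_atLeastAtMost)
    then have cS: "compact S" by (metis S_def closed_atLeastAtMost compact_Icc compact_Int_closed inf.absorb2 mem_Collect_eq subsetI)
    have "S \<noteq> {}" using m(1) by (auto simp: S_def)
    \<comment> \<open>At an interior minimum the two points at equal distance are minima too, so the
      leftmost minimiser cannot be interior; it cannot be an endpoint, since the value there is
      0.\<close>
    then obtain y where y: "y \<in> S" "\<And>z. z \<in> S \<Longrightarrow> y \<le> z"
      using compact_attains_inf[OF cS] by auto
    have yy: "\<bar>y\<bar> < R" using y(1) z gm unfolding S_def by (metis (mono_tags, lifting) abs_less_iff atLeastAtMost_iff less_eq_real_def less_irrefl mem_Collect_eq minus_less_iff neg_le_iff_le)
    define h where "h = R - \<bar>y\<bar>"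
    have h: "h > 0" using yy by (simp add: h_def)
    have "g (y + h) + g (y - h) \<le> 2 * g m"
      using conc[of y h] y(1) h by (auto simp: h_def S_def)
    moreover have "g (y + h) \<ge> g m" "g (y - h) \<ge> g m"
      by (intro m(2); use yy in \<open>auto simp: h_def\<close>)+
    ultimately have "g (y - h) = g m" by linarith
    then have "y - h \<in> S" using yy by (auto simp: S_def h_def)
    then show False using y(2) h by force
  qed
  \<comment> \<open>Two nonnegative values with a nonpositive sum both vanish.\<close>
  have "g t + g (- t) \<le> 0" using conc[of 0 t] t z by simp
  then show ?thesis using nonneg[of t] nonneg[of "- t"] t by simp
qed

text \<open>Midpoint concavity makes increments with a fixed step nonincreasing. Following the steps
  t and -t from a, a strict defect d accumulates linearly: after k steps the two values sum to at
  most \<open>2 * g a - real k * d\<close>, which finally violates the lower bound.\<close>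

lemma concave_bounded_below_affine:
  fixes g :: "real \<Rightarrow> real"
  assumes conc: "\<And>a t. g (a + t) + g (a - t) \<le> 2 * g a" and b: "\<And>a. B \<le> g a"
  shows "g (a + t) + g (a - t) = 2 * g a"
proof (rule ccontr)
  assume ne: "\<not> ?thesis"
  define d where "d = 2 * g a - g (a + t) - g (a - t)"
  have d: "d > 0" using ne conc[of a t] by (simp add: d_def)
  have incr: "g (a + (real k + 1) * s) - g (a + real k * s) \<le> g (a + s) - g a" for s k
  proof (induction k)
    case (Suc k)
    then show ?case using conc[of "a + (real k + 1) * s" s] by (simp add: algebra_simps)
  qed simp
  have up: "g (a + real k * s) \<le> g a + real k * (g (a + s) - g a)" for s k
  proof (induction k)
    case (Suc k)
    then show ?case using incr[of k s] by (simp add: algebra_simps)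
  qed simp
  have "2 * B \<le> 2 * g a - real k * d" for k
    using up[of k t] up[of k "- t"] b[of "a + real k * t"] b[of "a + real k * - t"]
    by (simp add: d_def algebra_simps)
  moreover obtain k where "real k * d > 2 * g a - 2 * B"
    using d reals_Archimedean3 by blast
  ultimately show False by (smt (verit))
qed

text \<open>After subtraction of the chord over [0, 1] the function vanishes at all integers by the
  two-term recursion; between -n, 0 and n it then vanishes as a continuous concave function.\<close>

lemma affine_if_second_differences_zero:
  fixes g :: "real \<Rightarrow> real"
  assumes cont: "continuous_on UNIV g"
    and z: "\<And>a t. g (a + t) + g (a - t) = 2 * g a"
  shows "g t = g 0 + t * (g 1 - g 0)"
proof -
  define k where "k t = g t - g 0 - t * (g 1 - g 0)" for t
  have zk: "k (a + t) + k (a - t) = 2 * k a" for a t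
    using z[of a t] by (simp add: k_def algebra_simps)
  have k01: "k 0 = 0" "k 1 = 0" by (simp_all add: k_def)
  have kn: "k (real n) = 0 \<and> k (real n + 1) = 0" for n
  proof (induction n)
    case (Suc n)
    then show ?case using zk[of "real n + 1" 1] by (simp add: add.commute)
  qed (use k01 in simp)
  have km: "k (- real n) = 0" for n using zk[of 0 "real n"] kn[of n] k01 by simp
  obtain n where n: "real n > \<bar>t\<bar>" using reals_Archimedean2 by blast
  have "k t = 0"
  proof (rule concave_eq_zero[where g = k and R = "real n"])
    show "continuous_on {- real n..real n} k" unfolding k_def
      by (intro continuous_intros continuous_on_subset[OF cont]) auto
  qed (use n zk kn km k01 in auto)
  then show ?thesis by (simp add: k_def)
qed

text \<open>The threshold N may depend on the point: rescaled functions are controlled at contact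
  points only, and these approach a given x only for large n.\<close>

definition asymp_equicontinuous :: "(nat \<Rightarrow> 'a::metric_space \<Rightarrow> 'b::metric_space) \<Rightarrow> bool" where
  "asymp_equicontinuous F \<longleftrightarrow> (\<forall>x. \<forall>e>0. \<exists>d>0. \<exists>N. \<forall>n\<ge>N. \<forall>y. dist y x < d \<longrightarrow> dist (F n y) (F n x) < e)"

lemma asymp_equicontinuous_subseq:
  assumes "asymp_equicontinuous F" "strict_mono (k :: nat \<Rightarrow> nat)"
  shows "asymp_equicontinuous (\<lambda>n. F (k n))"
  using assms unfolding asymp_equicontinuous_def
  by (meson le_trans seq_suble)

lemma asymp_equicontinuous_subsequence:
  fixes F :: "nat \<Rightarrow> 'a::euclidean_space \<Rightarrow> 'b::euclidean_space"
  assumes ae: "asymp_equicontinuous F" and bd: "\<And>n y. norm (F n y) \<le> B y"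
  obtains k G where "strict_mono (k :: nat \<Rightarrow> nat)" "\<And>y. (\<lambda>n. F (k n) y) \<longlonglongrightarrow> G y"
proof -
  obtain D :: "'a set" where D: "countable D" "\<And>X. open X \<Longrightarrow> X \<noteq> {} \<Longrightarrow> \<exists>d\<in>D. d \<in> X"
    using countable_dense_exists by metis
  \<comment> \<open>\<open>function_convergent_subsequence\<close> takes one bound for all points,
    whereas B depends on y; hence the values are normalised by \<open>b y\<close>, where the summand
    1 keeps the divisor positive.\<close>
  define b where "b y = \<bar>B y\<bar> + 1" for y
  have b: "b y > 0" for y by (simp add: b_def)
  have "norm (F n y /\<^sub>R b y) \<le> 1" for n y
    using bd[of n y] b[of y] by (simp add: b_def divide_simps)
  then obtain k where k: "strict_mono (k :: nat \<Rightarrow> nat)"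
    "\<And>y. y \<in> D \<Longrightarrow> \<exists>l. (\<lambda>n. F (k n) y /\<^sub>R b y) \<longlonglongrightarrow> l"
    using function_convergent_subsequence[OF D(1), of "\<lambda>n y. F n y /\<^sub>R b y" 1] by metis
  have conv: "convergent (\<lambda>n. F (k n) y)" if "y \<in> D" for y
  proof -
    obtain l where "(\<lambda>n. F (k n) y /\<^sub>R b y) \<longlonglongrightarrow> l" using k(2) \<open>y \<in> D\<close> by blast
    then have "(\<lambda>n. b y *\<^sub>R (F (k n) y /\<^sub>R b y)) \<longlonglongrightarrow> b y *\<^sub>R l" by (intro tendsto_intros)
    then show ?thesis using b[of y] by (auto simp: convergent_def)
  qed
  have "convergent (\<lambda>n. F (k n) x)" for x
  proof -
    have "Cauchy (\<lambda>n. F (k n) x)"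
    proof (rule metric_CauchyI)
      fix e :: real assume "e > 0"
      then obtain d N where d: "d > 0" "\<And>n y. n \<ge> N \<Longrightarrow> dist y x < d \<Longrightarrow> dist (F (k n) y) (F (k n) x) < e / 3"
        using asymp_equicontinuous_subseq[OF ae k(1)] unfolding asymp_equicontinuous_def
        by (metis zero_less_divide_iff zero_less_numeral)
      obtain y where y: "y \<in> D" "y \<in> ball x d"
        using D(2)[of "ball x d"] d(1) by auto
      obtain M where M: "\<And>m n. m \<ge> M \<Longrightarrow> n \<ge> M \<Longrightarrow> dist (F (k m) y) (F (k n) y) < e / 3"
        using metric_CauchyD[OF convergent_Cauchy[OF conv[OF y(1)]], of "e / 3"] \<open>e > 0\<close> by auto
      show "\<exists>M. \<forall>m\<ge>M. \<forall>n\<ge>M. dist (F (k m) x) (F (k n) x) < e"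
      proof (intro exI[of _ "max M N"] allI impI)
        fix m n assume "m \<ge> max M N" "n \<ge> max M N"
        then have "dist (F (k m) y) (F (k m) x) < e / 3" "dist (F (k n) y) (F (k n) x) < e / 3"
          "dist (F (k m) y) (F (k n) y) < e / 3"
          using d(2)[of m y] d(2)[of n y] M y(2) by (auto simp: dist_commute)
        then show "dist (F (k m) x) (F (k n) x) < e"
          by (metis dist_commute dist_triangle_third)
      qed
    qed
    then show ?thesis by (simp add: Cauchy_convergent)
  qed
  then show thesis using that[OF k(1), of "\<lambda>y. lim (\<lambda>n. F (k n) y)"]
    by (simp add: convergent_LIMSEQ_iff)
qed

lemma asymp_equicontinuous_moving_limit:
  fixes F :: "nat \<Rightarrow> 'a::metric_space \<Rightarrow> 'b::metric_space"
  assumes ae: "asymp_equicontinuous F" and lim: "\<And>y. (\<lambda>n. F n y) \<longlonglongrightarrow> G y" and x: "x \<longlonglongrightarrow> z"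
  shows "(\<lambda>n. F n (x n)) \<longlonglongrightarrow> G z"
proof (rule metric_LIMSEQ_I)
  fix e :: real assume "e > 0"
  then obtain d N where d: "d > 0" "\<And>n y. n \<ge> N \<Longrightarrow> dist y z < d \<Longrightarrow> dist (F n y) (F n z) < e / 2"
    using ae unfolding asymp_equicontinuous_def by (metis zero_less_divide_iff zero_less_numeral)
  obtain N1 where N1: "\<And>n. n \<ge> N1 \<Longrightarrow> dist (x n) z < d" using x d(1) by (meson LIMSEQ_def)
  obtain N2 where N2: "\<And>n. n \<ge> N2 \<Longrightarrow> dist (F n z) (G z) < e / 2"
    using lim[of z] \<open>e > 0\<close> by (meson LIMSEQ_def half_gt_zero)
  show "\<exists>N. \<forall>n\<ge>N. dist (F n (x n)) (G z) < e"
  proof (intro exI[of _ "max N (max N1 N2)"] allI impI)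
    fix n assume "n \<ge> max N (max N1 N2)"
    then have "dist (F n (x n)) (F n z) < e / 2" "dist (F n z) (G z) < e / 2"
      using d(2) N1 N2 by auto
    then show "dist (F n (x n)) (G z) < e" by (metis dist_commute dist_triangle_half_l)
  qed
qed

lemma asymp_equicontinuous_uniform_limit:
  fixes F :: "nat \<Rightarrow> 'a::metric_space \<Rightarrow> 'b::metric_space"
  assumes ae: "asymp_equicontinuous F" and lim: "\<And>y. (\<lambda>n. F n y) \<longlonglongrightarrow> G y" and S: "compact S"
  shows "uniform_limit S F G sequentially"
proof (rule uniform_limitI)
  fix e :: real assume e: "e > 0"
  have "\<forall>x. \<exists>d N. d > 0 \<and> (\<forall>n\<ge>N. \<forall>y. dist y x < d \<longrightarrow> dist (F n y) (F n x) < e / 4) \<and> (\<forall>n\<ge>N. dist (F n x) (G x) < e / 4)"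
  proof
    fix x
    obtain d N where d: "d > 0" "\<And>n y. n \<ge> N \<Longrightarrow> dist y x < d \<Longrightarrow> dist (F n y) (F n x) < e / 4"
      using ae e unfolding asymp_equicontinuous_def by (metis zero_less_divide_iff zero_less_numeral)
    obtain N2 where N2: "\<And>n. n \<ge> N2 \<Longrightarrow> dist (F n x) (G x) < e / 4"
      using lim[of x] e by (meson LIMSEQ_def zero_less_divide_iff zero_less_numeral)
    show "\<exists>d N. d > 0 \<and> (\<forall>n\<ge>N. \<forall>y. dist y x < d \<longrightarrow> dist (F n y) (F n x) < e / 4) \<and> (\<forall>n\<ge>N. dist (F n x) (G x) < e / 4)"
      by (rule exI[of _ d], rule exI[of _ "max N N2"]) (use d N2 in auto)
  qed
  then obtain d N where dN: "\<And>x. d x > 0"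
    "\<And>x n y. n \<ge> N x \<Longrightarrow> dist y x < d x \<Longrightarrow> dist (F n y) (F n x) < e / 4"
    "\<And>x n. n \<ge> N x \<Longrightarrow> dist (F n x) (G x) < e / 4"
    by metis
  have "S \<subseteq> (\<Union>x\<in>S. ball x (d x))" using dN(1) by force
  then obtain T where T: "T \<subseteq> S" "finite T" "S \<subseteq> (\<Union>x\<in>T. ball x (d x))"
    using compactE_image[OF S, of S "\<lambda>x. ball x (d x)"] by auto
  \<comment> \<open>The inserted 0 gives the maximum a meaning when S, and so T, is empty.\<close>
  define M where "M = Max (insert 0 (N ` T))"
  have "dist (F n y) (G y) < e" if n: "n \<ge> M" and y: "y \<in> S" for n y
  proof -
    obtain x where x: "x \<in> T" "dist y x < d x" using T(3) y by (auto simp: dist_commute)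
    have "N x \<le> M" unfolding M_def using T(2) x(1) by auto
    then have n: "n \<ge> N x" using n by simp
    have near: "dist (F m y) (G x) < e / 2" if "m \<ge> N x" for m
      using dN(2)[OF that x(2)] dN(3)[OF that] dist_triangle[of "F m y" "G x" "F m x"] by linarith
    have "dist (G y) (G x) \<le> e / 2"
    proof (rule LIMSEQ_le_const2)
      show "(\<lambda>m. dist (F m y) (G x)) \<longlonglongrightarrow> dist (G y) (G x)" by (intro tendsto_intros lim)
      show "\<exists>K. \<forall>m\<ge>K. dist (F m y) (G x) \<le> e / 2" using near less_imp_le by blast
    qed
    then show ?thesis using near[OF n] dist_triangle2[of "F n y" "G y" "G x"] by linarith
  qed
  then show "\<forall>\<^sub>F n in sequentially. \<forall>y\<in>S. dist (F n y) (G y) < e"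
    unfolding eventually_sequentially by blast
qed

section \<open>Families closed under blow-up\<close>

text \<open>A slope is a pair of gradients, one for each component of a map into
  \<open>real \<times> real\<close>; this is the derivative it represents.\<close>

definition lin :: "'a::real_inner \<times> 'a \<Rightarrow> 'a \<Rightarrow> real \<times> real" where
  "lin s h = (fst s \<bullet> h, snd s \<bullet> h)"

lemma lin_simps [simp]:
  "lin s (x + y) = lin s x + lin s y" "lin s (x - y) = lin s x - lin s y"
  "lin s (r *\<^sub>R x) = r *\<^sub>R lin s x" "lin s 0 = 0" "lin s (- x) = - lin s x"
  "lin (s + s') x = lin s x + lin s' x" "lin (r *\<^sub>R s) x = r *\<^sub>R lin s x" "lin 0 x = 0"
  by (simp_all add: lin_def inner_simps zero_prod_def)

lemma norm_lin_le: "norm (lin s h) \<le> 2 * norm s * norm h"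
proof -
  have "norm (lin s h) \<le> \<bar>fst s \<bullet> h\<bar> + \<bar>snd s \<bullet> h\<bar>"
    unfolding lin_def using norm_Pair_le[of "fst s \<bullet> h" "snd s \<bullet> h"] by simp
  also have "\<dots> \<le> norm (fst s) * norm h + norm (snd s) * norm h"
    by (intro add_mono Cauchy_Schwarz_ineq2)
  also have "\<dots> \<le> norm s * norm h + norm s * norm h"
    using norm_fst_le[of "fst s" "snd s"] norm_snd_le[of "snd s" "fst s"]
    by (intro add_mono mult_right_mono) auto
  finally show ?thesis by (simp add: mult_ac)
qed

lemma tendsto_lin [tendsto_intros]:
  "(s \<longlongrightarrow> a) F \<Longrightarrow> (h \<longlongrightarrow> b) F \<Longrightarrow> ((\<lambda>n. lin (s n) (h n)) \<longlongrightarrow> lin a b) F"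
  unfolding lin_def by (intro tendsto_intros)

text \<open>A first-order expansion with quadratic error at one point; with the same C at every
  point it expresses C^{1,1} regularity. The slope stays under the quantifier because limits select
  it anew by compactness.\<close>

definition quad_jet :: "real \<Rightarrow> ('a::real_inner \<Rightarrow> real \<times> real) \<Rightarrow> 'a \<Rightarrow> bool" where
  "quad_jet C F x \<longleftrightarrow> (\<exists>s. \<forall>h. norm (F (x + h) - F x - lin s h) \<le> C * (norm h)\<^sup>2)"

text \<open>Testing with unit vectors along each component of s reads off the slope: the linear term
  is composed of \<open>F (x + u)\<close>, \<open>F x\<close> and the expansion error, each at most
  \<open>C * (norm x + 1)\<^sup>2\<close>.\<close>

lemma quad_jet_slope_bound:
  fixes F :: "'a::real_inner \<Rightarrow> real \<times> real"
  assumes bd: "\<And>y. norm (F y) \<le> C * (norm y)\<^sup>2"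
    and jet: "\<And>h. norm (F (x + h) - F x - lin s h) \<le> C * (norm h)\<^sup>2" and C: "C \<ge> 0"
  shows "norm s \<le> 6 * C * (norm x + 1)\<^sup>2"
proof -
  have unit: "norm (lin s u) \<le> 3 * C * (norm x + 1)\<^sup>2" if u: "norm u \<le> 1" for u
  proof -
    have "norm (F (x + u)) \<le> C * (norm x + 1)\<^sup>2"
      using bd[of "x + u"] C u norm_triangle_ineq[of x u]
      by (meson add_left_mono mult_left_mono norm_ge_zero order_trans power_mono)
    moreover have "norm (F x) \<le> C * (norm x + 1)\<^sup>2"
      using bd[of x] C by (smt (verit) mult_left_mono norm_ge_zero power_mono)
    moreover have "norm (F (x + u) - F x - lin s u) \<le> C * (norm x + 1)\<^sup>2"
      using jet[of u] C u by (smt (verit) mult_left_mono norm_ge_zero power_mono)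
    moreover have "norm (lin s u) \<le> norm (F (x + u)) + norm (F x) + norm (F (x + u) - F x - lin s u)"
      using norm_triangle_ineq4[of "F (x + u) - F x" "F (x + u) - F x - lin s u"] norm_triangle_ineq4[of "F (x + u)" "F x"]
      by simp
    ultimately show ?thesis by linarith
  qed
  have sgn: "v \<bullet> sgn v = norm v" for v :: 'a
    by (cases "v = 0") (simp_all add: sgn_div_norm inner_scaleR_right dot_square_norm power2_eq_square)
  have sgn1: "norm (sgn v) \<le> 1" for v :: 'a by (simp add: norm_sgn)
  have "norm (fst s) = \<bar>fst (lin s (sgn (fst s)))\<bar>"
    by (simp add: lin_def sgn)
  also have "\<dots> \<le> 3 * C * (norm x + 1)\<^sup>2"
    using unit[OF sgn1[of "fst s"]] norm_fst_le[of "fst (lin s (sgn (fst s)))" "snd (lin s (sgn (fst s)))"]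
    by simp
  finally have 1: "norm (fst s) \<le> 3 * C * (norm x + 1)\<^sup>2" .
  have "norm (snd s) = \<bar>snd (lin s (sgn (snd s)))\<bar>"
    by (simp add: lin_def sgn)
  also have "\<dots> \<le> 3 * C * (norm x + 1)\<^sup>2"
    using unit[OF sgn1[of "snd s"]] norm_snd_le[of "snd (lin s (sgn (snd s)))" "fst (lin s (sgn (snd s)))"]
    by simp
  finally have 2: "norm (snd s) \<le> 3 * C * (norm x + 1)\<^sup>2" .
  show ?thesis using 1 2 norm_Pair_le[of "fst s" "snd s"] by simp
qed

lemma continuous_on_quad_jet:
  fixes F :: "'a::real_inner \<Rightarrow> real \<times> real"
  assumes "\<And>x. quad_jet C F x"
  shows "continuous_on UNIV F"
proof -
  have "isCont F x" for x
  proof -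
    obtain s where s: "\<And>h. norm (F (x + h) - F x - lin s h) \<le> C * (norm h)\<^sup>2"
      using assms[of x] by (auto simp: quad_jet_def)
    have "((\<lambda>h. C * (norm h)\<^sup>2) \<longlongrightarrow> 0) (at (0::'a))" by (auto intro!: tendsto_eq_intros)
    then have "((\<lambda>h. F (x + h) - F x - lin s h) \<longlongrightarrow> 0) (at 0)"
      by (rule Lim_null_comparison[OF always_eventually[OF allI[OF s]]])
    then have "((\<lambda>h. (F (x + h) - F x - lin s h) + F x + lin s h) \<longlongrightarrow> 0 + F x + lin s 0) (at 0)"
      by (intro tendsto_intros)
    then show ?thesis by (simp add: isCont_iff)
  qed
  then show ?thesis by (simp add: continuous_at_imp_continuous_on)
qed

text \<open>A nearby point \<open>k n\<close> serves as base point for both x and y: expanding there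
  turns \<open>F n y - F n x\<close> into two quadratic errors plus a linear term whose slope is
  bounded uniformly in n. No jet at x itself is assumed.\<close>

lemma quad_jet_asymp_equicontinuous:
  fixes F :: "nat \<Rightarrow> 'a::real_inner \<Rightarrow> real \<times> real"
  assumes bd: "\<And>n y. norm (F n y) \<le> C * (norm y)\<^sup>2" and C: "C \<ge> 0"
    and jets: "\<And>n k. k \<in> K n \<Longrightarrow> quad_jet C (F n) k"
    and dense: "\<And>y. \<exists>k. (\<forall>n. k n \<in> K n) \<and> k \<longlonglongrightarrow> y"
  shows "asymp_equicontinuous F"
  unfolding asymp_equicontinuous_def
proof (intro allI impI)
  fix x :: 'a and e :: real assume e: "e > 0"
  define A where "A = 6 * C * (norm x + 2)\<^sup>2"
  have A: "A \<ge> 0" using C by (simp add: A_def)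
  \<comment> \<open>For d \<le> 1 the errors 4 C d^2, C d^2 and 2 A d sum to at most (5 C + 4 A) d;
    the added 1 makes the final inequality strict and the divisor positive.\<close>
  define d where "d = min 1 (e / (5 * C + 4 * A + 1))"
  have d: "d > 0" "d \<le> 1" using e A C by (auto simp: d_def)
  have "(5 * C + 4 * A) * d < (5 * C + 4 * A + 1) * d" using d by simp
  also have "\<dots> \<le> (5 * C + 4 * A + 1) * (e / (5 * C + 4 * A + 1))"
    using A C by (intro mult_left_mono) (auto simp: d_def)
  also have "\<dots> = e" using A C by (simp add: add_nonneg_eq_0_iff)
  finally have de: "(5 * C + 4 * A) * d < e" .
  obtain k where k: "\<And>n. k n \<in> K n" "k \<longlonglongrightarrow> x" using dense by blast
  obtain N where N: "\<And>n. n \<ge> N \<Longrightarrow> dist (k n) x < d" using k(2) d(1) by (meson LIMSEQ_def)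
  show "\<exists>d>0. \<exists>N. \<forall>n\<ge>N. \<forall>y. dist y x < d \<longrightarrow> dist (F n y) (F n x) < e"
  proof (intro exI[of _ d] exI[of _ N] conjI allI impI)
    fix n y assume n: "n \<ge> N" and y: "dist y x < d"
    obtain s where s: "\<And>h. norm (F n (k n + h) - F n (k n) - lin s h) \<le> C * (norm h)\<^sup>2"
      using jets[OF k(1)[of n]] by (auto simp: quad_jet_def)
    have kx: "norm (x - k n) < d" using N[OF n] by (simp add: dist_norm norm_minus_commute)
    have yx: "norm (y - x) < d" using y by (simp add: dist_norm)
    have "norm (k n) \<le> norm x + 1"
      using kx d norm_triangle_ineq4[of x "x - k n"] by simp
    then have "6 * C * (norm (k n) + 1)\<^sup>2 \<le> A" unfolding A_def
      using C by (intro mult_left_mono power_mono) auto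
    then have sA: "norm s \<le> A"
      using quad_jet_slope_bound[OF bd s C] by linarith
    have yk: "norm (y - k n) \<le> 2 * d"
      using norm_triangle_ineq[of "y - x" "x - k n"] kx yx by simp
    have "norm (F n y - F n (k n) - lin s (y - k n)) \<le> C * (norm (y - k n))\<^sup>2" using s[of "y - k n"] by simp
    also have "\<dots> \<le> C * (2 * d)\<^sup>2" using yk C by (intro mult_left_mono power_mono) auto
    finally have 1: "norm (F n y - F n (k n) - lin s (y - k n)) \<le> 4 * C * d\<^sup>2" by (simp add: power_mult_distrib)
    have "norm (F n x - F n (k n) - lin s (x - k n)) \<le> C * (norm (x - k n))\<^sup>2" using s[of "x - k n"] by simp
    also have "\<dots> \<le> C * d\<^sup>2" using kx C by (intro mult_left_mono power_mono) auto
    finally have 2: "norm (F n x - F n (k n) - lin s (x - k n)) \<le> C * d\<^sup>2" .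
    have "norm (lin s (y - x)) \<le> 2 * norm s * norm (y - x)" by (rule norm_lin_le)
    also have "\<dots> \<le> 2 * A * d" using sA yx A by (intro mult_mono) auto
    finally have 3: "norm (lin s (y - x)) \<le> 2 * A * d" .
    have "F n y - F n x = (F n y - F n (k n) - lin s (y - k n)) - (F n x - F n (k n) - lin s (x - k n)) + lin s (y - x)"
      by simp
    also have "norm \<dots> \<le> 4 * C * d\<^sup>2 + C * d\<^sup>2 + 2 * A * d"
      using norm_triangle_ineq norm_triangle_ineq4 1 2 3 by (smt (verit))
    also have "\<dots> \<le> (5 * C + 4 * A) * d"
    proof -
      have "d\<^sup>2 \<le> d" using d by (simp add: power2_eq_square mult_left_le)
      then have "5 * C * d\<^sup>2 \<le> 5 * C * d" using C by (intro mult_left_mono) auto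
      moreover have "0 \<le> A * d" using A d by simp
      ultimately show ?thesis by (simp add: algebra_simps)
    qed
    finally show "dist (F n y) (F n x) < e" using de by (simp add: dist_norm)
  qed (use d in auto)
qed

text \<open>Slopes are bounded along the convergent base points, so a subsequence of them converges
  and the expansion passes to the limit while its base point moves.\<close>

lemma quad_jet_limit:
  fixes F :: "nat \<Rightarrow> 'a::euclidean_space \<Rightarrow> real \<times> real"
  assumes bd: "\<And>n y. norm (F n y) \<le> C * (norm y)\<^sup>2" and C: "C \<ge> 0"
    and jets: "\<And>n. quad_jet C (F n) (k n)" and k: "k \<longlonglongrightarrow> x"
    and ae: "asymp_equicontinuous F" and lim: "\<And>y. (\<lambda>n. F n y) \<longlonglongrightarrow> G y"
  shows "quad_jet C G x"
proof -
  obtain s where s: "\<And>n h. norm (F n (k n + h) - F n (k n) - lin (s n) h) \<le> C * (norm h)\<^sup>2"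
    using jets unfolding quad_jet_def by metis
  obtain B where B: "\<And>n. norm (k n) \<le> B" using convergent_imp_Bseq[of k] k
    by (auto simp: convergent_def Bseq_def)
  have "norm (s n) \<le> 6 * C * (B + 1)\<^sup>2" for n
  proof -
    have "6 * C * (norm (k n) + 1)\<^sup>2 \<le> 6 * C * (B + 1)\<^sup>2"
      using C B[of n] by (intro mult_left_mono power_mono) auto
    then show ?thesis using quad_jet_slope_bound[OF bd s C, of n] by linarith
  qed
  then have "bounded (range s)" by (auto simp: bounded_iff)
  then obtain l j where j: "strict_mono (j :: nat \<Rightarrow> nat)" "(s \<circ> j) \<longlonglongrightarrow> l"
    using bounded_imp_convergent_subsequence by metis
  have lim': "(\<lambda>n. F (j n) y) \<longlonglongrightarrow> G y" for y
    using LIMSEQ_subseq_LIMSEQ[OF lim j(1)] by (simp add: o_def)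
  have kj: "(\<lambda>n. k (j n)) \<longlonglongrightarrow> x" using LIMSEQ_subseq_LIMSEQ[OF k j(1)] by (simp add: o_def)
  note mv = asymp_equicontinuous_moving_limit[OF asymp_equicontinuous_subseq[OF ae j(1)] lim']
  have "norm (G (x + h) - G x - lin l h) \<le> C * (norm h)\<^sup>2" for h
  proof (rule LIMSEQ_le_const2)
    show "(\<lambda>n. norm (F (j n) (k (j n) + h) - F (j n) (k (j n)) - lin (s (j n)) h)) \<longlonglongrightarrow> norm (G (x + h) - G x - lin l h)"
      using j(2) by (intro tendsto_intros mv kj) (simp add: o_def)
  qed (use s in blast)
  then show ?thesis unfolding quad_jet_def by blast
qed

text \<open>Ascoli's theorem in the form used for blow-ups. The members have jets only on
  \<open>K n\<close>, yet the limit has them everywhere, because every point is a limit of points of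
  the \<open>K n\<close>.\<close>

lemma quad_jet_compactness:
  fixes F :: "nat \<Rightarrow> 'a::euclidean_space \<Rightarrow> real \<times> real"
  assumes bd: "\<And>n y. norm (F n y) \<le> C * (norm y)\<^sup>2" and C: "C \<ge> 0"
    and jets: "\<And>n k. k \<in> K n \<Longrightarrow> quad_jet C (F n) k"
    and dense: "\<And>y. \<exists>k. (\<forall>n. k n \<in> K n) \<and> k \<longlonglongrightarrow> y"
  obtains j G where "strict_mono (j :: nat \<Rightarrow> nat)" "asymp_equicontinuous (\<lambda>n. F (j n))"
    "\<And>y. (\<lambda>n. F (j n) y) \<longlonglongrightarrow> G y" "\<And>x. quad_jet C G x" "\<And>y. norm (G y) \<le> C * (norm y)\<^sup>2"
proof -
  have ae: "asymp_equicontinuous F" by (rule quad_jet_asymp_equicontinuous[OF bd C jets dense])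
  obtain j G where j: "strict_mono (j :: nat \<Rightarrow> nat)" and lim: "\<And>y. (\<lambda>n. F (j n) y) \<longlonglongrightarrow> G y"
    using asymp_equicontinuous_subsequence[OF ae bd] by metis
  have "quad_jet C G x" for x
  proof -
    obtain k where k: "\<And>n. k n \<in> K n" "k \<longlonglongrightarrow> x" using dense by blast
    show ?thesis
      by (rule quad_jet_limit[OF bd C jets[OF k(1)] _ asymp_equicontinuous_subseq[OF ae j] lim])
        (use LIMSEQ_subseq_LIMSEQ[OF k(2) j] in \<open>simp add: o_def\<close>)
  qed
  moreover have "norm (G y) \<le> C * (norm y)\<^sup>2" for y
    by (rule LIMSEQ_le_const2[OF tendsto_norm[OF lim]]) (use bd in blast)
  ultimately show thesis using that[OF j asymp_equicontinuous_subseq[OF ae j] lim] by blast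
qed

section \<open>Second differences and rescaling\<close>

definition second_diff :: "('a::real_vector \<Rightarrow> 'b::real_vector) \<Rightarrow> 'a \<Rightarrow> 'a \<Rightarrow> 'b" where
  "second_diff F x h = F (x + h) + F (x - h) - 2 *\<^sub>R F x"

text \<open>Division by r^2 leaves the coefficients of a quadratic form and the constant of a jet
  unchanged under zooming. The slope \<open>s\<close> belongs to the rescaled variable, so it stands
  for the slope \<open>s /\<^sub>R r\<close> of F.\<close>

definition recenter :: "'a::real_inner \<Rightarrow> real \<Rightarrow> real \<times> real \<Rightarrow> 'a \<times> 'a \<Rightarrow> ('a \<Rightarrow> real \<times> real) \<Rightarrow> 'a \<Rightarrow> real \<times> real" where
  "recenter x r b s F y = (F (x + r *\<^sub>R y) - b - lin s y) /\<^sub>R r\<^sup>2"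

lemma second_diff_recenter:
  "second_diff (recenter x r b s F) y h = second_diff F (x + r *\<^sub>R y) (r *\<^sub>R h) /\<^sub>R r\<^sup>2"
proof -
  have "recenter x r b s F (y + h) + recenter x r b s F (y - h) - 2 *\<^sub>R recenter x r b s F y
      = (F (x + r *\<^sub>R (y + h)) + F (x + r *\<^sub>R (y - h)) - 2 *\<^sub>R F (x + r *\<^sub>R y)) /\<^sub>R r\<^sup>2"
  proof -
    have "2 *\<^sub>R recenter x r b s F y = ((F (x + r *\<^sub>R y) - b - lin s y) + (F (x + r *\<^sub>R y) - b - lin s y)) /\<^sub>R r\<^sup>2"
      by (simp only: recenter_def scaleR_2 scaleR_add_right)
    then show ?thesis
      by (simp only: recenter_def flip: scaleR_add_right scaleR_diff_right) (simp add: scaleR_2)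
  qed
  moreover have "x + r *\<^sub>R (y + h) = x + r *\<^sub>R y + r *\<^sub>R h" "x + r *\<^sub>R (y - h) = x + r *\<^sub>R y - r *\<^sub>R h"
    by (simp_all add: scaleR_add_right scaleR_diff_right)
  ultimately show ?thesis by (simp only: second_diff_def)
qed

lemma quad_jet_second_diff:
  assumes "quad_jet C F x"
  shows "norm (second_diff F x h) \<le> 2 * C * (norm h)\<^sup>2"
proof -
  obtain s where s: "\<And>h. norm (F (x + h) - F x - lin s h) \<le> C * (norm h)\<^sup>2"
    using assms by (auto simp: quad_jet_def)
  have "second_diff F x h = (F (x + h) - F x - lin s h) + (F (x + - h) - F x - lin s (- h))"
    by (simp add: second_diff_def scaleR_2)
  then have "norm (second_diff F x h) \<le> norm (F (x + h) - F x - lin s h) + norm (F (x + - h) - F x - lin s (- h))"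
    by (simp only: norm_triangle_ineq)
  also have "\<dots> \<le> C * (norm h)\<^sup>2 + C * (norm (- h))\<^sup>2" by (intro add_mono s)
  finally show ?thesis by simp
qed

text \<open>Recentring comprises translation, zooming and subtraction of any affine function. Every
  member can thus be normalised to vanish to first order at a chosen point, and normalised members
  have convergent subsequences.\<close>

definition jet_family :: "real \<Rightarrow> ('a::euclidean_space \<Rightarrow> real \<times> real) set \<Rightarrow> bool" where
  "jet_family C \<F> \<longleftrightarrow> (\<forall>F\<in>\<F>. \<forall>x. quad_jet C F x)
    \<and> (\<forall>F\<in>\<F>. \<forall>x r b s. r > 0 \<longrightarrow> recenter x r b s F \<in> \<F>)
    \<and> (\<forall>F G. (\<forall>n. F n \<in> \<F>) \<and> (\<forall>S. compact S \<longrightarrow> uniform_limit S F G sequentially)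
        \<and> (\<forall>x. quad_jet C G x) \<longrightarrow> G \<in> \<F>)"

lemma jet_family_jet:
  assumes "jet_family C \<F>" "F \<in> \<F>"
  shows "quad_jet C F x"
proof -
  have "\<forall>F\<in>\<F>. \<forall>x. quad_jet C F x" using assms(1) unfolding jet_family_def by (elim conjE)
  from bspec[OF this assms(2)] show ?thesis ..
qed

lemma jet_family_recenter:
  assumes "jet_family C \<F>" "F \<in> \<F>" "r > 0"
  shows "recenter x r b s F \<in> \<F>"
proof -
  have "\<forall>F\<in>\<F>. \<forall>x r b s. r > 0 \<longrightarrow> recenter x r b s F \<in> \<F>"
    using assms(1) unfolding jet_family_def by (elim conjE)
  from bspec[OF this assms(2)] assms(3) show ?thesis by (elim allE impE)
qed

lemma jet_family_closed:
  assumes "jet_family C \<F>" "\<And>n. F n \<in> \<F>" "\<And>S. compact S \<Longrightarrow> uniform_limit S F G sequentially"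
    "\<And>x. quad_jet C G x"
  shows "G \<in> \<F>"
proof -
  have "\<forall>F G. (\<forall>n. F n \<in> \<F>) \<and> (\<forall>S. compact S \<longrightarrow> uniform_limit S F G sequentially)
        \<and> (\<forall>x. quad_jet C G x) \<longrightarrow> G \<in> \<F>"
    using assms(1) unfolding jet_family_def by (elim conjE)
  then have "(\<forall>n. F n \<in> \<F>) \<and> (\<forall>S. compact S \<longrightarrow> uniform_limit S F G sequentially)
      \<and> (\<forall>x. quad_jet C G x) \<longrightarrow> G \<in> \<F>" by (elim allE)
  then show ?thesis by (rule mp) (intro conjI allI impI assms(2-4))
qed

lemma jet_family_normalize:
  assumes fam: "jet_family C \<F>" and F: "F \<in> \<F>" and r: "r > 0"
  obtains s where "recenter x r (F x) s F \<in> \<F>" "\<And>y. norm (recenter x r (F x) s F y) \<le> C * (norm y)\<^sup>2"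
proof -
  obtain s where s: "\<And>h. norm (F (x + h) - F x - lin s h) \<le> C * (norm h)\<^sup>2"
    using jet_family_jet[OF fam F, of x] unfolding quad_jet_def by blast
  have "norm (recenter x r (F x) (r *\<^sub>R s) F y) \<le> C * (norm y)\<^sup>2" for y
    using s[of "r *\<^sub>R y"] r by (simp add: recenter_def divide_simps power_mult_distrib mult_ac)
  then show thesis by (rule that[OF jet_family_recenter[OF fam F r]])
qed

lemma jet_family_compact:
  assumes fam: "jet_family C \<F>" and C: "C \<ge> 0" and F: "\<And>n. F n \<in> \<F>"
    and bd: "\<And>n y. norm (F n y) \<le> C * (norm y)\<^sup>2"
  obtains j G where "strict_mono (j :: nat \<Rightarrow> nat)" "G \<in> \<F>" "\<And>y. norm (G y) \<le> C * (norm y)\<^sup>2"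
    "\<And>y. (\<lambda>n. F (j n) y) \<longlonglongrightarrow> G y"
proof -
  have jets: "quad_jet C (F n) k" for n k by (rule jet_family_jet[OF fam F])
  have dense: "\<exists>k. (\<forall>n :: nat. k n \<in> UNIV) \<and> k \<longlonglongrightarrow> y" for y :: 'a by (rule exI[of _ "\<lambda>_. y"]) simp
  obtain j G where j: "strict_mono (j :: nat \<Rightarrow> nat)" "asymp_equicontinuous (\<lambda>n. F (j n))"
    "\<And>y. (\<lambda>n. F (j n) y) \<longlonglongrightarrow> G y" "\<And>x. quad_jet C G x" "\<And>y. norm (G y) \<le> C * (norm y)\<^sup>2"
  proof -
    show thesis if that: "\<And>j G. \<lbrakk>strict_mono (j :: nat \<Rightarrow> nat); asymp_equicontinuous (\<lambda>n. F (j n));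
      \<And>y. (\<lambda>n. F (j n) y) \<longlonglongrightarrow> G y; \<And>x. quad_jet C G x; \<And>y. norm (G y) \<le> C * (norm y)\<^sup>2\<rbrakk> \<Longrightarrow> thesis"
      by (rule quad_jet_compactness[where F = F and C = C and K = "\<lambda>_. UNIV", OF bd C jets dense]) (rule that)
  qed
  have "uniform_limit S (\<lambda>n. F (j n)) G sequentially" if "compact S" for S
    by (rule asymp_equicontinuous_uniform_limit[OF j(2,3) that])
  then have "G \<in> \<F>" using jet_family_closed[where F = "\<lambda>n. F (j n)", OF fam F _ j(4)] by simp
  then show thesis by (rule that[OF j(1) _ j(5) j(3)])
qed

lemma tendsto_second_diff:
  assumes "\<And>y. (\<lambda>n. F n y) \<longlonglongrightarrow> (G y :: 'b::real_normed_vector)"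
  shows "(\<lambda>n. second_diff (F n) x h) \<longlonglongrightarrow> second_diff G x h"
  unfolding second_diff_def by (intro tendsto_intros assms)

section \<open>Extremal members of a family\<close>

lemma norm_inner_second_diff_le:
  assumes "quad_jet C F x" "C \<ge> 0"
  shows "\<bar>c \<bullet> second_diff F x h\<bar> \<le> norm c * (2 * C * (norm h)\<^sup>2)"
  using Cauchy_Schwarz_ineq2[of c "second_diff F x h"] quad_jet_second_diff[OF assms(1), of h]
  by (meson mult_left_mono norm_ge_zero order_trans)

text \<open>Second differences in direction \<open>e\<close>, divided by the squared step, have a maximum over the
  family because of the invariance under recentring. Concavity makes the maximiser exactly
  quadratic on a segment, and zooming in makes it quadratic along a whole line through the origin.
  The symmetrised restriction to any parallel line is then concave and bounded, hence constant.\<close>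

lemma jet_family_extremal:
  fixes \<F> :: "('a::euclidean_space \<Rightarrow> real \<times> real) set"
  assumes fam: "jet_family C \<F>" and C: "C \<ge> 0" and ne: "\<F> \<noteq> {}"
  obtains F M where "F \<in> \<F>" "\<And>x t. c \<bullet> second_diff F x (t *\<^sub>R e) = M * t\<^sup>2"
proof -
  define nrm where "nrm F \<longleftrightarrow> F \<in> \<F> \<and> (\<forall>y. norm (F y) \<le> C * (norm y)\<^sup>2)" for F
  have jet: "quad_jet C F x" if "F \<in> \<F>" for F x
    by (rule jet_family_jet[OF fam that])
  \<comment> \<open>The step e at the origin is enough: recentring at x with factor t turns the
    second difference with step \<open>t *\<^sub>R e\<close> at x into t^2 times one of this form.
    Normalised members lose nothing, since second differences ignore affine terms, and compactness
    applies to them.\<close>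
  define V where "V = (\<lambda>F. c \<bullet> second_diff F 0 e) ` {F. nrm F}"
  have Vb: "\<bar>v\<bar> \<le> norm c * (2 * C * (norm e)\<^sup>2)" if "v \<in> V" for v
    using that norm_inner_second_diff_le[OF jet C] unfolding V_def nrm_def by blast
  have bdd: "bdd_above V" using Vb by (meson abs_le_D1 bdd_aboveI)
  obtain F0 where "F0 \<in> \<F>" using ne by blast
  then obtain s where "nrm (recenter 0 1 (F0 0) s F0)"
    using jet_family_normalize[OF fam, of F0 1 0] zero_less_one nrm_def by metis
  then have Vne: "V \<noteq> {}" unfolding V_def by blast
  define M where "M = Sup V"
  have upper: "c \<bullet> second_diff F x (t *\<^sub>R e) \<le> M * t\<^sup>2" if F: "F \<in> \<F>" for F x t
  proof -
    have pos: "c \<bullet> second_diff F x (t *\<^sub>R e) \<le> M * t\<^sup>2" if t: "t > 0" for t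
    proof -
      obtain s where "nrm (recenter x t (F x) s F)"
        using jet_family_normalize[OF fam F t, of x] nrm_def by metis
      then have "c \<bullet> second_diff (recenter x t (F x) s F) 0 e \<le> M"
        unfolding M_def by (intro cSup_upper bdd) (auto simp: V_def)
      then show ?thesis using t by (simp add: second_diff_recenter divide_simps mult_ac)
    qed
    have sym: "second_diff F x (- h) = second_diff F x h" for h
      by (simp add: second_diff_def)
    consider "t > 0" | "t = 0" | "- t > 0" by linarith
    then show ?thesis
    proof cases
      case 3
      then show ?thesis using pos[OF 3] sym[of "t *\<^sub>R e"] by simp
    qed (use pos in \<open>auto simp: second_diff_def scaleR_2\<close>)
  qed
  have "\<exists>F. nrm F \<and> c \<bullet> second_diff F 0 e > M - 1 / real (Suc n)" for n
    using less_cSup_iff[OF Vne bdd, of "M - 1 / real (Suc n)"] unfolding M_def[symmetric] by (auto simp: V_def)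
  then obtain F where F: "\<And>n. nrm (F n)" "\<And>n. c \<bullet> second_diff (F n) 0 e > M - 1 / real (Suc n)"
    by metis
  have F': "\<And>n. F n \<in> \<F>" "\<And>n y. norm (F n y) \<le> C * (norm y)\<^sup>2" using F(1) by (auto simp: nrm_def)
  obtain j G where j: "strict_mono (j :: nat \<Rightarrow> nat)" and G: "G \<in> \<F>" "\<And>y. norm (G y) \<le> C * (norm y)\<^sup>2"
    and lim: "\<And>y. (\<lambda>n. F (j n) y) \<longlonglongrightarrow> G y"
    by (rule jet_family_compact[where F = F, OF fam C F']) (rule that)
  have "(\<lambda>n. M - 1 / real (Suc n)) \<longlonglongrightarrow> M - 0"
    by (intro tendsto_intros LIMSEQ_Suc lim_1_over_n)
  from LIMSEQ_subseq_LIMSEQ[OF this j] have "(\<lambda>n. M - 1 / real (Suc (j n))) \<longlonglongrightarrow> M"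
    by (simp add: o_def)
  moreover have "(\<lambda>n. c \<bullet> second_diff (F (j n)) 0 e) \<longlonglongrightarrow> c \<bullet> second_diff G 0 e"
    by (intro tendsto_intros tendsto_second_diff lim)
  ultimately have "M \<le> c \<bullet> second_diff G 0 e"
    by (rule LIMSEQ_le) (intro exI allI impI less_imp_le[OF F(2)])
  then have GM: "c \<bullet> second_diff G 0 e = M" using upper[OF G(1), of 0 1] by simp
  have contG: "continuous_on UNIV G" by (rule continuous_on_quad_jet) (rule jet[OF G(1)])
  have seg: "c \<bullet> second_diff G (a *\<^sub>R e) (t *\<^sub>R e) = M * t\<^sup>2" if at: "\<bar>a\<bar> + \<bar>t\<bar> \<le> 1" for a t
  proof -
    \<comment> \<open>The slope of the chord over [0, 1] once the parabola is removed, so that g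
      vanishes at 0 and 1; the value attained by G at the origin adds the zero at -1.\<close>
    define L where "L = c \<bullet> G e - c \<bullet> G 0 - M / 2"
    define g where "g t = c \<bullet> G (t *\<^sub>R e) - M * t\<^sup>2 / 2 - c \<bullet> G 0 - t * L" for t
    have sdg: "g (a + t) + g (a - t) - 2 * g a = c \<bullet> second_diff G (a *\<^sub>R e) (t *\<^sub>R e) - M * t\<^sup>2" for a t
      by (simp add: g_def second_diff_def inner_simps scaleR_left_distrib scaleR_left_diff_distrib power2_eq_square field_simps)
    have gz: "g 0 = 0" "g 1 = 0" by (simp_all add: g_def L_def)
    have conc: "g (a + t) + g (a - t) \<le> 2 * g a" for a t
      using sdg[of a t] upper[OF G(1), of "a *\<^sub>R e" t] by simp
    have gm: "g (- 1) = 0" using sdg[of 0 1] gz GM by simp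
    have z: "g t = 0" if "\<bar>t\<bar> \<le> 1" for t
    proof (rule concave_eq_zero[where g = g and R = 1])
      show "continuous_on {-1..1} g" unfolding g_def
        by (intro continuous_intros continuous_on_compose2[OF contG]) auto
    qed (use conc gz gm that in auto)
    have "\<bar>a + t\<bar> \<le> 1" "\<bar>a - t\<bar> \<le> 1" "\<bar>a\<bar> \<le> 1" using at by linarith+
    then show ?thesis using sdg[of a t] z by simp
  qed
  \<comment> \<open>Zooming in at 0 stretches the segment to length n + 1 on each side. No affine
    part has to be removed, as G is already bounded by \<open>C * (norm y)\<^sup>2\<close>.\<close>
  define E where "E n = recenter 0 (1 / real (Suc n)) 0 0 G" for n
  have E: "E n \<in> \<F>" for n
    unfolding E_def by (rule jet_family_recenter[OF fam G(1)]) simp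
  have Eb: "norm (E n y) \<le> C * (norm y)\<^sup>2" for n y
    using G(2)[of "y /\<^sub>R real (Suc n)"]
    by (simp add: E_def recenter_def divide_simps power_mult_distrib mult_ac del: of_nat_Suc)
  have Esd: "c \<bullet> second_diff (E n) (a *\<^sub>R e) (t *\<^sub>R e) = M * t\<^sup>2" if "\<bar>a\<bar> + \<bar>t\<bar> \<le> real (Suc n)" for n a t
  proof -
    have "\<bar>a / real (Suc n)\<bar> + \<bar>t / real (Suc n)\<bar> \<le> 1"
      using that by (simp add: abs_divide divide_simps del: of_nat_Suc)
    from seg[OF this] show ?thesis
      by (simp add: E_def second_diff_recenter divide_simps power_divide mult_ac del: of_nat_Suc)
  qed
  obtain j K where j: "strict_mono (j :: nat \<Rightarrow> nat)" and K: "K \<in> \<F>" "\<And>y. norm (K y) \<le> C * (norm y)\<^sup>2"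
    and lim: "\<And>y. (\<lambda>n. E (j n) y) \<longlonglongrightarrow> K y"
    by (rule jet_family_compact[where F = E, OF fam C E Eb]) (rule that)
  note K = K(1)
  have line: "c \<bullet> second_diff K (a *\<^sub>R e) (t *\<^sub>R e) = M * t\<^sup>2" for a t
  proof (rule LIMSEQ_unique)
    show "(\<lambda>n. c \<bullet> second_diff (E (j n)) (a *\<^sub>R e) (t *\<^sub>R e)) \<longlonglongrightarrow> c \<bullet> second_diff K (a *\<^sub>R e) (t *\<^sub>R e)"
      by (intro tendsto_intros tendsto_second_diff lim)
    obtain N where N: "\<bar>a\<bar> + \<bar>t\<bar> \<le> real N" using real_arch_simple by blast
    have "c \<bullet> second_diff (E (j n)) (a *\<^sub>R e) (t *\<^sub>R e) = M * t\<^sup>2" if "n \<ge> N" for n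
    proof (rule Esd)
      show "\<bar>a\<bar> + \<bar>t\<bar> \<le> real (Suc (j n))" using N that seq_suble[OF j, of n] by linarith
    qed
    then show "(\<lambda>n. c \<bullet> second_diff (E (j n)) (a *\<^sub>R e) (t *\<^sub>R e)) \<longlonglongrightarrow> M * t\<^sup>2"
      by (intro tendsto_eventually) (auto simp: eventually_sequentially)
  qed
  have "c \<bullet> second_diff K x (t *\<^sub>R e) = M * t\<^sup>2" for x t
  proof -
    \<comment> \<open>Its second difference in a compares the lines through x and -x, where M is an
      upper bound, with the line through 0, where M is attained; hence concavity. The bound from
      below comes from the fixed step x.\<close>
    define g where "g a = c \<bullet> second_diff K (a *\<^sub>R e) x" for a
    have sdg: "g (a + t) + g (a - t) - 2 * g a
      = c \<bullet> second_diff K (x + a *\<^sub>R e) (t *\<^sub>R e) + c \<bullet> second_diff K (- x + a *\<^sub>R e) (t *\<^sub>R e)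
        - 2 * (c \<bullet> second_diff K (a *\<^sub>R e) (t *\<^sub>R e))" for a t
    proof -
      have eqs: "(a + t) *\<^sub>R e + x = x + a *\<^sub>R e + t *\<^sub>R e" "(a - t) *\<^sub>R e + x = x + a *\<^sub>R e - t *\<^sub>R e"
        "(a + t) *\<^sub>R e - x = - x + a *\<^sub>R e + t *\<^sub>R e" "(a - t) *\<^sub>R e - x = - x + a *\<^sub>R e - t *\<^sub>R e"
        "(a + t) *\<^sub>R e = a *\<^sub>R e + t *\<^sub>R e" "(a - t) *\<^sub>R e = a *\<^sub>R e - t *\<^sub>R e"
        "a *\<^sub>R e + x = x + a *\<^sub>R e" "a *\<^sub>R e - x = - x + a *\<^sub>R e"
        by (simp_all add: algebra_simps)
      show ?thesis
        by (simp only: g_def second_diff_def eqs(1-4,7,8) inner_add_right inner_diff_right inner_scaleR_right)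
          (simp add: eqs(5,6))
    qed
    have "g (0 + t) + g (0 - t) = 2 * g 0"
    proof (rule concave_bounded_below_affine)
      show "g (a + t) + g (a - t) \<le> 2 * g a" for a t
        using sdg[of a t] upper[OF K, of "x + a *\<^sub>R e" t] upper[OF K, of "- x + a *\<^sub>R e" t] line[of a t]
        by linarith
      show "- (norm c * (2 * C * (norm x)\<^sup>2)) \<le> g a" for a
        using norm_inner_second_diff_le[OF jet[OF K] C, of c "a *\<^sub>R e" x] unfolding g_def by linarith
    qed
    \<comment> \<open>Equality in the sum of the two upper bounds, at x and at -x, is equality in
      each.\<close>
    then show ?thesis
      using sdg[of 0 t] upper[OF K, of x t] upper[OF K, of "- x" t] line[of 0 t] by simp
  qed
  then show thesis by (rule that[OF K])
qed

text \<open>Being exactly quadratic in one direction, with a fixed M, survives recentring and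
  limits. Later directions can therefore be treated inside the subfamily without losing the earlier
  ones.\<close>

lemma jet_family_subfamily:
  assumes fam: "jet_family C \<F>"
  shows "jet_family C {F \<in> \<F>. \<forall>x t. c \<bullet> second_diff F x (t *\<^sub>R e) = M * t\<^sup>2}" (is "jet_family C ?G")
  unfolding jet_family_def
proof (intro conjI ballI allI impI)
  show "quad_jet C F x" if "F \<in> ?G" for F x using jet_family_jet[OF fam] that by blast
  show "recenter x r b s F \<in> ?G" if F: "F \<in> ?G" and r: "r > 0" for F x r b s
  proof -
    have "c \<bullet> second_diff (recenter x r b s F) y (t *\<^sub>R e) = M * t\<^sup>2" for y t
    proof -
      have "c \<bullet> second_diff F (x + r *\<^sub>R y) ((r * t) *\<^sub>R e) = M * (r * t)\<^sup>2" using F by blast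
      then show ?thesis using r by (simp add: second_diff_recenter power_mult_distrib divide_simps)
    qed
    then show ?thesis using jet_family_recenter[OF fam _ r] F by blast
  qed
  show "G \<in> ?G" if H: "(\<forall>n. F n \<in> ?G) \<and> (\<forall>S. compact S \<longrightarrow> uniform_limit S F G sequentially) \<and> (\<forall>x. quad_jet C G x)" for F G
  proof -
    have "G \<in> \<F>" by (rule jet_family_closed[OF fam, of F]) (use H in auto)
    moreover have "c \<bullet> second_diff G x (t *\<^sub>R e) = M * t\<^sup>2" for x t
    proof (rule LIMSEQ_unique)
      have "(\<lambda>n. F n y) \<longlonglongrightarrow> G y" for y
        by (rule tendsto_uniform_limitI[where S = "{y}", OF H[THEN conjunct2, THEN conjunct1, rule_format]]) auto
      then show "(\<lambda>n. c \<bullet> second_diff (F n) x (t *\<^sub>R e)) \<longlonglongrightarrow> c \<bullet> second_diff G x (t *\<^sub>R e)"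
        by (intro tendsto_intros tendsto_second_diff)
      show "(\<lambda>n. c \<bullet> second_diff (F n) x (t *\<^sub>R e)) \<longlonglongrightarrow> M * t\<^sup>2" using H by simp
    qed
    ultimately show ?thesis by blast
  qed
qed

text \<open>Each direction is extremised over the subfamily that is already quadratic in the others
  treated so far, so the family varies in the induction and M need not be extremal for the original
  one.\<close>

lemma jet_family_finite_directions:
  fixes \<F> :: "('a::euclidean_space \<Rightarrow> real \<times> real) set"
  assumes "finite D" and "jet_family C \<F>" and C: "C \<ge> 0" and "\<F> \<noteq> {}"
  shows "\<exists>F\<in>\<F>. \<forall>(c, e)\<in>D. \<exists>M. \<forall>x t. c \<bullet> second_diff F x (t *\<^sub>R e) = M * t\<^sup>2"
  using assms(1,2,4)
proof (induction D arbitrary: \<F> rule: finite_induct)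
  case empty
  then show ?case by auto
next
  case (insert d D)
  obtain c e where d: "d = (c, e)" by (cases d)
  obtain F M where F: "F \<in> \<F>" "\<And>x t. c \<bullet> second_diff F x (t *\<^sub>R e) = M * t\<^sup>2"
    by (rule jet_family_extremal[OF insert.prems(1) C insert.prems(2)]) (rule that)
  define \<G> where "\<G> = {F \<in> \<F>. \<forall>x t. c \<bullet> second_diff F x (t *\<^sub>R e) = M * t\<^sup>2}"
  have "jet_family C \<G>" unfolding \<G>_def by (rule jet_family_subfamily[OF insert.prems(1)])
  moreover have "\<G> \<noteq> {}" using F by (auto simp: \<G>_def)
  ultimately obtain G where "G \<in> \<G>" "\<forall>(c, e)\<in>D. \<exists>M. \<forall>x t. c \<bullet> second_diff G x (t *\<^sub>R e) = M * t\<^sup>2"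
    using insert.IH by blast
  then show ?case unfolding d \<G>_def by (intro bexI[of _ G]) auto
qed

section \<open>Quadratic functions and porous sets\<close>

text \<open>Along each axis G is affine, so for two axes only a mixed coefficient k could remain;
  along the sum of the axes it would appear as k t^2, which the second hypothesis excludes.\<close>

lemma affine_of_second_diffs_zero:
  fixes G :: "real ^ 'n \<Rightarrow> real"
  assumes cont: "continuous_on UNIV G"
    and z1: "\<And>i x t. second_diff G x (t *\<^sub>R axis i 1) = 0"
    and z2: "\<And>i j x t. second_diff G x (t *\<^sub>R (axis i 1 + axis j 1)) = 0"
  obtains b where "\<And>y. G y = G 0 + b \<bullet> y"
proof -
  have lineq: "G (x + t *\<^sub>R e) = G x + t * (G (x + e) - G x)"
    if e: "\<And>x t. second_diff G x (t *\<^sub>R e) = 0" for x t e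
  proof -
    have "G (x + (a + t) *\<^sub>R e) + G (x + (a - t) *\<^sub>R e) = 2 * G (x + a *\<^sub>R e)" for a t
      using e[of "x + a *\<^sub>R e" t] by (simp add: second_diff_def scaleR_left_distrib scaleR_left_diff_distrib add.assoc add_diff_eq)
    moreover have "continuous_on UNIV (\<lambda>t. G (x + t *\<^sub>R e))"
      by (intro continuous_on_compose2[OF cont] continuous_intros) auto
    ultimately show ?thesis
      using affine_if_second_differences_zero[of "\<lambda>t. G (x + t *\<^sub>R e)" t] by simp
  qed
  define S where "S i x = G (x + axis i 1) - G x" for i x
  have L: "G (x + t *\<^sub>R axis i 1) = G x + t * S i x" for i x t
    unfolding S_def by (rule lineq) (rule z1)
  have S_move: "S i (x + t *\<^sub>R axis j 1) = S i x" for i j x t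
  proof (cases "i = j")
    case True
    have "S i (x + t *\<^sub>R axis i 1) = G (x + (t + 1) *\<^sub>R axis i 1) - G (x + t *\<^sub>R axis i 1)"
      by (simp add: S_def scaleR_left_distrib add.assoc)
    also have "\<dots> = S i x" by (simp only: L) (simp add: algebra_simps)
    finally show ?thesis using True by simp
  next
    case False
    define k where "k = S i (x + axis j 1) - S i x"
    have comm: "x + axis i 1 + t *\<^sub>R axis j 1 = x + t *\<^sub>R axis j 1 + axis i 1" for t x
      by simp
    have Si: "S i (x + t *\<^sub>R axis j 1) = S i x + t * (S j (x + axis i 1) - S j x)" for t
      using L[of "x + axis i 1" t j] L[of x t j] by (simp add: S_def comm algebra_simps)
    have Sj: "S j (x + axis i 1) - S j x = k"
      using Si[of 1] by (simp add: k_def)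
    have diag: "G (x + t *\<^sub>R axis j 1 + t *\<^sub>R axis i 1) = G x + t * (G (x + (axis j 1 + axis i 1)) - G x)" for t
      using lineq[OF z2, of x t j i] by (simp add: scaleR_right_distrib add.assoc)
    have exp: "G (x + t *\<^sub>R axis j 1 + t *\<^sub>R axis i 1) = G x + t * S j x + t * (S i x + t * k)" for t
      using L[of "x + t *\<^sub>R axis j 1" t i] L[of x t j] Si[of t] Sj by simp
    \<comment> \<open>The restriction to the diagonal is affine by \<open>diag\<close> and has the
      quadratic term t^2 k by \<open>exp\<close>; the values at t = 1 and t = 2 separate the
      two.\<close>
    have "k = 0" using diag[of 1] diag[of 2] exp[of 1] exp[of 2] by simp
    then show ?thesis using Si[of t] Sj by simp
  qed
  have S_const: "S i (\<Sum>j\<in>J. y $ j *\<^sub>R axis j 1) = S i 0" if "finite J" for i J and y :: "real ^ 'n"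
    using that
  proof (induction J rule: finite_induct)
    case (insert j J)
    then show ?case using S_move[of i "\<Sum>j\<in>J. y $ j *\<^sub>R axis j 1" "y $ j" j] by (simp add: add.commute)
  qed simp
  have Gsum: "G (\<Sum>j\<in>J. y $ j *\<^sub>R axis j 1) = G 0 + (\<Sum>j\<in>J. S j 0 * y $ j)" if "finite J" for J and y :: "real ^ 'n"
    using that
  proof (induction J rule: finite_induct)
    case (insert j J)
    then show ?case
      using L[of "\<Sum>j\<in>J. y $ j *\<^sub>R axis j 1" "y $ j" j] S_const[of J j y] by (simp add: add.commute mult.commute)
  qed simp
  have "G y = G 0 + (\<chi> i. S i 0) \<bullet> y" for y
    using Gsum[of UNIV y] basis_expansion[of y] by (simp add: inner_vec_def scalar_mult_eq_scaleR)
  then show thesis by (rule that)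
qed

lemma second_diff_quadratic:
  fixes A :: "real ^ 'n ^ 'n"
  shows "second_diff (\<lambda>y. (y \<bullet> (A *v y)) / 2) x h = h \<bullet> (A *v h)"
  by (simp add: second_diff_def matrix_vector_right_distrib matrix_vector_mult_diff_distrib inner_simps field_simps)

text \<open>Polarisation: second differences along axis vectors and along sums of two of them give
  the entries of a symmetric matrix. Once its form is subtracted, the remainder has zero second
  differences in these directions and is affine.\<close>

lemma quadratic_of_second_diffs:
  fixes f :: "real ^ 'n \<Rightarrow> real"
  assumes cont: "continuous_on UNIV f"
    and z1: "\<And>i. \<exists>M. \<forall>x t. second_diff f x (t *\<^sub>R axis i 1) = M * t\<^sup>2"
    and z2: "\<And>i j. \<exists>M. \<forall>x t. second_diff f x (t *\<^sub>R (axis i 1 + axis j 1)) = M * t\<^sup>2"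
  obtains A b where "A \<in> sym_matrices" "\<And>y. f y = f 0 + b \<bullet> y + (y \<bullet> (A *v y)) / 2"
proof -
  define m where "m e = second_diff f 0 e" for e
  have m: "second_diff f x (t *\<^sub>R e) = m e * t\<^sup>2"
    if ex: "\<exists>M. \<forall>x t. second_diff f x (t *\<^sub>R e) = M * t\<^sup>2" for e x t
  proof -
    obtain M where M: "\<forall>x t. second_diff f x (t *\<^sub>R e) = M * t\<^sup>2" using ex by (elim exE)
    have "m e = M" using M[rule_format, of 0 1] by (simp add: m_def)
    then show ?thesis using M by simp
  qed
  note m1 = m[OF z1] and m2 = m[OF z2]
  define A :: "real ^ 'n ^ 'n" where
    "A = (\<chi> i j. (m (axis i 1 + axis j 1) - m (axis i 1) - m (axis j 1)) / 2)"
  have sym: "A \<in> sym_matrices"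
    by (simp add: sym_matrices_def A_def transpose_def vec_eq_iff add.commute)
  have eAe: "axis i 1 \<bullet> (A *v axis j 1) = A $ i $ j" for i j
    by (simp add: matrix_vector_mult_basis column_def inner_axis' )
  have Aii: "A $ i $ i = m (axis i 1)" for i
  proof -
    have "m (axis i 1 + axis i 1) = 4 * m (axis i 1)"
      using m1[of 0 2 i] by (simp add: m_def scaleR_2)
    then show ?thesis by (simp add: A_def)
  qed
  have Aij: "A $ i $ j + A $ j $ i = m (axis i 1 + axis j 1) - m (axis i 1) - m (axis j 1)" for i j
    by (simp add: A_def add.commute[of "axis j 1" "axis i 1"] field_simps)
  define q where "q y = (y \<bullet> (A *v y)) / 2" for y
  define G where "G y = f y - q y" for y
  have sdG: "second_diff G x h = second_diff f x h - h \<bullet> (A *v h)" for x h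
    using second_diff_quadratic[of A x h] by (simp add: second_diff_def G_def q_def algebra_simps)
  have cq: "continuous_on UNIV q"
    unfolding q_def by (intro continuous_intros matrix_vector_mult_linear_continuous_on) auto
  obtain b where b: "\<And>y. G y = G 0 + b \<bullet> y"
  proof (rule affine_of_second_diffs_zero)
    show "continuous_on UNIV G" unfolding G_def by (intro continuous_intros cont cq)
    show "second_diff G x (t *\<^sub>R axis i 1) = 0" for i x t
      using m1[of x t i] eAe[of i i] Aii[of i]
      by (simp add: sdG matrix_vector_mult_scaleR power2_eq_square)
    show "second_diff G x (t *\<^sub>R (axis i 1 + axis j 1)) = 0" for i j x t
    proof -
      have "(axis i 1 + axis j 1) \<bullet> (A *v (axis i 1 + axis j 1)) = m (axis i 1 + axis j 1)"
        using eAe[of i i] eAe[of j j] eAe[of i j] eAe[of j i] Aii[of i] Aii[of j] Aij[of i j]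
        by (simp add: matrix_vector_right_distrib inner_simps)
      then show ?thesis using m2[of x t i j]
        by (simp add: sdG matrix_vector_mult_scaleR power2_eq_square)
    qed
  qed (rule that)
  have "f y = f 0 + b \<bullet> y + (y \<bullet> (A *v y)) / 2" for y
    using b[of y] by (simp add: G_def q_def)
  then show thesis using that sym by blast
qed

text \<open>A quantitative density argument. Up to a null set, K is covered by disjoint Vitali balls
  inside an open set of measure less than |K| + e, and the holes take the share c^N of each ball, N
  being the dimension. Hence |K| \<le> (1 - c^N) (|K| + e) for every e > 0.\<close>

lemma porous_negligible:
  fixes K :: "'a::euclidean_space set"
  assumes K: "compact K" and c: "c > 0" and R: "R > 0"
    and hole: "\<And>x r. x \<in> K \<Longrightarrow> 0 < r \<Longrightarrow> r < R \<Longrightarrow> \<exists>y. ball y (c * r) \<subseteq> ball x r \<and> ball y (c * r) \<inter> K = {}"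
  shows "negligible K"
proof -
  have Km: "K \<in> lmeasurable" by (rule lmeasurable_compact[OF K])
  let ?\<mu> = "measure lebesgue"
  have main: "?\<mu> K \<le> (1 - c ^ DIM('a)) * (?\<mu> K + e)" if e: "e > 0" and c1: "c \<le> 1" for e
  proof -
    obtain U where U: "open U" "K \<subseteq> U" "U \<in> lmeasurable" "?\<mu> U < ?\<mu> K + e"
    proof -
      obtain U where U: "open U" "K \<subseteq> U" "U - K \<in> lmeasurable" "emeasure lebesgue (U - K) < ennreal e"
        using sets_lebesgue_outer_open[of K e] Km e by (metis fmeasurableD)
      have "U = K \<union> (U - K)" using U(2) by blast
      then have Um: "U \<in> lmeasurable" and "?\<mu> U \<le> ?\<mu> K + ?\<mu> (U - K)"
        using fmeasurable.Un[OF Km U(3)] measure_Un_le[of K lebesgue "U - K"] Km U(3) by auto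
      moreover have "?\<mu> (U - K) < e"
        using U(3,4) e by (metis emeasure_eq_measure2 ennreal_less_iff measure_nonneg)
      ultimately show thesis using that[OF U(1,2)] by simp
    qed
    define I where "I = {(x, r). x \<in> K \<and> 0 < r \<and> r < R \<and> ball x r \<subseteq> U}"
    obtain C where C: "countable C" "C \<subseteq> I"
      "pairwise (\<lambda>i j. disjnt (ball (fst i) (snd i)) (ball (fst j) (snd j))) C"
      "negligible (K - (\<Union>i\<in>C. ball (fst i) (snd i)))"
    proof (rule Vitali_covering_theorem_balls[of K I fst snd])
      fix x d assume x: "x \<in> K" and d: "(d::real) > 0"
      obtain r where r: "r > 0" "ball x r \<subseteq> U" using U x open_contains_ball by blast
      define s where "s = min r (min (d / 2) (R / 2))"
      have "0 < s" "s < d" "s < R" "s \<le> r" using r d R by (auto simp: s_def)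
      then show "\<exists>i. i \<in> I \<and> x \<in> ball (fst i) (snd i) \<and> snd i < d"
        by (intro exI[of _ "(x, s)"]) (use r x in \<open>auto simp: I_def\<close>)
    qed (rule that)
    have "\<forall>i\<in>C. \<exists>y. ball y (c * snd i) \<subseteq> ball (fst i) (snd i) \<and> ball y (c * snd i) \<inter> K = {}"
      using hole C(2) by (force simp: I_def)
    then obtain y where y: "\<And>i. i \<in> C \<Longrightarrow> ball (y i) (c * snd i) \<subseteq> ball (fst i) (snd i)"
      "\<And>i. i \<in> C \<Longrightarrow> ball (y i) (c * snd i) \<inter> K = {}" by metis
    define B where "B = (\<Union>i\<in>C. ball (fst i) (snd i))"
    define T where "T = (\<Union>i\<in>C. ball (y i) (c * snd i))"
    have pos: "snd i > 0" if "i \<in> C" for i using that C(2) by (auto simp: I_def)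
    have disj: "disjoint_family_on (\<lambda>i. ball (fst i) (snd i)) C"
      using C(3) by (auto simp: disjoint_family_on_def pairwise_def disjnt_def)
    then have disj': "disjoint_family_on (\<lambda>i. ball (y i) (c * snd i)) C"
      using y(1) unfolding disjoint_family_on_def by blast
    have eB: "emeasure lborel B = (\<integral>\<^sup>+i. emeasure lborel (ball (fst i) (snd i)) \<partial>count_space C)"
      unfolding B_def by (rule emeasure_UN_countable[OF _ C(1) disj]) auto
    have "emeasure lborel T = (\<integral>\<^sup>+i. emeasure lborel (ball (y i) (c * snd i)) \<partial>count_space C)"
      unfolding T_def by (rule emeasure_UN_countable[OF _ C(1) disj']) auto
    also have "\<dots> = (\<integral>\<^sup>+i. ennreal (c ^ DIM('a)) * emeasure lborel (ball (fst i) (snd i)) \<partial>count_space C)"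
    proof (rule nn_integral_cong)
      fix i assume "i \<in> space (count_space C)"
      then have "snd i > 0" using pos by simp
      then show "emeasure lborel (ball (y i) (c * snd i)) = ennreal (c ^ DIM('a)) * emeasure lborel (ball (fst i) (snd i))"
        using c by (simp add: emeasure_ball power_mult_distrib ennreal_mult'[symmetric] mult_ac)
    qed
    also have "\<dots> = ennreal (c ^ DIM('a)) * emeasure lborel B"
      unfolding eB by (rule nn_integral_cmult) auto
    finally have eT: "emeasure lborel T = ennreal (c ^ DIM('a)) * emeasure lborel B" .
    have oB: "open B" and oT: "open T" unfolding B_def T_def by (auto intro: open_UN)
    have BU: "B \<subseteq> U" using C(2) unfolding B_def I_def by fastforce
    have TB: "T \<subseteq> B" using y(1) unfolding T_def B_def by blast
    have Bm: "B \<in> lmeasurable" by (rule fmeasurableI2[OF U(3) BU]) (use oB in auto)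
    have Tm: "T \<in> lmeasurable" by (rule fmeasurableI2[OF Bm TB]) (use oT in auto)
    have mT: "?\<mu> T = c ^ DIM('a) * ?\<mu> B"
      using eT c oB oT by (simp add: measure_def enn2real_mult)
    have "?\<mu> K \<le> ?\<mu> ((K - B) \<union> (B - T))"
    proof (rule measure_mono_fmeasurable)
      show "K \<subseteq> (K - B) \<union> (B - T)" using y(2) unfolding T_def by blast
      show "(K - B) \<union> (B - T) \<in> lmeasurable"
        using Km Bm Tm by (intro fmeasurable.Un fmeasurable.Diff) auto
    qed (use Km in auto)
    also have "\<dots> \<le> ?\<mu> (K - B) + ?\<mu> (B - T)"
      using C(4) Bm Tm unfolding B_def[symmetric]
      by (intro measure_Un_le) (auto simp: negligible_imp_sets)
    also have "?\<mu> (K - B) = 0" using C(4) unfolding B_def[symmetric] by (rule negligible_imp_measure0)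
    also have "?\<mu> (B - T) = ?\<mu> B - ?\<mu> T"
      by (rule measurable_measure_Diff) (use Bm Tm TB in auto)
    also have "\<dots> = (1 - c ^ DIM('a)) * ?\<mu> B" by (simp add: mT algebra_simps)
    also have "\<dots> \<le> (1 - c ^ DIM('a)) * (?\<mu> K + e)"
    proof (rule mult_left_mono)
      show "?\<mu> B \<le> ?\<mu> K + e"
        using measure_mono_fmeasurable[OF BU _ U(3)] Bm U(4) by auto
      show "0 \<le> 1 - c ^ DIM('a)" using c c1 by (simp add: power_le_one)
    qed
    finally show ?thesis by simp
  qed
  show ?thesis
  proof (cases "K = {}")
    case False
    then obtain x where "x \<in> K" by blast
    \<comment> \<open>A hole of radius c R / 2 has to fit into a ball of radius R / 2, which forces
      c \<le> 1.\<close>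
    then obtain y where "ball y (c * (R / 2)) \<subseteq> ball x (R / 2)" using hole[of x "R / 2"] R by auto
    then have "dist x y + c * (R / 2) \<le> R / 2" using R c by (subst (asm) ball_subset_ball_iff) (auto simp: dist_commute mult_le_0_iff)
    then have "c * (R / 2) \<le> 1 * (R / 2)" using zero_le_dist[of x y] by linarith
    then have c1: "c \<le> 1" using R by simp
    have "c ^ DIM('a) * ?\<mu> K \<le> 0 + e" if "e > 0" for e
    proof -
      have "(1 - c ^ DIM('a)) * e \<le> e" using that c by (simp add: algebra_simps)
      then show ?thesis using main[OF that c1] by (simp add: algebra_simps)
    qed
    then have "c ^ DIM('a) * ?\<mu> K \<le> 0" by (rule field_le_epsilon)
    then have "?\<mu> K = 0" using zero_less_power[OF c, of "DIM('a)"]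
      by (metis measure_nonneg mult_le_0_iff not_less order.antisym)
    then show ?thesis using Km by (simp add: negligible_iff_measure)
  qed simp
qed

text \<open>If at every point of K and every small scale some point of the rescaled ball of radius m
  were more than 1 / m away from K, then K would be porous with ratio
  \<open>1 / (2 * m * m)\<close>.\<close>

lemma non_negligible_dense_at_scale:
  fixes K :: "'a::euclidean_space set"
  assumes K: "compact K" "\<not> negligible K" and m: "m \<ge> 1"
  obtains x r where "x \<in> K" "0 < r" "r < 1 / m" "\<And>y. norm y \<le> m \<Longrightarrow> \<exists>k\<in>K. norm (x + r *\<^sub>R y - k) \<le> r / m"
proof (rule ccontr)
  assume no: "\<not> thesis"
  note witness = that
  have far: "\<exists>y. norm y \<le> m \<and> (\<forall>k\<in>K. norm (x + s *\<^sub>R y - k) > s / m)"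
    if "x \<in> K" "0 < s" "s < 1 / m" for x s
  proof (rule ccontr)
    assume "\<not> ?thesis"
    then have "\<exists>k\<in>K. norm (x + s *\<^sub>R y - k) \<le> s / m" if "norm y \<le> m" for y
      using that by (meson not_le)
    from witness[OF \<open>x \<in> K\<close> \<open>0 < s\<close> \<open>s < 1 / m\<close> this] no show False by blast
  qed
  have "negligible K"
  proof (rule porous_negligible[OF K(1), of "1 / (2 * m * m)" "1 / m"])
    fix x :: 'a and r :: real
    assume x: "x \<in> K" and r: "0 < r" "r < 1 / m"
    \<comment> \<open>At scale s the offsets \<open>s *\<^sub>R y\<close> reach at most s m = r / 2,
      which leaves room in \<open>ball x r\<close> for the hole of radius s / m.\<close>
    define s where "s = r / (2 * m)"
    have sr: "2 * (s * m) = r" using m by (simp add: s_def)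
    have s: "0 < s" using r m by (simp add: s_def)
    have sm: "s \<le> s * m" using s m by simp
    obtain y where y: "norm y \<le> m" "\<forall>k\<in>K. norm (x + s *\<^sub>R y - k) > s / m"
      using far[OF x s] sm sr r s by auto
    have c: "1 / (2 * m * m) * r = s / m" using m by (simp add: s_def)
    show "\<exists>y. ball y (1 / (2 * m * m) * r) \<subseteq> ball x r \<and> ball y (1 / (2 * m * m) * r) \<inter> K = {}"
      unfolding c
    proof (intro exI[of _ "x + s *\<^sub>R y"] conjI)
      show "ball (x + s *\<^sub>R y) (s / m) \<inter> K = {}"
        using y(2) by (force simp: dist_norm)
      have "s * norm y \<le> s * m" using y(1) s by simp
      moreover have "s / m \<le> s * m" using s m sm by (smt (verit) divide_le_eq_1 divide_left_mono divide_self_if mult_pos_pos div_by_1)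
      ultimately have "s * norm y + s / m \<le> r" using sr by linarith
      then show "ball (x + s *\<^sub>R y) (s / m) \<subseteq> ball x r"
        using s m by (subst ball_subset_ball_iff) (auto simp: dist_norm)
    qed
  qed (use m in auto)
  then show False using K(2) by blast
qed

section \<open>Contact sets of semiconvex functions\<close>

text \<open>Equivalent to convexity of f + c |x|^2, phrased through a supporting paraboloid at every
  point because the contact argument works with these slopes.\<close>

definition semiconvex :: "real \<Rightarrow> ('a::real_inner \<Rightarrow> real) \<Rightarrow> bool" where
  "semiconvex c f \<longleftrightarrow> (\<forall>x. \<exists>a. \<forall>y. f y \<ge> f x + a \<bullet> (y - x) - c * (norm (y - x))\<^sup>2)"

text \<open>The upper contact set. The planes lie above w on the whole space, so second differences
  of w at its points are nonpositive for every step.\<close>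

definition touching :: "real \<Rightarrow> ('a::real_inner \<Rightarrow> real) \<Rightarrow> 'a set" where
  "touching \<kappa> w = {x. \<exists>p. norm p \<le> \<kappa> \<and> (\<forall>y. w y \<le> w x + p \<bullet> (y - x))}"

lemma touching_plane_exists:
  fixes w :: "'a::euclidean_space \<Rightarrow> real"
  assumes cont: "continuous_on UNIV w" and D: "D > 0" and growth: "\<And>x. w x \<le> B - D * (norm x)\<^sup>2"
  obtains x where "\<And>y. w y \<le> w x + p \<bullet> (y - x)"
proof -
  \<comment> \<open>Outside radius R the growth bound gives
    \<open>w y - p \<bullet> y \<le> B - E\<close>, and E is chosen to place this below the value at
    0; a maximum over the ball is therefore global.\<close>
  define E where "E = \<bar>B - w 0\<bar> + 1"
  define R where "R = max 1 ((norm p + E) / D)"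
  obtain x where x: "x \<in> cball 0 R" "\<And>y. y \<in> cball 0 R \<Longrightarrow> w y - p \<bullet> y \<le> w x - p \<bullet> x"
    using continuous_attains_sup[of "cball 0 R" "\<lambda>y. w y - p \<bullet> y"] cont
    by (force intro!: continuous_intros continuous_on_subset[OF cont] simp: R_def)
  have "w y - p \<bullet> y \<le> w x - p \<bullet> x" for y
  proof (cases "norm y \<le> R")
    case False
    have R: "R \<ge> 1" "norm p + E \<le> D * R" using D by (auto simp: R_def field_simps max_def)
    have "norm p + E \<le> D * norm y" using R(2) False D by (smt (verit) mult_left_mono)
    then have "E \<le> D * norm y - norm p" by simp
    then have "1 * E \<le> norm y * (D * norm y - norm p)" using False R by (intro mult_mono) (auto simp: E_def)
    moreover have "- (p \<bullet> y) \<le> norm p * norm y" using Cauchy_Schwarz_ineq2[of p y] by linarith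
    ultimately have "w y - p \<bullet> y \<le> B - E"
      using growth[of y] by (simp add: algebra_simps power2_eq_square)
    also have "\<dots> \<le> w 0 - p \<bullet> 0" by (simp add: E_def)
    also have "\<dots> \<le> w x - p \<bullet> x" using R by (intro x(2)) auto
    finally show ?thesis .
  qed (use x(2) in auto)
  then show thesis by (intro that[of x]) (simp add: inner_diff_right algebra_simps)
qed

text \<open>The plane above the sum and the paraboloids below f and g squeeze each summand. The
  vector q = a + b - p satisfies \<open>q \<bullet> h \<le> 2 * c * (norm h)\<^sup>2\<close> for all
  h and so is zero; the upper bound for f is then the plane minus the lower bound for g, and
  conversely.\<close>

lemma touching_slopes:
  fixes f g :: "'a::real_inner \<Rightarrow> real"
  assumes f: "semiconvex c f" and g: "semiconvex c g" and c: "c \<ge> 0"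
    and touch: "\<And>y. f y + g y \<le> f x + g x + p \<bullet> (y - x)"
  obtains s where "fst s + snd s = p"
    "\<And>h. norm ((f (x + h), g (x + h)) - (f x, g x) - lin s h) \<le> 2 * c * (norm h)\<^sup>2"
proof -
  obtain a where a: "\<And>y. f y \<ge> f x + a \<bullet> (y - x) - c * (norm (y - x))\<^sup>2"
    using f unfolding semiconvex_def by blast
  obtain b where b: "\<And>y. g y \<ge> g x + b \<bullet> (y - x) - c * (norm (y - x))\<^sup>2"
    using g unfolding semiconvex_def by blast
  define q where "q = a + b - p"
  have qh: "q \<bullet> h \<le> 2 * c * (norm h)\<^sup>2" for h
    using touch[of "x + h"] a[of "x + h"] b[of "x + h"] by (simp add: q_def inner_simps)
  \<comment> \<open>Small enough for 2 c t \<le> 1 / 2, so that the test vector h = t q gives |q|^2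
    \<le> |q|^2 / 2; the summand 1 covers c = 0.\<close>
  define t where "t = 1 / (4 * c + 1)"
  have t: "t > 0" "2 * c * t \<le> 1 / 2" using c by (auto simp: t_def field_simps)
  have "t * (norm q)\<^sup>2 \<le> t * (2 * c * t * (norm q)\<^sup>2)"
    using qh[of "t *\<^sub>R q"] t by (simp add: power_mult_distrib dot_square_norm power2_eq_square mult_ac)
  then have "(norm q)\<^sup>2 \<le> (2 * c * t) * (norm q)\<^sup>2" using t by simp
  also have "\<dots> \<le> 1 / 2 * (norm q)\<^sup>2" using t by (intro mult_right_mono) auto
  finally have "q = 0" by simp
  then have ab: "a + b = p" by (simp add: q_def)
  have "norm ((f (x + h), g (x + h)) - (f x, g x) - lin (a, b) h) \<le> 2 * c * (norm h)\<^sup>2" for h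
  proof -
    have "\<bar>f (x + h) - f x - a \<bullet> h\<bar> \<le> c * (norm h)\<^sup>2" "\<bar>g (x + h) - g x - b \<bullet> h\<bar> \<le> c * (norm h)\<^sup>2"
      using touch[of "x + h"] a[of "x + h"] b[of "x + h"] by (auto simp: ab[symmetric] inner_simps abs_le_iff)
    then show ?thesis
      using norm_Pair_le[of "f (x + h) - f x - a \<bullet> h" "g (x + h) - g x - b \<bullet> h"] by (simp add: lin_def)
  qed
  then show thesis by (intro that[of "(a, b)"]) (use ab in auto)
qed

text \<open>Both expansions predict W at y + h. Taking h of length |x - y| along p - q turns their
  discrepancy into the slope difference, and the squared lengths 4, 1 and 1 make the factor 6. For x
  = y the same comparison at small h says that the slope is unique.\<close>

lemma slope_Lipschitz:
  fixes W :: "'a::real_inner \<Rightarrow> real"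
  assumes p: "\<And>h. \<bar>W (x + h) - W x - p \<bullet> h\<bar> \<le> C * (norm h)\<^sup>2"
    and q: "\<And>h. \<bar>W (y + h) - W y - q \<bullet> h\<bar> \<le> C * (norm h)\<^sup>2" and C: "C \<ge> 0"
  shows "norm (p - q) \<le> 6 * C * norm (x - y)"
proof -
  have key: "\<bar>(p - q) \<bullet> h\<bar> \<le> C * ((norm (y - x + h))\<^sup>2 + (norm h)\<^sup>2 + (norm (y - x))\<^sup>2)" for h
    using p[of "y - x + h"] p[of "y - x"] q[of h] by (simp add: inner_simps algebra_simps abs_le_iff)
  show ?thesis
  proof (cases "x = y")
    case True
    define r where "r = p - q"
    have rh: "\<bar>r \<bullet> h\<bar> \<le> 2 * C * (norm h)\<^sup>2" for h using key[of h] True by (simp add: r_def)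
    define t where "t = 1 / (4 * C + 1)"
    have t: "t > 0" "2 * C * t \<le> 1 / 2" using C by (auto simp: t_def field_simps)
    have "t * (norm r)\<^sup>2 \<le> t * (2 * C * t * (norm r)\<^sup>2)"
      using rh[of "t *\<^sub>R r"] t by (simp add: power_mult_distrib dot_square_norm power2_eq_square mult_ac)
    then have "(norm r)\<^sup>2 \<le> (2 * C * t) * (norm r)\<^sup>2" using t by simp
    also have "\<dots> \<le> 1 / 2 * (norm r)\<^sup>2" using t by (intro mult_right_mono) auto
    finally show ?thesis using True by (simp add: r_def)
  next
    case False
    define d where "d = norm (y - x)"
    have d: "d > 0" using False by (simp add: d_def)
    define h where "h = d *\<^sub>R sgn (p - q)"
    have nh: "norm h \<le> d" using d by (simp add: h_def norm_sgn)
    have "(p - q) \<bullet> h = d * norm (p - q)"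
      by (cases "p = q") (simp_all add: h_def sgn_div_norm dot_square_norm power2_eq_square)
    moreover have "(norm (y - x + h))\<^sup>2 \<le> (2 * d)\<^sup>2"
      using norm_triangle_ineq[of "y - x" h] nh by (intro power_mono) (auto simp: d_def)
    moreover have "(norm h)\<^sup>2 \<le> d\<^sup>2" using nh by (intro power_mono) auto
    ultimately have "d * norm (p - q) \<le> C * (4 * d\<^sup>2 + d\<^sup>2 + d\<^sup>2)"
      using key[of h] C d by (smt (verit) d_def mult_left_mono power_mult_distrib four_x_squared)
    then have "d * norm (p - q) \<le> d * (6 * C * d)" by (simp add: power2_eq_square algebra_simps)
    then show ?thesis using d by (simp add: d_def norm_minus_commute)
  qed
qed

lemma compact_touching:
  fixes w :: "'a::euclidean_space \<Rightarrow> real"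
  assumes cont: "continuous_on UNIV w" and D: "D > 0" and growth: "\<And>x. w x \<le> B - D * (norm x)\<^sup>2"
    and k: "\<kappa> \<ge> 0"
  shows "compact (touching \<kappa> w)"
proof -
  \<comment> \<open>The slope is kept as a coordinate because contact is a closed condition on the
    pair (x, p); the existential over p comes back by projecting a compact set.\<close>
  define Z where "Z = (\<Inter>y. {z. w y \<le> w (fst z) + snd z \<bullet> (y - fst z)}) \<inter> (UNIV \<times> cball 0 \<kappa>)"
  have clZ: "closed Z" unfolding Z_def
    by (intro closed_Int closed_INT ballI closed_Collect_le closed_Times closed_UNIV closed_cball
        continuous_intros continuous_on_compose2[OF cont]) auto
  define R where "R = (\<bar>B - w 0\<bar> + \<kappa> + D) / D"
  have bd: "norm x \<le> R" if "(x, p) \<in> Z" for x p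
  proof (rule ccontr)
    assume "\<not> ?thesis"
    then have R: "norm x > R" by simp
    have "R \<ge> 1" using D k by (simp add: R_def field_simps)
    then have x1: "norm x \<ge> 1" using R by simp
    have al: "\<forall>y. w y \<le> w x + p \<bullet> (y - x)" "norm p \<le> \<kappa>" using that by (auto simp: Z_def)
    have "w 0 \<le> w x + p \<bullet> (0 - x)" "norm p \<le> \<kappa>" using al(1)[rule_format, of 0] al(2) by auto
    moreover have "p \<bullet> (0 - x) \<le> norm p * norm x" using Cauchy_Schwarz_ineq2[of p "0 - x"] by simp
    moreover have "norm p * norm x \<le> \<kappa> * norm x" using calculation by (intro mult_right_mono) auto
    ultimately have "D * (norm x)\<^sup>2 - \<kappa> * norm x \<le> B - w 0" using growth[of x] by linarith
    moreover have "D * norm x \<ge> \<bar>B - w 0\<bar> + \<kappa> + D"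
      using R D by (simp add: R_def field_simps)
    then have "norm x * (D * norm x - \<kappa>) \<ge> 1 * (\<bar>B - w 0\<bar> + D)"
      using x1 D by (intro mult_mono) auto
    ultimately show False using D by (simp add: power2_eq_square algebra_simps)
  qed
  have "Z \<subseteq> cball 0 R \<times> cball 0 \<kappa>" using bd by (auto simp: Z_def)
  then have "compact Z"
    using compact_Int_closed[OF compact_Times[OF compact_cball compact_cball] clZ, of 0 R 0 \<kappa>]
    by (simp add: inf.absorb2)
  then have "compact (fst ` Z)" by (intro compact_continuous_image continuous_intros)
  moreover have "fst ` Z = touching \<kappa> w"
  proof (rule set_eqI)
    fix x
    have "(x, p) \<in> Z \<longleftrightarrow> norm p \<le> \<kappa> \<and> (\<forall>y. w y \<le> w x + p \<bullet> (y - x))" for p by (auto simp: Z_def)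
    moreover have "x \<in> fst ` Z \<longleftrightarrow> (\<exists>p. (x, p) \<in> Z)" by force
    ultimately show "x \<in> fst ` Z \<longleftrightarrow> x \<in> touching \<kappa> w" by (simp add: touching_def)
  qed
  ultimately show ?thesis by simp
qed

text \<open>Jensen's lemma: the slope of the touching plane is a Lipschitz function on the contact set,
  and its image is a whole ball.\<close>

lemma touching_not_negligible:
  fixes f g :: "'a::euclidean_space \<Rightarrow> real"
  assumes cont: "continuous_on UNIV (\<lambda>x. f x + g x)" and D: "D > 0"
    and growth: "\<And>x. f x + g x \<le> B - D * (norm x)\<^sup>2"
    and f: "semiconvex c f" and g: "semiconvex c g" and c: "c \<ge> 0" and k: "\<kappa> > 0"
  shows "\<not> negligible (touching \<kappa> (\<lambda>x. f x + g x))"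
proof
  let ?w = "\<lambda>x. f x + g x" let ?K = "touching \<kappa> ?w"
  assume neg: "negligible ?K"
  have jet: "\<bar>?w (x + h) - ?w x - p \<bullet> h\<bar> \<le> 4 * c * (norm h)\<^sup>2"
    if touch: "\<And>y. ?w y \<le> ?w x + p \<bullet> (y - x)" for x p h
  proof -
    obtain s where s: "fst s + snd s = p"
      "\<And>h. norm ((f (x + h), g (x + h)) - (f x, g x) - lin s h) \<le> 2 * c * (norm h)\<^sup>2"
      by (rule touching_slopes[OF f g c touch]) (rule that)
    have "\<bar>f (x + h) - f x - fst s \<bullet> h\<bar> \<le> 2 * c * (norm h)\<^sup>2" "\<bar>g (x + h) - g x - snd s \<bullet> h\<bar> \<le> 2 * c * (norm h)\<^sup>2"
      using s(2)[of h] norm_fst_le[of "f (x + h) - f x - fst s \<bullet> h" "g (x + h) - g x - snd s \<bullet> h"]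
        norm_snd_le[of "g (x + h) - g x - snd s \<bullet> h" "f (x + h) - f x - fst s \<bullet> h"]
      by (auto simp: lin_def)
    then show ?thesis unfolding s(1)[symmetric] inner_add_left by linarith
  qed
  have "\<forall>x\<in>?K. \<exists>p. norm p \<le> \<kappa> \<and> (\<forall>y. ?w y \<le> ?w x + p \<bullet> (y - x))" by (simp add: touching_def)
  then obtain P where P: "\<And>x. x \<in> ?K \<Longrightarrow> norm (P x) \<le> \<kappa>" "\<And>x y. x \<in> ?K \<Longrightarrow> ?w y \<le> ?w x + P x \<bullet> (y - x)"
    by metis
  have "negligible (P ` ?K)"
  proof (rule negligible_locally_Lipschitz_image[OF order_refl neg])
    fix x assume x: "x \<in> ?K"
    show "\<exists>T B. open T \<and> x \<in> T \<and> (\<forall>y\<in>?K \<inter> T. norm (P y - P x) \<le> B * norm (y - x))"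
    proof (intro exI[of _ UNIV] exI[of _ "6 * (4 * c)"] conjI ballI)
      fix y assume y: "y \<in> ?K \<inter> UNIV"
      show "norm (P y - P x) \<le> 6 * (4 * c) * norm (y - x)"
        by (rule slope_Lipschitz[where W = ?w]) (use x y c in \<open>auto intro!: jet P(2)\<close>)
    qed auto
  qed
  moreover have "ball 0 \<kappa> \<subseteq> P ` ?K"
  proof
    fix p :: 'a assume p: "p \<in> ball 0 \<kappa>"
    obtain x where x: "\<And>y. ?w y \<le> ?w x + p \<bullet> (y - x)"
      by (rule touching_plane_exists[OF cont D growth, of p]) (rule that)
    then have xK: "x \<in> ?K" using p by (auto simp: touching_def intro!: exI[of _ p])
    \<comment> \<open>The Lipschitz estimate at coinciding points: the contact slope is unique, so
      the selected \<open>P x\<close> is the prescribed p.\<close>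
    have "norm (p - P x) \<le> 6 * (4 * c) * norm (x - x)"
      by (rule slope_Lipschitz[where W = ?w]) (use xK c x in \<open>auto intro!: jet P(2)\<close>)
    then have "p = P x" by simp
    then show "p \<in> P ` ?K" using xK by blast
  qed
  ultimately have "negligible (ball (0::'a) \<kappa>)" by (rule negligible_subset)
  then show False using k open_not_negligible[of "ball (0::'a) \<kappa>"] by simp
qed

section \<open>Blow-ups at contact points\<close>

lemma quad_jet_recenter:
  assumes jet: "quad_jet C F (x + r *\<^sub>R y)" and r: "r > 0"
  shows "quad_jet C (recenter x r b s F) y"
proof -
  obtain s' where s': "\<And>h. norm (F (x + r *\<^sub>R y + h) - F (x + r *\<^sub>R y) - lin s' h) \<le> C * (norm h)\<^sup>2"
    using jet by (auto simp: quad_jet_def)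
  define s'' where "s'' = inverse r *\<^sub>R s' - inverse (r\<^sup>2) *\<^sub>R s"
  have "norm (recenter x r b s F (y + h) - recenter x r b s F y - lin s'' h) \<le> C * (norm h)\<^sup>2" for h
  proof -
    have l: "lin s'' h = inverse (r\<^sup>2) *\<^sub>R (lin s' (r *\<^sub>R h) - lin s h)"
    proof -
      have "lin s'' h = inverse r *\<^sub>R lin s' h - inverse (r\<^sup>2) *\<^sub>R lin s h"
        by (simp add: s''_def lin_def inner_simps)
      then show ?thesis using r by (simp add: scaleR_diff_right power2_eq_square)
    qed
    have e: "x + r *\<^sub>R (y + h) = x + r *\<^sub>R y + r *\<^sub>R h" by (simp add: scaleR_add_right)
    have "recenter x r b s F (y + h) - recenter x r b s F y - lin s'' h
      = inverse (r\<^sup>2) *\<^sub>R (F (x + r *\<^sub>R y + r *\<^sub>R h) - F (x + r *\<^sub>R y) - lin s' (r *\<^sub>R h))"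
      unfolding recenter_def e l scaleR_diff_right[symmetric] by simp
    then have "norm (recenter x r b s F (y + h) - recenter x r b s F y - lin s'' h)
      = inverse (r\<^sup>2) * norm (F (x + r *\<^sub>R y + r *\<^sub>R h) - F (x + r *\<^sub>R y) - lin s' (r *\<^sub>R h))"
      by (simp only: norm_scaleR) simp
    also have "\<dots> \<le> inverse (r\<^sup>2) * (C * (norm (r *\<^sub>R h))\<^sup>2)" using s'[of "r *\<^sub>R h"] by (intro mult_left_mono) auto
    also have "\<dots> = C * (norm h)\<^sup>2" using r by (simp add: power_mult_distrib)
    finally show ?thesis .
  qed
  then show ?thesis unfolding quad_jet_def by blast
qed

text \<open>Says that F is a limit of rescalings of \<Phi> without naming a sequence; the free
  affine part makes this stable under recentring. The centre is only required near K, since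
  recentring moves it off K. As \<open>s\<close> is a slope in rescaled coordinates, division by r
  yields the bound \<kappa> + \<epsilon> for the slope of the sum.\<close>

definition blowup_approx :: "real \<Rightarrow> 'a::real_inner set \<Rightarrow> ('a \<Rightarrow> real \<times> real) \<Rightarrow> ('a \<Rightarrow> real \<times> real) \<Rightarrow> bool" where
  "blowup_approx \<kappa> K \<Phi> F \<longleftrightarrow> (\<forall>R>0. \<forall>\<epsilon>>0. \<exists>x r b s k. 0 < r \<and> r < \<epsilon> \<and> k \<in> K \<and> dist x k < \<epsilon>
     \<and> norm (fst s + snd s) \<le> (\<kappa> + \<epsilon>) * r \<and> (\<forall>y\<in>cball 0 R. norm (F y - recenter x r b s \<Phi> y) \<le> \<epsilon>))"

definition blowups :: "real \<Rightarrow> real \<Rightarrow> 'a::real_inner set \<Rightarrow> ('a \<Rightarrow> real \<times> real) \<Rightarrow> ('a \<Rightarrow> real \<times> real) set" where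
  "blowups C \<kappa> K \<Phi> = {F. (\<forall>x. quad_jet C F x)
     \<and> (\<forall>x h. fst (second_diff F x h) + snd (second_diff F x h) \<le> 0) \<and> blowup_approx \<kappa> K \<Phi> F}"

lemma blowup_approxE:
  assumes "blowup_approx \<kappa> K \<Phi> F" "R > 0" "\<epsilon> > 0"
  obtains x r b s k where "0 < r" "r < \<epsilon>" "k \<in> K" "dist x k < \<epsilon>" "norm (fst s + snd s) \<le> (\<kappa> + \<epsilon>) * r"
    "\<And>y. y \<in> cball 0 R \<Longrightarrow> norm (F y - recenter x r b s \<Phi> y) \<le> \<epsilon>"
proof -
  from assms(1)[unfolded blowup_approx_def, rule_format, OF assms(2,3)] show thesis
    by (elim exE conjE) (rule that, assumption+, erule bspec)
qed

lemma blowup_approx_recenter: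
  assumes F: "blowup_approx \<kappa> K \<Phi> F" and q: "q > 0"
  shows "blowup_approx \<kappa> K \<Phi> (recenter x0 q b0 s0 F)"
  unfolding blowup_approx_def
proof (intro allI impI)
  fix R \<epsilon> :: real assume R: "R > 0" and e: "\<epsilon> > 0"
  \<comment> \<open>T dominates each factor by which recentring enlarges an error: q for the scale,
    \<open>1 + norm x0\<close> for the centre, \<open>1 + 2 * norm s0 / q\<close> for the slope and
    \<open>inverse (q\<^sup>2)\<close> for the values.\<close>
  define T where "T = 1 + q + norm x0 + 2 * norm s0 / q + inverse (q\<^sup>2)"
  have Tge: "T \<ge> 1" "T \<ge> q" "T \<ge> 1 + norm x0" "T \<ge> 1 + 2 * norm s0 / q" "T \<ge> inverse (q\<^sup>2)"
    using q by (simp_all add: T_def)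
  define d where "d = \<epsilon> / T"
  have d: "d > 0" "d * T = \<epsilon>" using e Tge by (auto simp: d_def)
  have dT: "d * t \<le> \<epsilon>" if "t \<le> T" for t using that d by (metis mult_left_mono less_imp_le)
  have "norm x0 + q * R + 1 > 0" using q R by (simp add: add_nonneg_pos)
  then obtain x r b s k where A: "0 < r" "r < d" "k \<in> K" "dist x k < d" "norm (fst s + snd s) \<le> (\<kappa> + d) * r"
    "\<And>y. y \<in> cball 0 (norm x0 + q * R + 1) \<Longrightarrow> norm (F y - recenter x r b s \<Phi> y) \<le> d"
    by (rule blowup_approxE[OF F _ d(1)]) (rule that)
  \<comment> \<open>A rescaling of a rescaling has factor r q, with the affine parts collected in s'
    and b'. The outer slope enters with r^2, so its share in the slope condition vanishes relative
    to r q.\<close>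
  define s' where "s' = q *\<^sub>R s + r\<^sup>2 *\<^sub>R s0"
  define b' where "b' = b + lin s x0 + r\<^sup>2 *\<^sub>R b0"
  have comp: "recenter x0 q b0 s0 (recenter x r b s \<Phi>) y = recenter (x + r *\<^sub>R x0) (r * q) b' s' \<Phi> y" for y
  proof -
    have e: "x + r *\<^sub>R (x0 + q *\<^sub>R y) = x + r *\<^sub>R x0 + (r * q) *\<^sub>R y" by (simp add: scaleR_add_right)
    have "recenter x r b s \<Phi> (x0 + q *\<^sub>R y) - b0 - lin s0 y
        = inverse (r\<^sup>2) *\<^sub>R (\<Phi> (x + r *\<^sub>R x0 + (r * q) *\<^sub>R y) - b' - lin s' y)"
      unfolding recenter_def e b'_def s'_def using A(1)
      by (simp add: scaleR_add_right scaleR_diff_right)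
    then show ?thesis
      by (simp only: recenter_def[of x0] recenter_def[of "x + r *\<^sub>R x0"]) (simp add: power_mult_distrib mult_ac)
  qed
  show "\<exists>x r b s k. 0 < r \<and> r < \<epsilon> \<and> k \<in> K \<and> dist x k < \<epsilon> \<and> norm (fst s + snd s) \<le> (\<kappa> + \<epsilon>) * r
      \<and> (\<forall>y\<in>cball 0 R. norm (recenter x0 q b0 s0 F y - recenter x r b s \<Phi> y) \<le> \<epsilon>)"
  proof (intro exI conjI ballI)
    show "0 < r * q" using A q by simp
    have "r * q < d * q" using A q by simp
    then show "r * q < \<epsilon>" using dT[OF Tge(2)] by linarith
    show "k \<in> K" by (rule A(3))
    have "dist (x + r *\<^sub>R x0) k \<le> dist x k + r * norm x0"
      using A(1) norm_triangle_ineq[of "x - k" "r *\<^sub>R x0"] by (simp add: dist_norm algebra_simps)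
    also have "\<dots> < d + d * norm x0" using A by (intro add_less_le_mono mult_right_mono) auto
    also have "\<dots> \<le> \<epsilon>" using dT[OF Tge(3)] by (simp add: algebra_simps)
    finally show "dist (x + r *\<^sub>R x0) k < \<epsilon>" .
    have "norm (fst s0 + snd s0) \<le> 2 * norm s0"
      using norm_triangle_ineq[of "fst s0" "snd s0"] norm_fst_le[of "fst s0" "snd s0"] norm_snd_le[of "snd s0" "fst s0"] by simp
    have "fst s' + snd s' = q *\<^sub>R (fst s + snd s) + r\<^sup>2 *\<^sub>R (fst s0 + snd s0)"
      by (simp add: s'_def scaleR_add_right)
    then have "norm (fst s' + snd s') \<le> q * norm (fst s + snd s) + r\<^sup>2 * norm (fst s0 + snd s0)"
      using norm_triangle_ineq[of "q *\<^sub>R (fst s + snd s)" "r\<^sup>2 *\<^sub>R (fst s0 + snd s0)"] q by simp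
    also have "\<dots> \<le> q * ((\<kappa> + d) * r) + (r * d) * (2 * norm s0)"
      using A q \<open>norm (fst s0 + snd s0) \<le> 2 * norm s0\<close>
      by (intro add_mono mult_left_mono mult_mono) (auto simp: power2_eq_square)
    also have "\<dots> = (\<kappa> + d * (1 + 2 * norm s0 / q)) * (r * q)" using q by (simp add: field_simps)
    also have "\<dots> \<le> (\<kappa> + \<epsilon>) * (r * q)"
      using dT[OF Tge(4)] A q by (intro mult_right_mono) auto
    finally show "norm (fst s' + snd s') \<le> (\<kappa> + \<epsilon>) * (r * q)" .
    fix y :: 'a assume y: "y \<in> cball 0 R"
    have "norm (x0 + q *\<^sub>R y) \<le> norm x0 + q * norm y" using norm_triangle_ineq[of x0 "q *\<^sub>R y"] q by simp
    also have "\<dots> \<le> norm x0 + q * R + 1" using y q by (simp add: add_increasing2)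
    finally have y': "norm (F (x0 + q *\<^sub>R y) - recenter x r b s \<Phi> (x0 + q *\<^sub>R y)) \<le> d" by (intro A(6)) auto
    have "recenter x0 q b0 s0 F y - recenter (x + r *\<^sub>R x0) (r * q) b' s' \<Phi> y
      = inverse (q\<^sup>2) *\<^sub>R (F (x0 + q *\<^sub>R y) - recenter x r b s \<Phi> (x0 + q *\<^sub>R y))"
      unfolding comp[symmetric] recenter_def[of x0] scaleR_diff_right[symmetric] by simp
    then have "norm (recenter x0 q b0 s0 F y - recenter (x + r *\<^sub>R x0) (r * q) b' s' \<Phi> y)
      = inverse (q\<^sup>2) * norm (F (x0 + q *\<^sub>R y) - recenter x r b s \<Phi> (x0 + q *\<^sub>R y))"
      by (simp only: norm_scaleR) simp
    also have "\<dots> \<le> inverse (q\<^sup>2) * d" using y' by (intro mult_left_mono) auto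
    also have "\<dots> \<le> \<epsilon>" using dT[OF Tge(5)] by (simp add: mult.commute)
    finally show "norm (recenter x0 q b0 s0 F y - recenter (x + r *\<^sub>R x0) (r * q) b' s' \<Phi> y) \<le> \<epsilon>" .
  qed
qed

lemma blowup_approx_limit:
  assumes F: "\<And>n::nat. blowup_approx \<kappa> K \<Phi> (F n)"
    and lim: "\<And>R. uniform_limit (cball 0 R) F G sequentially"
  shows "blowup_approx \<kappa> K \<Phi> G"
  unfolding blowup_approx_def
proof (intro allI impI)
  fix R \<epsilon> :: real assume R: "R > 0" and e: "\<epsilon> > 0"
  obtain n where "\<forall>m\<ge>n. \<forall>y\<in>cball 0 R. dist (F m y) (G y) < \<epsilon> / 2"
    using uniform_limitD[OF lim half_gt_zero[OF e], of R] unfolding eventually_sequentially by (elim exE)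
  then have n: "dist (F n y) (G y) < \<epsilon> / 2" if "y \<in> cball 0 R" for y using that by blast
  obtain x r b s k where A: "0 < r" "r < \<epsilon> / 2" "k \<in> K" "dist x k < \<epsilon> / 2" "norm (fst s + snd s) \<le> (\<kappa> + \<epsilon> / 2) * r"
    "\<And>y. y \<in> cball 0 R \<Longrightarrow> norm (F n y - recenter x r b s \<Phi> y) \<le> \<epsilon> / 2"
    by (rule blowup_approxE[OF F[of n] R half_gt_zero[OF e]]) (rule that)
  have "(\<kappa> + \<epsilon> / 2) * r \<le> (\<kappa> + \<epsilon>) * r" using A(1) e by (intro mult_right_mono) auto
  then have "norm (fst s + snd s) \<le> (\<kappa> + \<epsilon>) * r" using A(5) by linarith
  moreover have "norm (G y - recenter x r b s \<Phi> y) \<le> \<epsilon>" if "y \<in> cball 0 R" for y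
    using A(6)[OF that] n[OF that] norm_triangle_ineq[of "G y - F n y" "F n y - recenter x r b s \<Phi> y"]
    by (simp add: dist_norm norm_minus_commute)
  ultimately show "\<exists>x r b s k. 0 < r \<and> r < \<epsilon> \<and> k \<in> K \<and> dist x k < \<epsilon> \<and> norm (fst s + snd s) \<le> (\<kappa> + \<epsilon>) * r
      \<and> (\<forall>y\<in>cball 0 R. norm (G y - recenter x r b s \<Phi> y) \<le> \<epsilon>)"
    using A(1-4) e
    by - (rule exI[of _ x], rule exI[of _ r], rule exI[of _ b], rule exI[of _ s], rule exI[of _ k], auto)
qed

lemma blowupsI:
  assumes "\<And>x. quad_jet C F x" "\<And>x h. fst (second_diff F x h) + snd (second_diff F x h) \<le> 0"
    "blowup_approx \<kappa> K \<Phi> F"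
  shows "F \<in> blowups C \<kappa> K \<Phi>"
  unfolding blowups_def mem_Collect_eq by (intro conjI allI assms)

lemma jet_family_blowups:
  fixes K :: "'a::euclidean_space set"
  shows "jet_family C (blowups C \<kappa> K \<Phi>)"
  unfolding jet_family_def
proof (intro conjI ballI allI impI)
  fix F x assume "F \<in> blowups C \<kappa> K \<Phi>"
  then show "quad_jet C F x" by (simp add: blowups_def)
next
  fix F x b s and r :: real assume F: "F \<in> blowups C \<kappa> K \<Phi>" and r: "r > 0"
  have "quad_jet C (recenter x r b s F) y" for y
    by (rule quad_jet_recenter[OF _ r]) (use F in \<open>simp add: blowups_def\<close>)
  moreover have "fst (second_diff (recenter x r b s F) y h) + snd (second_diff (recenter x r b s F) y h) \<le> 0" for y h
  proof -
    have "fst (second_diff F (x + r *\<^sub>R y) (r *\<^sub>R h)) + snd (second_diff F (x + r *\<^sub>R y) (r *\<^sub>R h)) \<le> 0"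
      using F by (simp add: blowups_def)
    then have "inverse (r\<^sup>2) * (fst (second_diff F (x + r *\<^sub>R y) (r *\<^sub>R h)) + snd (second_diff F (x + r *\<^sub>R y) (r *\<^sub>R h))) \<le> 0"
      by (intro mult_nonneg_nonpos) auto
    then show ?thesis by (simp add: second_diff_recenter distrib_left)
  qed
  moreover have "blowup_approx \<kappa> K \<Phi> (recenter x r b s F)"
    by (rule blowup_approx_recenter[OF _ r]) (use F in \<open>simp add: blowups_def\<close>)
  ultimately show "recenter x r b s F \<in> blowups C \<kappa> K \<Phi>" by (rule blowupsI)
next
  fix F G assume H: "(\<forall>n. F n \<in> blowups C \<kappa> K \<Phi>) \<and> (\<forall>S. compact S \<longrightarrow> uniform_limit S F G sequentially) \<and> (\<forall>x. quad_jet C G x)"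
  note ul = H[THEN conjunct2, THEN conjunct1, rule_format]
  have lim: "(\<lambda>n. F n y) \<longlonglongrightarrow> G y" for y
    by (rule tendsto_uniform_limitI[where S = "{y}", OF ul]) auto
  have "fst (second_diff G x h) + snd (second_diff G x h) \<le> 0" for x h
  proof (rule LIMSEQ_le_const2)
    show "(\<lambda>n. fst (second_diff (F n) x h) + snd (second_diff (F n) x h)) \<longlonglongrightarrow> fst (second_diff G x h) + snd (second_diff G x h)"
      by (intro tendsto_intros tendsto_second_diff lim)
  qed (use H in \<open>simp add: blowups_def\<close>)
  moreover have "blowup_approx \<kappa> K \<Phi> G"
    by (rule blowup_approx_limit[of \<kappa> K \<Phi> F]) (use H ul in \<open>simp_all add: blowups_def\<close>)
  ultimately show "G \<in> blowups C \<kappa> K \<Phi>" using H by (intro blowupsI) auto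
qed

text \<open>K nearly fills suitable balls at arbitrarily small scales, so in rescaled coordinates
  the points with jets become dense. The jet bound and the sign of the summed second differences are
  known on K only, and density carries both to every point of the limit.\<close>

lemma blowups_nonempty:
  fixes K :: "'a::euclidean_space set"
  assumes K: "compact K" "\<not> negligible K" and C: "C \<ge> 0"
    and jets: "\<And>x. x \<in> K \<Longrightarrow> \<exists>s. norm (fst s + snd s) \<le> \<kappa>
       \<and> (\<forall>h. norm (\<Phi> (x + h) - \<Phi> x - lin s h) \<le> C * (norm h)\<^sup>2)"
    and conc: "\<And>x h. x \<in> K \<Longrightarrow> fst (second_diff \<Phi> x h) + snd (second_diff \<Phi> x h) \<le> 0"
  shows "blowups C \<kappa> K \<Phi> \<noteq> {}"
proof -
  have "\<exists>x r. x \<in> K \<and> 0 < r \<and> r < 1 / (real n + 1) \<and> (\<forall>y. norm y \<le> real n + 1 \<longrightarrow> (\<exists>k\<in>K. norm (x + r *\<^sub>R y - k) \<le> r / (real n + 1)))" for n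
  proof -
    obtain x r where "x \<in> K" "0 < r" "r < 1 / (real n + 1)" "\<And>y. norm y \<le> real n + 1 \<Longrightarrow> \<exists>k\<in>K. norm (x + r *\<^sub>R y - k) \<le> r / (real n + 1)"
      by (rule non_negligible_dense_at_scale[OF K, of "real n + 1"]) (simp, rule that)
    then show ?thesis by blast
  qed
  then obtain x r where xr: "\<And>n. x n \<in> K" "\<And>n. 0 < r n" "\<And>n. r n < 1 / (real n + 1)"
    "\<And>n y. norm y \<le> real n + 1 \<Longrightarrow> \<exists>k\<in>K. norm (x n + r n *\<^sub>R y - k) \<le> r n / (real n + 1)"
    by metis
  have "\<forall>n. \<exists>s. norm (fst s + snd s) \<le> \<kappa> \<and> (\<forall>h. norm (\<Phi> (x n + h) - \<Phi> (x n) - lin s h) \<le> C * (norm h)\<^sup>2)"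
    using jets xr(1) by blast
  then obtain s where s: "\<And>n. norm (fst (s n) + snd (s n)) \<le> \<kappa>"
    "\<And>n h. norm (\<Phi> (x n + h) - \<Phi> (x n) - lin (s n) h) \<le> C * (norm h)\<^sup>2" by metis
  define F where "F n = recenter (x n) (r n) (\<Phi> (x n)) (r n *\<^sub>R s n) \<Phi>" for n
  define L where "L n = {y. x n + r n *\<^sub>R y \<in> K}" for n
  have bd: "norm (F n y) \<le> C * (norm y)\<^sup>2" for n y
    using s(2)[of n "r n *\<^sub>R y"] xr(2)[of n]
    by (simp add: F_def recenter_def divide_simps power_mult_distrib mult_ac)
  have Fj: "quad_jet C (F n) k" if "k \<in> L n" for n k
    unfolding F_def
  proof (rule quad_jet_recenter[OF _ xr(2)])
    show "quad_jet C \<Phi> (x n + r n *\<^sub>R k)" using jets that unfolding quad_jet_def L_def by blast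
  qed
  have dense: "\<exists>k. (\<forall>n. k n \<in> L n) \<and> k \<longlonglongrightarrow> y" for y
  proof -
    \<comment> \<open>The point 0 lies in every \<open>L n\<close> because \<open>x n\<close> lies
      in K; it is the default for the finitely many n with y outside the controlled ball.\<close>
    have "\<exists>z. z \<in> L n \<and> (norm y \<le> real n + 1 \<longrightarrow> norm (z - y) \<le> 1 / (real n + 1))" for n
    proof (cases "norm y \<le> real n + 1")
      case True
      then obtain k where k: "k \<in> K" "norm (x n + r n *\<^sub>R y - k) \<le> r n / (real n + 1)" using xr(4) by blast
      define z where "z = (k - x n) /\<^sub>R r n"
      have "x n + r n *\<^sub>R z = k" using xr(2)[of n] by (simp add: z_def)
      moreover have "r n * norm (z - y) \<le> r n * (1 / (real n + 1))"
      proof -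
        have "norm (x n + r n *\<^sub>R y - k) = norm (r n *\<^sub>R (y - z))"
          using calculation by (simp add: scaleR_diff_right algebra_simps flip: calculation)
        then show ?thesis using k(2) xr(2)[of n] by (simp add: norm_minus_commute)
      qed
      then have "norm (z - y) \<le> 1 / (real n + 1)" using mult_le_cancel_left_pos[OF xr(2)[of n]] by blast
      ultimately show ?thesis using k(1) by (intro exI[of _ z]) (simp add: L_def)
    next
      case False
      then show ?thesis using xr(1) by (intro exI[of _ 0]) (simp add: L_def)
    qed
    then obtain k where k: "\<And>n. k n \<in> L n" "\<And>n. norm y \<le> real n + 1 \<Longrightarrow> norm (k n - y) \<le> 1 / (real n + 1)" by metis
    obtain N where N: "norm y \<le> real N" using real_arch_simple by blast
    have "(\<lambda>n. k n - y) \<longlonglongrightarrow> 0"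
    proof (rule Lim_null_comparison)
      show "\<forall>\<^sub>F n in sequentially. norm (k n - y) \<le> inverse (real (Suc n))"
        unfolding eventually_sequentially
      proof (intro exI[of _ N] allI impI)
        fix n assume "N \<le> n"
        then have "norm (k n - y) \<le> 1 / (real n + 1)" using N by (intro k(2)) linarith
        then show "norm (k n - y) \<le> inverse (real (Suc n))" by (simp add: inverse_eq_divide add.commute)
      qed
    qed (rule LIMSEQ_inverse_real_of_nat)
    then have "k \<longlonglongrightarrow> y" by (simp add: LIM_zero_iff)
    then show ?thesis using k(1) by blast
  qed
  obtain j G where j: "strict_mono (j :: nat \<Rightarrow> nat)" and ae: "asymp_equicontinuous (\<lambda>n. F (j n))"
    and lim: "\<And>y. (\<lambda>n. F (j n) y) \<longlonglongrightarrow> G y" and G: "\<And>x. quad_jet C G x" "\<And>y. norm (G y) \<le> C * (norm y)\<^sup>2"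
    by (rule quad_jet_compactness[where F = F and K = L, OF bd C Fj dense]) (assumption, rule that)
  have "fst (second_diff G y h) + snd (second_diff G y h) \<le> 0" for y h
  proof -
    obtain k where k: "\<And>n. k n \<in> L n" "k \<longlonglongrightarrow> y" using dense by blast
    have kj: "(\<lambda>n. k (j n)) \<longlonglongrightarrow> y" using LIMSEQ_subseq_LIMSEQ[OF k(2) j] by (simp add: o_def)
    have le: "fst (second_diff (F n) (k n) h) + snd (second_diff (F n) (k n) h) \<le> 0" for n
    proof -
      have "inverse ((r n)\<^sup>2) * (fst (second_diff \<Phi> (x n + r n *\<^sub>R k n) (r n *\<^sub>R h)) + snd (second_diff \<Phi> (x n + r n *\<^sub>R k n) (r n *\<^sub>R h))) \<le> 0"
        using conc k(1)[of n] by (intro mult_nonneg_nonpos) (auto simp: L_def)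
      then show ?thesis by (simp add: F_def second_diff_recenter distrib_left)
    qed
    note mv = asymp_equicontinuous_moving_limit[OF ae lim]
    have sd: "(\<lambda>n. second_diff (F (j n)) (k (j n)) h) \<longlonglongrightarrow> second_diff G y h"
      unfolding second_diff_def by (intro tendsto_intros mv kj)
    show ?thesis
    proof (rule LIMSEQ_le_const2)
      show "(\<lambda>n. fst (second_diff (F (j n)) (k (j n)) h) + snd (second_diff (F (j n)) (k (j n)) h)) \<longlonglongrightarrow> fst (second_diff G y h) + snd (second_diff G y h)"
        by (intro tendsto_intros sd)
    qed (use le in blast)
  qed
  moreover have "blowup_approx \<kappa> K \<Phi> G" unfolding blowup_approx_def
  proof (intro allI impI)
    fix R \<epsilon> :: real assume R: "R > 0" and e: "\<epsilon> > 0"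
    obtain N where N: "\<And>n y. n \<ge> N \<Longrightarrow> y \<in> cball 0 R \<Longrightarrow> dist (F (j n) y) (G y) < \<epsilon>"
    proof -
      obtain N where "\<forall>n\<ge>N. \<forall>y\<in>cball 0 R. dist (F (j n) y) (G y) < \<epsilon>"
        using uniform_limitD[OF asymp_equicontinuous_uniform_limit[OF ae lim compact_cball] e, of 0 R]
        unfolding eventually_sequentially by (elim exE)
      then show thesis by (intro that) blast
    qed
    obtain N2 :: nat where N2: "1 / \<epsilon> < real N2" using reals_Archimedean2 by blast
    define n where "n = j (max N N2)"
    have "real N2 \<le> real n" unfolding n_def using seq_suble[OF j, of "max N N2"] by linarith
    then have "1 / \<epsilon> < real n + 1" using N2 by linarith
    then have "1 / (real n + 1) < \<epsilon>" using e by (simp add: divide_less_eq mult.commute)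
    then have rn: "r n < \<epsilon>" using xr(3)[of n] by linarith
    have "fst (r n *\<^sub>R s n) + snd (r n *\<^sub>R s n) = r n *\<^sub>R (fst (s n) + snd (s n))"
      by (simp add: scaleR_add_right)
    then have "norm (fst (r n *\<^sub>R s n) + snd (r n *\<^sub>R s n)) = r n * norm (fst (s n) + snd (s n))"
      using xr(2)[of n] by simp
    also have "\<dots> \<le> (\<kappa> + \<epsilon>) * r n" using s(1)[of n] xr(2)[of n] e by (subst mult.commute) (intro mult_right_mono; simp)
    finally have sn: "norm (fst (r n *\<^sub>R s n) + snd (r n *\<^sub>R s n)) \<le> (\<kappa> + \<epsilon>) * r n" .
    have app: "norm (G y - recenter (x n) (r n) (\<Phi> (x n)) (r n *\<^sub>R s n) \<Phi> y) \<le> \<epsilon>" if "y \<in> cball 0 R" for y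
      using N[of "max N N2" y] that unfolding n_def[symmetric] F_def by (simp add: dist_norm norm_minus_commute)
    show "\<exists>x r b s k. 0 < r \<and> r < \<epsilon> \<and> k \<in> K \<and> dist x k < \<epsilon> \<and> norm (fst s + snd s) \<le> (\<kappa> + \<epsilon>) * r
      \<and> (\<forall>y\<in>cball 0 R. norm (G y - recenter x r b s \<Phi> y) \<le> \<epsilon>)"
      using xr(1)[of n] xr(2)[of n] rn sn app e
      by (intro exI[of _ "x n"] exI[of _ "r n"] exI[of _ "\<Phi> (x n)"] exI[of _ "r n *\<^sub>R s n"]) auto
  qed
  ultimately have "G \<in> blowups C \<kappa> K \<Phi>" using G(1) by (intro blowupsI)
  then show ?thesis by blast
qed

section \<open>Second-order jets of sums of semiconvex functions\<close>

text \<open>A second-order superjet without error term, so that the quadratic itself serves as test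
  function. At boundary points of \<open>S\<close> only neighbours in \<open>S\<close>
  count.\<close>

definition quad_above :: "(real ^ 'n) set \<Rightarrow> (real ^ 'n \<Rightarrow> real) \<Rightarrow> real ^ 'n \<Rightarrow> real ^ 'n \<Rightarrow> real ^ 'n ^ 'n \<Rightarrow> bool" where
  "quad_above S f x p X \<longleftrightarrow>
    (\<forall>\<^sub>F y in at x within S. f y \<le> f x + p \<bullet> (y - x) + ((y - x) \<bullet> (X *v (y - x))) / 2)"

section \<open>Symmetric matrices\<close>

lemma scaled_id_mult_vec: "(t *\<^sub>R mat 1) *v v = t *\<^sub>R (v :: real ^ 'n)"
  by (metis matrix_vector_mul_lid scaleR_matrix_vector_assoc)

lemma sym_matrices_add: "A \<in> sym_matrices \<Longrightarrow> B \<in> sym_matrices \<Longrightarrow> A + B \<in> sym_matrices"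
  by (auto simp: sym_matrices_def transpose_def vec_eq_iff)

lemma sym_matrices_minus: "A \<in> sym_matrices \<Longrightarrow> - A \<in> sym_matrices"
  by (auto simp: sym_matrices_def transpose_def vec_eq_iff)

lemma sym_matrices_scaled_id: "t *\<^sub>R mat 1 \<in> sym_matrices"
  by (auto simp: sym_matrices_def transpose_def vec_eq_iff mat_def)

lemma sym_matrix_inner: "A \<in> sym_matrices \<Longrightarrow> x \<bullet> (A *v y) = (A *v x) \<bullet> y"
  by (metis (mono_tags, lifting) dot_lmul_matrix mem_Collect_eq sym_matrices_def transpose_matrix_vector inner_commute)

text \<open>A single scale suffices for viscosity tests: a function uniformly close to a quadratic on
  a ball is touched from above, inside that ball, by a slightly steeper quadratic.\<close>

lemma quad_above_of_close:
  fixes f :: "real ^ 'n \<Rightarrow> real"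
  assumes cont: "continuous_on UNIV f" and r: "r > 0" and e: "\<epsilon> > 0" and A: "A \<in> sym_matrices"
    and close: "\<And>y. y \<in> cball 0 1 \<Longrightarrow> \<bar>u + a \<bullet> y + (y \<bullet> (A *v y)) / 2 - (f (x + r *\<^sub>R y) - b - s \<bullet> y) / r\<^sup>2\<bar> \<le> \<epsilon>"
  obtains y where "norm y < 1"
    "quad_above UNIV f (x + r *\<^sub>R y) (s /\<^sub>R r + r *\<^sub>R (a + A *v y + (8 * \<epsilon>) *\<^sub>R y)) (A + (8 * \<epsilon>) *\<^sub>R mat 1)"
proof -
  define U where "U y = u + a \<bullet> y + (y \<bullet> (A *v y)) / 2" for y
  have cU: "continuous_on UNIV U" unfolding U_def
    by (intro continuous_intros matrix_vector_mult_linear_continuous_on) auto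
  \<comment> \<open>On the unit sphere the subtracted square
    \<open>4 * \<epsilon> * r\<^sup>2\<close> exceeds twice the error
    \<open>\<epsilon> * r\<^sup>2\<close>, so h is smaller there than at 0 and has an interior
    maximum. Its derivatives are the terms with 8 \<epsilon> in slope and matrix.\<close>
  define h where "h y = f (x + r *\<^sub>R y) - b - s \<bullet> y - r\<^sup>2 * U y - 4 * \<epsilon> * r\<^sup>2 * (norm y)\<^sup>2" for y
  have hc: "\<bar>f (x + r *\<^sub>R y) - b - s \<bullet> y - r\<^sup>2 * U y\<bar> \<le> \<epsilon> * r\<^sup>2" if "y \<in> cball 0 1" for y
  proof -
    have alg: "W - r\<^sup>2 * u = - (r\<^sup>2 * (u - W / r\<^sup>2))" for W u
      using r by (simp add: right_diff_distrib)
    have "f (x + r *\<^sub>R y) - b - s \<bullet> y - r\<^sup>2 * U y = - (r\<^sup>2 * (U y - (f (x + r *\<^sub>R y) - b - s \<bullet> y) / r\<^sup>2))"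
      by (rule alg)
    then have "\<bar>f (x + r *\<^sub>R y) - b - s \<bullet> y - r\<^sup>2 * U y\<bar> = r\<^sup>2 * \<bar>U y - (f (x + r *\<^sub>R y) - b - s \<bullet> y) / r\<^sup>2\<bar>"
      by (simp add: abs_mult)
    also have "\<dots> \<le> r\<^sup>2 * \<epsilon>" using close[OF that] by (intro mult_left_mono) (auto simp: U_def)
    finally show ?thesis by (simp add: mult.commute)
  qed
  have "continuous_on (cball 0 1) h" unfolding h_def
    by (intro continuous_intros continuous_on_compose2[OF cont] continuous_on_subset[OF cU]) auto
  then obtain z where z: "z \<in> cball 0 1" "\<And>y. y \<in> cball 0 1 \<Longrightarrow> h y \<le> h z"
    using continuous_attains_sup[of "cball 0 1" h] by auto
  have z1: "norm z < 1"
  proof (rule ccontr)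
    assume "\<not> norm z < 1"
    then have "norm z = 1" using z(1) by simp
    then have "h z \<le> \<epsilon> * r\<^sup>2 - 4 * \<epsilon> * r\<^sup>2" using hc[OF z(1)] by (simp add: h_def)
    moreover have "h 0 \<ge> - (\<epsilon> * r\<^sup>2)" using hc[of 0] by (simp add: h_def)
    moreover have "\<epsilon> * r\<^sup>2 > 0" using e r by simp
    ultimately show False using z(2)[of 0] by simp
  qed
  let ?x = "x + r *\<^sub>R z" and ?p = "s /\<^sub>R r + r *\<^sub>R (a + A *v z + (8 * \<epsilon>) *\<^sub>R z)" and ?X = "A + (8 * \<epsilon>) *\<^sub>R mat 1"
  have le: "f y \<le> f ?x + ?p \<bullet> (y - ?x) + ((y - ?x) \<bullet> (?X *v (y - ?x))) / 2" if y: "dist y ?x < r * (1 - norm z)" for y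
  proof -
    define d where "d = (y - ?x) /\<^sub>R r"
    have yd: "y = x + r *\<^sub>R (z + d)" "y - ?x = r *\<^sub>R d" using r by (simp_all add: d_def scaleR_add_right)
    have "norm d < 1 - norm z" using y r by (simp add: yd(2) dist_norm)
    then have "norm (z + d) \<le> 1" using norm_triangle_ineq[of z d] by simp
    then have "h (z + d) \<le> h z" by (intro z(2)) auto
    then have "f y \<le> f ?x + s \<bullet> d + r\<^sup>2 * (U (z + d) - U z) + 4 * \<epsilon> * r\<^sup>2 * ((norm (z + d))\<^sup>2 - (norm z)\<^sup>2)"
      unfolding h_def yd(1)[symmetric] by (simp add: inner_simps algebra_simps)
    also have "U (z + d) - U z = a \<bullet> d + (A *v z) \<bullet> d + (d \<bullet> (A *v d)) / 2"
      using sym_matrix_inner[OF A, of z d]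
      by (simp add: U_def inner_simps matrix_vector_right_distrib inner_commute[of d "A *v z"] add_divide_distrib)
    also have "(norm (z + d))\<^sup>2 - (norm z)\<^sup>2 = 2 * (z \<bullet> d) + d \<bullet> d"
      by (simp add: power2_norm_eq_inner inner_simps inner_commute)
    finally have 1: "f y \<le> f ?x + s \<bullet> d + r\<^sup>2 * (a \<bullet> d + (A *v z) \<bullet> d + (d \<bullet> (A *v d)) / 2) + 4 * \<epsilon> * r\<^sup>2 * (2 * (z \<bullet> d) + d \<bullet> d)" .
    have e1: "?p \<bullet> (y - ?x) = s \<bullet> d + r\<^sup>2 * (a \<bullet> d + (A *v z) \<bullet> d + 8 * \<epsilon> * (z \<bullet> d))"
      unfolding yd(2) using r by (simp add: inner_simps power2_eq_square algebra_simps)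
    have e2: "(y - ?x) \<bullet> (?X *v (y - ?x)) = r\<^sup>2 * (d \<bullet> (A *v d) + 8 * \<epsilon> * (d \<bullet> d))"
      unfolding yd(2) by (simp add: matrix_vector_mult_add_rdistrib scaled_id_mult_vec matrix_vector_mult_scaleR inner_simps power2_eq_square algebra_simps)
    show ?thesis unfolding e1 e2 using 1 by (simp add: algebra_simps add_divide_distrib)
  qed
  have "quad_above UNIV f ?x ?p ?X" unfolding quad_above_def eventually_at
    using le z1 r by (intro exI[of _ "r * (1 - norm z)"]) auto
  then show thesis using that z1 by blast
qed

text \<open>Takes the place of Jensen's lemma combined with Alexandrov's theorem. The touching
  points are found separately for f and g on one small ball, hence may differ; the last conclusion
  keeps the two values close to the maximum of the sum.\<close>

lemma semiconvex_sum_jets: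
  fixes f g :: "real ^ 'n \<Rightarrow> real"
  assumes cf: "continuous_on UNIV f" and cg: "continuous_on UNIV g"
    and f: "semiconvex c f" and g: "semiconvex c g" and c: "c \<ge> 0"
    and D: "D > 0" and growth: "\<And>x. f x + g x \<le> B0 - D * (norm x)\<^sup>2" and eta: "\<eta> > 0"
  obtains x1 x2 p q X Y where "X \<in> sym_matrices" "Y \<in> sym_matrices" "dist x1 x2 < \<eta>" "norm (p + q) < \<eta>"
    "\<And>v. v \<bullet> ((X + Y) *v v) \<le> \<eta> * (norm v)\<^sup>2"
    "quad_above UNIV f x1 p X" "quad_above UNIV g x2 q Y" "\<And>x. f x + g x - \<eta> \<le> f x1 + g x2"
proof -
  let ?w = "\<lambda>x. f x + g x"
  have cw: "continuous_on UNIV ?w" by (intro continuous_intros cf cg)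
  obtain xs where xs: "\<And>y. ?w y \<le> ?w xs + 0 \<bullet> (y - xs)"
    by (rule touching_plane_exists[OF cw D growth, of 0]) (rule that)
  have "compact (touching 1 ?w)" by (rule compact_touching[OF cw D growth]) simp
  then obtain R0 where R0: "R0 > 0" "\<And>x. x \<in> touching 1 ?w \<Longrightarrow> norm x \<le> R0"
    using compact_imp_bounded bounded_pos by metis
  have "xs \<in> touching 1 ?w" using xs by (auto simp: touching_def intro!: exI[of _ 0])
  then have xsR: "norm xs \<le> R0" by (rule R0(2))
  \<comment> \<open>R0 was fixed for slope 1 beforehand, since \<kappa> depends on it. A contact
    point of slope at most \<kappa> misses the maximum of the sum by at most
    \<open>\<kappa> * (2 * R0) \<le> \<eta> / 4\<close>; the other bounds keep K inside the larger
    contact set and the slope of the sum small.\<close>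
  define \<kappa> where "\<kappa> = min 1 (min (\<eta> / 4) (\<eta> / (8 * R0)))"
  have k: "\<kappa> > 0" "\<kappa> \<le> 1" "\<kappa> \<le> \<eta> / 4" using eta R0 by (auto simp: \<kappa>_def)
  have "\<kappa> \<le> \<eta> / (8 * R0)" by (simp add: \<kappa>_def)
  then have kR: "\<kappa> * (2 * R0) \<le> \<eta> / 4" using R0(1) by (simp add: field_simps)
  define K where "K = touching \<kappa> ?w"
  have KR: "norm x \<le> R0" if xK: "x \<in> K" for x
  proof -
    obtain p where p: "norm p \<le> \<kappa>" "\<forall>y. ?w y \<le> ?w x + p \<bullet> (y - x)"
      using xK unfolding K_def touching_def mem_Collect_eq by (elim exE conjE)
    then have "norm p \<le> 1 \<and> (\<forall>y. ?w y \<le> ?w x + p \<bullet> (y - x))" using k(2) by simp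
    then have "x \<in> touching 1 ?w" unfolding touching_def mem_Collect_eq by (rule exI)
    then show ?thesis by (rule R0(2))
  qed
  have Kc: "compact K" unfolding K_def by (rule compact_touching[OF cw D growth]) (use k in simp)
  have Kn: "\<not> negligible K" unfolding K_def by (rule touching_not_negligible[OF cw D growth f g c k(1)])
  define \<Phi> where "\<Phi> x = (f x, g x)" for x
  have ne: "blowups (2 * c) \<kappa> K \<Phi> \<noteq> {}"
  proof (rule blowups_nonempty[OF Kc Kn])
    fix x assume "x \<in> K"
    then obtain p where p: "norm p \<le> \<kappa>" "\<And>y. ?w y \<le> ?w x + p \<bullet> (y - x)"
      unfolding K_def touching_def by blast
    obtain s where "fst s + snd s = p" "\<And>h. norm ((f (x + h), g (x + h)) - (f x, g x) - lin s h) \<le> 2 * c * (norm h)\<^sup>2"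
      by (rule touching_slopes[OF f g c p(2)]) (rule that)
    then show "\<exists>s. norm (fst s + snd s) \<le> \<kappa> \<and> (\<forall>h. norm (\<Phi> (x + h) - \<Phi> x - lin s h) \<le> 2 * c * (norm h)\<^sup>2)"
      using p(1) unfolding \<Phi>_def by blast
    show "fst (second_diff \<Phi> x h) + snd (second_diff \<Phi> x h) \<le> 0" for h
      using p(2)[of "x + h"] p(2)[of "x - h"] by (simp add: second_diff_def \<Phi>_def)
  qed (use c in simp)
  \<comment> \<open>The directions that determine a quadratic polynomial, to be paired with the two
    functionals that select the components f and g.\<close>
  define E :: "(real ^ 'n) set" where "E = range (\<lambda>i. axis i 1) \<union> (\<lambda>(i, j). axis i 1 + axis j 1) ` UNIV"
  define Dir :: "((real \<times> real) \<times> (real ^ 'n)) set" where "Dir = {(1, 0), (0, 1)} \<times> E"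
  have "finite Dir" by (simp add: Dir_def E_def)
  from jet_family_finite_directions[OF this jet_family_blowups _ ne] c
  obtain F where F: "F \<in> blowups (2 * c) \<kappa> K \<Phi>"
    and Fd: "\<forall>(d, e)\<in>Dir. \<exists>M. \<forall>x t. d \<bullet> second_diff F x (t *\<^sub>R e) = M * t\<^sup>2" by auto
  have cF: "continuous_on UNIV F"
    by (rule continuous_on_quad_jet[of "2 * c"]) (use F in \<open>simp add: blowups_def\<close>)
  have sdf: "second_diff (\<lambda>y. fst (F y)) x h = (1, 0) \<bullet> second_diff F x h"
    and sds: "second_diff (\<lambda>y. snd (F y)) x h = (0, 1) \<bullet> second_diff F x h" for x h
    by (simp_all add: second_diff_def inner_prod_def)
  have E1: "\<exists>M. \<forall>x t. (1, 0) \<bullet> second_diff F x (t *\<^sub>R e) = M * t\<^sup>2"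
    and E2: "\<exists>M. \<forall>x t. (0, 1) \<bullet> second_diff F x (t *\<^sub>R e) = M * t\<^sup>2" if "e \<in> E" for e
    using Fd that by (auto simp: Dir_def)
  have inE: "axis i 1 \<in> E" "axis i 1 + axis j 1 \<in> E" for i j by (auto simp: E_def)
  obtain A a where A: "A \<in> sym_matrices" "\<And>y. fst (F y) = fst (F 0) + a \<bullet> y + (y \<bullet> (A *v y)) / 2"
    by (rule quadratic_of_second_diffs[of "\<lambda>y. fst (F y)"])
      (unfold sdf, intro continuous_intros cF, rule E1[OF inE(1)], rule E1[OF inE(2)], rule that)
  obtain B b where B: "B \<in> sym_matrices" "\<And>y. snd (F y) = snd (F 0) + b \<bullet> y + (y \<bullet> (B *v y)) / 2"
    by (rule quadratic_of_second_diffs[of "\<lambda>y. snd (F y)"])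
      (unfold sds, intro continuous_intros cF, rule E2[OF inE(1)], rule E2[OF inE(2)], rule that)
  have AB: "v \<bullet> (A *v v) + v \<bullet> (B *v v) \<le> 0" for v
  proof -
    have "fst (second_diff F 0 v) + snd (second_diff F 0 v) \<le> 0" using F by (simp add: blowups_def)
    moreover have "fst (second_diff F 0 v) = fst (F v) + fst (F (- v)) - 2 * fst (F 0)"
      "snd (second_diff F 0 v) = snd (F v) + snd (F (- v)) - 2 * snd (F 0)" by (simp_all add: second_diff_def)
    moreover have "fst (F v) + fst (F (- v)) - 2 * fst (F 0) = v \<bullet> (A *v v)"
      unfolding A(2)[of v] A(2)[of "- v"] by (simp add: linear_neg)
    moreover have "snd (F v) + snd (F (- v)) - 2 * snd (F 0) = v \<bullet> (B *v v)"
      unfolding B(2)[of v] B(2)[of "- v"] by (simp add: linear_neg)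
    ultimately show ?thesis by linarith
  qed
  obtain LA where LA: "LA > 0" "\<And>y. norm (A *v y) \<le> norm y * LA"
    using bounded_linear.pos_bounded[OF matrix_vector_mul_bounded_linear[of A]] by blast
  obtain LB where LB: "LB > 0" "\<And>y. norm (B *v y) \<le> norm y * LB"
    using bounded_linear.pos_bounded[OF matrix_vector_mul_bounded_linear[of B]] by blast
  \<comment> \<open>Bounds the summed gradients of the two steepened limit quadratics on the unit
    ball, where each correction 8 \<epsilon> y has norm at most 8.\<close>
  define M where "M = norm a + LA + norm b + LB + 16"
  have M: "M \<ge> 16" using LA LB by (simp add: M_def)
  have uc: "\<exists>d>0. \<forall>x y. norm x \<le> R0 + 2 \<longrightarrow> norm y \<le> R0 + 2 \<longrightarrow> dist x y < d \<longrightarrow> \<bar>h x - h y\<bar> < \<eta> / 4"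
    if "continuous_on UNIV h" for h :: "real ^ 'n \<Rightarrow> real"
  proof -
    have "uniformly_continuous_on (cball 0 (R0 + 2)) h"
      by (rule compact_uniformly_continuous[OF continuous_on_subset[OF that subset_UNIV] compact_cball])
    moreover have "\<eta> / 4 > 0" using eta by simp
    ultimately obtain d where "d > 0"
      "\<And>x y. y \<in> cball 0 (R0 + 2) \<Longrightarrow> x \<in> cball 0 (R0 + 2) \<Longrightarrow> dist x y < d \<Longrightarrow> dist (h x) (h y) < \<eta> / 4"
      by (rule uniformly_continuous_onE) (rule that)
    then show ?thesis by (intro exI[of _ d]) (simp add: dist_real_def)
  qed
  obtain d1 where d1: "d1 > 0" "\<forall>x y. norm x \<le> R0 + 2 \<longrightarrow> norm y \<le> R0 + 2 \<longrightarrow> dist x y < d1 \<longrightarrow> \<bar>f x - f y\<bar> < \<eta> / 4"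
    using uc[OF cf] by (elim exE conjE)
  obtain d2 where d2: "d2 > 0" "\<forall>x y. norm x \<le> R0 + 2 \<longrightarrow> norm y \<le> R0 + 2 \<longrightarrow> dist x y < d2 \<longrightarrow> \<bar>g x - g y\<bar> < \<eta> / 4"
    using uc[OF cg] by (elim exE conjE)
  \<comment> \<open>The terms with d1 and d2 keep f and g within \<eta> / 4 of their values at the
    contact point k0; the last one controls the slope error \<open>\<epsilon> * (1 + M)\<close> and
    the Hessian excess 16 \<epsilon>.\<close>
  define \<epsilon> where "\<epsilon> = min (min 1 (min (d1 / 2) (d2 / 2))) (\<eta> / (16 * (1 + M)))"
  have e: "\<epsilon> > 0" "\<epsilon> \<le> 1" "2 * \<epsilon> \<le> d1" "2 * \<epsilon> \<le> d2" using d1 d2 eta M by (auto simp: \<epsilon>_def)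
  have "\<epsilon> \<le> \<eta> / (16 * (1 + M))" by (simp add: \<epsilon>_def)
  then have eM: "16 * (\<epsilon> * (1 + M)) \<le> \<eta>" using M by (simp add: field_simps)
  have "\<epsilon> * 1 \<le> \<epsilon> * (1 + M)" using e M by (intro mult_left_mono) auto
  then have e16: "16 * \<epsilon> \<le> \<eta>" using eM by linarith
  have "blowup_approx \<kappa> K \<Phi> F" using F by (simp add: blowups_def)
  then obtain x r b' s k0 where app: "0 < r" "r < \<epsilon>" "k0 \<in> K" "dist x k0 < \<epsilon>" "norm (fst s + snd s) \<le> (\<kappa> + \<epsilon>) * r"
    "\<And>y. y \<in> cball 0 1 \<Longrightarrow> norm (F y - recenter x r b' s \<Phi> y) \<le> \<epsilon>"
    by (rule blowup_approxE[OF _ zero_less_one e(1)]) (rule that)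
  have clf: "\<bar>fst (F 0) + a \<bullet> y + (y \<bullet> (A *v y)) / 2 - (f (x + r *\<^sub>R y) - fst b' - fst s \<bullet> y) / r\<^sup>2\<bar> \<le> \<epsilon>"
    and clg: "\<bar>snd (F 0) + b \<bullet> y + (y \<bullet> (B *v y)) / 2 - (g (x + r *\<^sub>R y) - snd b' - snd s \<bullet> y) / r\<^sup>2\<bar> \<le> \<epsilon>"
    if "y \<in> cball 0 1" for y
  proof -
    define z where "z = F y - recenter x r b' s \<Phi> y"
    have "norm z \<le> \<epsilon>" using app(6)[OF that] by (simp add: z_def)
    then have "\<bar>fst z\<bar> \<le> \<epsilon>" "\<bar>snd z\<bar> \<le> \<epsilon>"
      using norm_fst_le[of "fst z" "snd z"] norm_snd_le[of "snd z" "fst z"] by simp_all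
    then show "\<bar>fst (F 0) + a \<bullet> y + (y \<bullet> (A *v y)) / 2 - (f (x + r *\<^sub>R y) - fst b' - fst s \<bullet> y) / r\<^sup>2\<bar> \<le> \<epsilon>"
      "\<bar>snd (F 0) + b \<bullet> y + (y \<bullet> (B *v y)) / 2 - (g (x + r *\<^sub>R y) - snd b' - snd s \<bullet> y) / r\<^sup>2\<bar> \<le> \<epsilon>"
      unfolding z_def A(2)[symmetric] B(2)[symmetric]
      by (simp_all add: recenter_def \<Phi>_def lin_def divide_inverse mult.commute)
  qed
  obtain y1 where y1: "norm y1 < 1"
    "quad_above UNIV f (x + r *\<^sub>R y1) (fst s /\<^sub>R r + r *\<^sub>R (a + A *v y1 + (8 * \<epsilon>) *\<^sub>R y1)) (A + (8 * \<epsilon>) *\<^sub>R mat 1)"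
    by (rule quad_above_of_close[OF cf app(1) e(1) A(1) clf]) (assumption, rule that)
  obtain y2 where y2: "norm y2 < 1"
    "quad_above UNIV g (x + r *\<^sub>R y2) (snd s /\<^sub>R r + r *\<^sub>R (b + B *v y2 + (8 * \<epsilon>) *\<^sub>R y2)) (B + (8 * \<epsilon>) *\<^sub>R mat 1)"
    by (rule quad_above_of_close[OF cg app(1) e(1) B(1) clg]) (assumption, rule that)
  let ?p = "fst s /\<^sub>R r + r *\<^sub>R (a + A *v y1 + (8 * \<epsilon>) *\<^sub>R y1)"
  let ?q = "snd s /\<^sub>R r + r *\<^sub>R (b + B *v y2 + (8 * \<epsilon>) *\<^sub>R y2)"
  let ?X = "A + (8 * \<epsilon>) *\<^sub>R mat 1" and ?Y = "B + (8 * \<epsilon>) *\<^sub>R mat 1"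
  have near: "dist (x + r *\<^sub>R y) k0 < 2 * \<epsilon>" "norm (x + r *\<^sub>R y) \<le> R0 + 2" if "norm y < 1" for y
  proof -
    have "norm (r *\<^sub>R y) \<le> r" using that app(1) by simp
    then show d: "dist (x + r *\<^sub>R y) k0 < 2 * \<epsilon>"
      using app(2,4) norm_triangle_ineq[of "x - k0" "r *\<^sub>R y"] by (simp add: dist_norm algebra_simps)
    show "norm (x + r *\<^sub>R y) \<le> R0 + 2"
      using d e(2) KR[OF app(3)] norm_triangle_ineq[of "x + r *\<^sub>R y - k0" k0] by (simp add: dist_norm)
  qed
  show thesis
  proof (rule that[OF _ _ _ _ _ y1(2) y2(2)])
    show "?X \<in> sym_matrices" "?Y \<in> sym_matrices"
      by (intro sym_matrices_add A B sym_matrices_scaled_id)+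
    have "dist (x + r *\<^sub>R y1) (x + r *\<^sub>R y2) < 4 * \<epsilon>"
      using near(1)[OF y1(1)] near(1)[OF y2(1)] dist_triangle2[of "x + r *\<^sub>R y1" "x + r *\<^sub>R y2" k0] by linarith
    then show "dist (x + r *\<^sub>R y1) (x + r *\<^sub>R y2) < \<eta>" using e16 e(1) by linarith
    have pq: "?p + ?q = (fst s + snd s) /\<^sub>R r + r *\<^sub>R ((a + A *v y1 + (8 * \<epsilon>) *\<^sub>R y1) + (b + B *v y2 + (8 * \<epsilon>) *\<^sub>R y2))"
      by (simp add: scaleR_add_right)
    have "norm (a + A *v y1 + (8 * \<epsilon>) *\<^sub>R y1) \<le> norm a + LA + 8"
    proof -
      have "norm y1 * LA \<le> 1 * LA" using LA(1) y1(1) by (intro mult_right_mono) auto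
      then have "norm (A *v y1) \<le> LA" using LA(2)[of y1] by linarith
      moreover have "norm ((8 * \<epsilon>) *\<^sub>R y1) \<le> 8" using e(1,2) y1(1) mult_mono[of "8 * \<epsilon>" 8 "norm y1" 1] by simp
      ultimately show ?thesis using norm_triangle_ineq[of "a + A *v y1" "(8 * \<epsilon>) *\<^sub>R y1"] norm_triangle_ineq[of a "A *v y1"] by linarith
    qed
    moreover have "norm (b + B *v y2 + (8 * \<epsilon>) *\<^sub>R y2) \<le> norm b + LB + 8"
    proof -
      have "norm y2 * LB \<le> 1 * LB" using LB(1) y2(1) by (intro mult_right_mono) auto
      then have "norm (B *v y2) \<le> LB" using LB(2)[of y2] by linarith
      moreover have "norm ((8 * \<epsilon>) *\<^sub>R y2) \<le> 8" using e(1,2) y2(1) mult_mono[of "8 * \<epsilon>" 8 "norm y2" 1] by simp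
      ultimately show ?thesis using norm_triangle_ineq[of "b + B *v y2" "(8 * \<epsilon>) *\<^sub>R y2"] norm_triangle_ineq[of b "B *v y2"] by linarith
    qed
    ultimately have "norm ((a + A *v y1 + (8 * \<epsilon>) *\<^sub>R y1) + (b + B *v y2 + (8 * \<epsilon>) *\<^sub>R y2)) \<le> M"
      using norm_triangle_ineq[of "a + A *v y1 + (8 * \<epsilon>) *\<^sub>R y1" "b + B *v y2 + (8 * \<epsilon>) *\<^sub>R y2"] by (simp add: M_def)
    then have "r * norm ((a + A *v y1 + (8 * \<epsilon>) *\<^sub>R y1) + (b + B *v y2 + (8 * \<epsilon>) *\<^sub>R y2)) \<le> \<epsilon> * M"
      using app(1,2) e(1) by (intro mult_mono) auto
    moreover have "norm ((fst s + snd s) /\<^sub>R r) \<le> \<kappa> + \<epsilon>"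
    proof -
      have "norm ((fst s + snd s) /\<^sub>R r) = norm (fst s + snd s) / r"
        unfolding norm_scaleR using app(1) by (simp add: divide_inverse mult.commute)
      then show ?thesis using app(1,5) by (simp add: divide_le_eq)
    qed
    ultimately have "norm (?p + ?q) \<le> \<kappa> + \<epsilon> + \<epsilon> * M"
      unfolding pq using app(1) norm_triangle_ineq[of "(fst s + snd s) /\<^sub>R r" "r *\<^sub>R ((a + A *v y1 + (8 * \<epsilon>) *\<^sub>R y1) + (b + B *v y2 + (8 * \<epsilon>) *\<^sub>R y2))"]
      by simp
    also have "\<dots> < \<eta>" using k(3) eM eta by (simp add: algebra_simps)
    finally show "norm (?p + ?q) < \<eta>" .
    show "v \<bullet> ((?X + ?Y) *v v) \<le> \<eta> * (norm v)\<^sup>2" for v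
    proof -
      have "v \<bullet> ((?X + ?Y) *v v) = (v \<bullet> (A *v v) + v \<bullet> (B *v v)) + 16 * \<epsilon> * (norm v)\<^sup>2"
        by (simp only: matrix_vector_mult_add_rdistrib scaled_id_mult_vec inner_add_right inner_scaleR_right
            power2_norm_eq_inner)
      also have "\<dots> \<le> 0 + \<eta> * (norm v)\<^sup>2" using AB[of v] e16 by (intro add_mono mult_right_mono) auto
      finally show ?thesis by simp
    qed
    show "f z + g z - \<eta> \<le> f (x + r *\<^sub>R y1) + g (x + r *\<^sub>R y2)" for z
    proof -
      have kn: "norm k0 \<le> R0 + 2" using KR[OF app(3)] by simp
      have "\<bar>f (x + r *\<^sub>R y1) - f k0\<bar> < \<eta> / 4"
        using near[OF y1(1)] kn e(3) by (intro d1(2)[rule_format]) auto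
      moreover have "\<bar>g (x + r *\<^sub>R y2) - g k0\<bar> < \<eta> / 4"
        using near[OF y2(1)] kn e(4) by (intro d2(2)[rule_format]) auto
      moreover have "?w xs \<le> ?w k0 + \<eta> / 4"
      proof -
        obtain p where p: "norm p \<le> \<kappa>" "?w xs \<le> ?w k0 + p \<bullet> (xs - k0)" using app(3) unfolding K_def touching_def by blast
        have "p \<bullet> (xs - k0) \<le> norm p * norm (xs - k0)" using Cauchy_Schwarz_ineq2[of p "xs - k0"] by linarith
        also have "\<dots> \<le> \<kappa> * (2 * R0)"
          using p(1) xsR KR[OF app(3)] norm_triangle_ineq4[of xs k0] k(1) by (intro mult_mono) auto
        finally show ?thesis using p(2) kR by linarith
      qed
      moreover have "?w z \<le> ?w xs" using xs[of z] by simp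
      ultimately show ?thesis using eta by linarith
    qed
  qed
qed

section \<open>Sup-convolutions\<close>

text \<open>The supremum ranges over A only. For h continuous on a non-empty compact A and e > 0 the
  result is nevertheless semiconvex on the whole space and lies below a downward paraboloid, as the
  contact argument demands.\<close>

definition sup_conv :: "'a::real_normed_vector set \<Rightarrow> ('a \<Rightarrow> real) \<Rightarrow> real \<Rightarrow> 'a \<Rightarrow> real" where
  "sup_conv A h e x = (SUP y\<in>A. h y - (norm (x - y))\<^sup>2 / (2 * e))"

lemma sup_conv_attained:
  assumes A: "compact A" "A \<noteq> {}" and h: "continuous_on A h"
  obtains y where "y \<in> A" "sup_conv A h e x = h y - (norm (x - y))\<^sup>2 / (2 * e)"
    "\<And>z. z \<in> A \<Longrightarrow> h z - (norm (x - z))\<^sup>2 / (2 * e) \<le> sup_conv A h e x"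
proof -
  have "continuous_on A (\<lambda>y. h y - (norm (x - y))\<^sup>2 / (2 * e))"
    unfolding divide_inverse by (intro continuous_intros h)
  then obtain y where y: "y \<in> A" "\<And>z. z \<in> A \<Longrightarrow> h z - (norm (x - z))\<^sup>2 / (2 * e) \<le> h y - (norm (x - y))\<^sup>2 / (2 * e)"
    using continuous_attains_sup[OF A] by blast
  have "sup_conv A h e x = h y - (norm (x - y))\<^sup>2 / (2 * e)"
    unfolding sup_conv_def by (rule cSup_eq_maximum) (use y in auto)
  then show thesis using that y by simp
qed

text \<open>The paraboloid centred at the maximiser z for x stays below the sup-convolution and
  meets it at x, which gives the slope (z - x) / e. The bound on this slope serves for
  continuity.\<close>

lemma sup_conv_lower:
  fixes A :: "'a::real_inner set"
  assumes A: "compact A" "A \<noteq> {}" and h: "continuous_on A h" and e: "e > 0"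
    and R: "\<And>y. y \<in> A \<Longrightarrow> norm y \<le> R"
  shows "\<exists>a. norm a \<le> (norm x + R) / e
    \<and> (\<forall>y. sup_conv A h e y \<ge> sup_conv A h e x + a \<bullet> (y - x) - 1 / (2 * e) * (norm (y - x))\<^sup>2)"
proof -
  obtain z where z: "z \<in> A" "sup_conv A h e x = h z - (norm (x - z))\<^sup>2 / (2 * e)"
    by (rule sup_conv_attained[OF A h]) (rule that)
  have low: "h z - (norm (y - z))\<^sup>2 / (2 * e) \<le> sup_conv A h e y" for y
    by (rule sup_conv_attained[OF A h, of e y]) (use z(1) in blast)
  define a where "a = (z - x) /\<^sub>R e"
  have "norm a \<le> (norm x + R) / e"
    using norm_triangle_ineq4[of z x] R[OF z(1)] e by (simp add: a_def divide_simps)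
  moreover have "sup_conv A h e y \<ge> sup_conv A h e x + a \<bullet> (y - x) - 1 / (2 * e) * (norm (y - x))\<^sup>2" for y
  proof -
    have exp: "(norm (y - z))\<^sup>2 = (norm (x - z))\<^sup>2 - 2 * ((z - x) \<bullet> (y - x)) + (norm (y - x))\<^sup>2"
      unfolding power2_norm_eq_inner by (simp add: inner_simps inner_commute)
    have "(norm (y - z))\<^sup>2 / (2 * e) = (norm (x - z))\<^sup>2 / (2 * e) - a \<bullet> (y - x) + 1 / (2 * e) * (norm (y - x))\<^sup>2"
    proof -
      have "a \<bullet> (y - x) = ((z - x) \<bullet> (y - x)) / e" by (simp add: a_def divide_inverse mult.commute)
      then show ?thesis unfolding exp using e by (simp add: add_divide_distrib diff_divide_distrib)
    qed
    then show ?thesis using low[of y] z(2) by linarith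
  qed
  ultimately show ?thesis by blast
qed

lemma sup_conv_semiconvex:
  fixes A :: "'a::real_inner set"
  assumes A: "compact A" "A \<noteq> {}" and h: "continuous_on A h" and e: "e > 0"
  shows "semiconvex (1 / (2 * e)) (sup_conv A h e)"
proof -
  obtain R where "\<And>y. y \<in> A \<Longrightarrow> norm y \<le> R" using compact_imp_bounded[OF A(1)] bounded_iff by metis
  from sup_conv_lower[OF A h e this] show ?thesis unfolding semiconvex_def by blast
qed

lemma sup_conv_continuous:
  fixes A :: "'a::real_inner set"
  assumes A: "compact A" "A \<noteq> {}" and h: "continuous_on A h" and e: "e > 0"
  shows "continuous_on UNIV (sup_conv A h e)"
proof -
  obtain R where R: "\<And>y. y \<in> A \<Longrightarrow> norm y \<le> R" using compact_imp_bounded[OF A(1)] bounded_iff by metis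
  let ?f = "sup_conv A h e"
  have low: "?f y - ?f x \<ge> - ((norm x + R) / e * norm (y - x) + 1 / (2 * e) * (norm (y - x))\<^sup>2)" for x y
  proof -
    obtain a where a: "norm a \<le> (norm x + R) / e" "?f y \<ge> ?f x + a \<bullet> (y - x) - 1 / (2 * e) * (norm (y - x))\<^sup>2"
      using sup_conv_lower[OF A h e R, of x] by blast
    have "- (a \<bullet> (y - x)) \<le> norm a * norm (y - x)" using Cauchy_Schwarz_ineq2[of a "y - x"] by linarith
    also have "\<dots> \<le> (norm x + R) / e * norm (y - x)" using a(1) by (intro mult_right_mono) auto
    finally show ?thesis using a(2) by linarith
  qed
  have "isCont ?f x" for x
  proof -
    have lim0: "((\<lambda>y. (norm z + R) / e * norm (y - x) + 1 / (2 * e) * (norm (y - x))\<^sup>2) \<longlongrightarrow> 0) (at x)" for z :: 'a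
      using e by (auto intro!: tendsto_eq_intros)
    have lim1: "((\<lambda>y. (norm y + R) / e * norm (y - x) + 1 / (2 * e) * (norm (y - x))\<^sup>2) \<longlongrightarrow> 0) (at x)"
      using e by (auto intro!: tendsto_eq_intros)
    have "((\<lambda>y. ?f y - ?f x) \<longlongrightarrow> 0) (at x)"
    proof (rule tendsto_sandwich)
      show "((\<lambda>y. - ((norm x + R) / e * norm (y - x) + 1 / (2 * e) * (norm (y - x))\<^sup>2)) \<longlongrightarrow> 0) (at x)"
        using tendsto_minus[OF lim0[of x]] by simp
      show "\<forall>\<^sub>F y in at x. ?f y - ?f x \<le> (norm y + R) / e * norm (y - x) + 1 / (2 * e) * (norm (y - x))\<^sup>2"
        using low[of _ x] by (intro always_eventually allI) (smt (verit) low norm_minus_commute)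
    qed (use low lim1 in auto)
    then show ?thesis by (simp add: isCont_def LIM_zero_iff)
  qed
  then show ?thesis by (simp add: continuous_at_imp_continuous_on)
qed

lemma sup_conv_growth:
  fixes A :: "'a::real_inner set"
  assumes A: "compact A" "A \<noteq> {}" and h: "continuous_on A h" and e: "e > 0"
  obtains B where "\<And>x. sup_conv A h e x \<le> B - 1 / (4 * e) * (norm x)\<^sup>2"
proof -
  obtain R where R: "\<And>y. y \<in> A \<Longrightarrow> norm y \<le> R" using compact_imp_bounded[OF A(1)] bounded_iff by metis
  obtain z where z: "z \<in> A" "\<And>y. y \<in> A \<Longrightarrow> h y \<le> h z" using continuous_attains_sup[OF A h] by blast
  have "sup_conv A h e x \<le> (h z + R\<^sup>2 / (2 * e)) - 1 / (4 * e) * (norm x)\<^sup>2" for x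
  proof -
    obtain y where y: "y \<in> A" "sup_conv A h e x = h y - (norm (x - y))\<^sup>2 / (2 * e)"
      by (rule sup_conv_attained[OF A h]) (rule that)
    have "norm x \<le> norm (x - y) + R" using R[OF y(1)] norm_triangle_ineq[of "x - y" y] by simp
    then have "(norm x)\<^sup>2 \<le> (norm (x - y) + R)\<^sup>2" by (intro power_mono) auto
    also have "\<dots> \<le> 2 * (norm (x - y))\<^sup>2 + 2 * R\<^sup>2"
      using sum_squares_bound[of "norm (x - y)" R] by (simp add: power2_sum)
    finally have "1 / (4 * e) * (norm x)\<^sup>2 \<le> 1 / (4 * e) * (2 * (norm (x - y))\<^sup>2 + 2 * R\<^sup>2)"
      using e by (intro mult_left_mono) auto
    also have "\<dots> = (norm (x - y))\<^sup>2 / (2 * e) + R\<^sup>2 / (2 * e)" using e by (simp add: field_simps)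
    finally show ?thesis using y z(2)[OF y(1)] by linarith
  qed
  then show thesis by (rule that)
qed

text \<open>Moving the argument and the competitor by the same vector keeps the penalty constant, so
  the test quadratic at x can be translated to the maximiser y with slope and matrix
  unchanged.\<close>

lemma quad_above_sup_conv:
  assumes touch: "quad_above UNIV (sup_conv A h e) x p X"
    and y: "y \<in> A" "sup_conv A h e x = h y - (norm (x - y))\<^sup>2 / (2 * e)"
    and ub: "\<And>x z. z \<in> A \<Longrightarrow> h z - (norm (x - z))\<^sup>2 / (2 * e) \<le> sup_conv A h e x"
  shows "quad_above A h y p X"
proof -
  let ?f = "sup_conv A h e"
  obtain d where d: "d > 0"
    "\<forall>z. z \<noteq> x \<and> dist z x < d \<longrightarrow> ?f z \<le> ?f x + p \<bullet> (z - x) + ((z - x) \<bullet> (X *v (z - x))) / 2"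
    using touch unfolding quad_above_def eventually_at by auto
  have "h z \<le> h y + p \<bullet> (z - y) + ((z - y) \<bullet> (X *v (z - y))) / 2"
    if z: "z \<in> A" "z \<noteq> y" "dist z y < d" for z
  proof -
    have eqs: "x + (z - y) - x = z - y" "x + (z - y) - z = x - y" by simp_all
    have "x + (z - y) \<noteq> x" "dist (x + (z - y)) x < d" using z by (auto simp: dist_norm)
    then have "?f (x + (z - y)) \<le> ?f x + p \<bullet> (z - y) + ((z - y) \<bullet> (X *v (z - y))) / 2"
      using d(2)[rule_format, of "x + (z - y)"] unfolding eqs by blast
    moreover have "h z - (norm (x - y))\<^sup>2 / (2 * e) \<le> ?f (x + (z - y))"
      using ub[OF z(1), of "x + (z - y)"] unfolding eqs .
    ultimately show ?thesis using y(2) by linarith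
  qed
  then show ?thesis unfolding quad_above_def eventually_at using d(1) by blast
qed

section \<open>Quadratic upper bounds under shifts, added squares and change of domain\<close>

lemma quad_above_shift:
  assumes "quad_above UNIV (\<lambda>y. f (y + a)) x p X"
  shows "quad_above UNIV f (x + a) p X"
proof -
  obtain d where d: "d > 0"
    "\<forall>y. y \<noteq> x \<and> dist y x < d \<longrightarrow> f (y + a) \<le> f (x + a) + p \<bullet> (y - x) + ((y - x) \<bullet> (X *v (y - x))) / 2"
    using assms unfolding quad_above_def eventually_at by auto
  have "f y \<le> f (x + a) + p \<bullet> (y - (x + a)) + ((y - (x + a)) \<bullet> (X *v (y - (x + a)))) / 2"
    if "y \<noteq> x + a" "dist y (x + a) < d" for y
  proof -
    have "y - a \<noteq> x" "dist (y - a) x < d" using that by (auto simp: dist_norm algebra_simps)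
    moreover have eq: "y - a - x = y - (x + a)" by (simp add: algebra_simps)
    ultimately have "f (y - a + a) \<le> f (x + a) + p \<bullet> (y - (x + a)) + ((y - (x + a)) \<bullet> (X *v (y - (x + a)))) / 2"
      using d(2)[rule_format, of "y - a"] unfolding eq by blast
    then show ?thesis by simp
  qed
  then show ?thesis unfolding quad_above_def eventually_at using d(1) by blast
qed

lemma quad_above_add_square:
  assumes "quad_above S (\<lambda>y. f y - d * (norm (y - z))\<^sup>2) x p X"
  shows "quad_above S f x (p + (2 * d) *\<^sub>R (x - z)) (X + (2 * d) *\<^sub>R mat 1)"
  unfolding quad_above_def
proof (rule eventually_mono[OF assms[unfolded quad_above_def]])
  fix y assume le: "f y - d * (norm (y - z))\<^sup>2
    \<le> f x - d * (norm (x - z))\<^sup>2 + p \<bullet> (y - x) + (y - x) \<bullet> (X *v (y - x)) / 2"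
  have "(norm (y - z))\<^sup>2 = (norm (x - z))\<^sup>2 + 2 * ((x - z) \<bullet> (y - x)) + (y - x) \<bullet> (y - x)"
    unfolding power2_norm_eq_inner by (simp add: inner_simps inner_commute)
  then have "d * (norm (y - z))\<^sup>2 = d * (norm (x - z))\<^sup>2 + 2 * d * ((x - z) \<bullet> (y - x)) + d * ((y - x) \<bullet> (y - x))"
    by (simp only: distrib_left mult.assoc mult.left_commute)
  moreover have "(y - x) \<bullet> ((X + (2 * d) *\<^sub>R mat 1) *v (y - x)) = (y - x) \<bullet> (X *v (y - x)) + 2 * d * ((y - x) \<bullet> (y - x))"
    by (simp add: matrix_vector_mult_add_rdistrib scaled_id_mult_vec inner_add_right)
  ultimately show "f y \<le> f x + (p + (2 * d) *\<^sub>R (x - z)) \<bullet> (y - x) + (y - x) \<bullet> ((X + (2 * d) *\<^sub>R mat 1) *v (y - x)) / 2"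
    using le by (simp add: inner_add_left add_divide_distrib)
qed

lemma quad_above_mono_set:
  assumes "quad_above A f x p X" "open U" "x \<in> U" "S \<inter> U \<subseteq> A"
  shows "quad_above S f x p X"
proof -
  have "\<forall>\<^sub>F y in at x within S. y \<in> A"
    unfolding eventually_at_topological using assms(2-4) by (intro exI[of _ U]) blast
  moreover obtain d where "d > 0" "\<forall>y\<in>A. y \<noteq> x \<and> dist y x < d \<longrightarrow> f y \<le> f x + p \<bullet> (y - x) + (y - x) \<bullet> (X *v (y - x)) / 2"
    using assms(1) unfolding quad_above_def eventually_at by auto
  then have "\<forall>\<^sub>F y in at x within S. y \<in> A \<longrightarrow> f y \<le> f x + p \<bullet> (y - x) + (y - x) \<bullet> (X *v (y - x)) / 2"
    unfolding eventually_at by blast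
  ultimately show ?thesis unfolding quad_above_def by eventually_elim blast
qed

section \<open>The comparison principle\<close>

lemma minus_matrix_mult_vec: "(- A) *v v = - (A *v (v :: real ^ 'n))"
  by (simp add: matrix_vector_mult_def vec_eq_iff sum_negf)

lemma dist_triple_le: "dist (a, b, c) (a', b', c') \<le> dist a a' + dist b b' + dist c c'"
proof -
  have pair: "dist (x, y) (x', y') \<le> dist x x' + dist y y'" for x x' :: "'x::metric_space" and y y' :: "'y::metric_space"
    by (simp add: dist_Pair_Pair sqrt_sum_squares_le_sum)
  show ?thesis using pair[of a "(b, c)" a' "(b', c')"] pair[of b c b' c'] by linarith
qed

text \<open>Soner's shift \<open>u (y + s m(z))\<close> along the interior cone makes the subsolution live on a full
  neighbourhood of the maximum point. The two test functions have ordered Hessians and almost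
  equal slopes, so the uniform continuity of \<open>H\<close> compares the two inequalities.\<close>

lemma comparison_principle:
  fixes \<theta> :: "(real ^ 'n) set" and H :: "real ^ 'n \<Rightarrow> real ^ 'n \<Rightarrow> real ^ 'n ^ 'n \<Rightarrow> real"
  assumes comp: "compact (closure \<theta>)" and dom: "domain_condition \<theta>"
    and uc: "uniformly_continuous_on (UNIV \<times> UNIV \<times> sym_matrices) (\<lambda>(x, p, A). H x p A)"
    and ell: "\<And>x p A B. A \<in> sym_matrices \<Longrightarrow> B \<in> sym_matrices \<Longrightarrow> B \<preceq> A \<Longrightarrow> H x p A \<le> H x p B"
    and mu: "\<mu> > 0" and L: "L > 0"
    and lu: "\<And>x y. x \<in> closure \<theta> \<Longrightarrow> y \<in> closure \<theta> \<Longrightarrow> \<bar>u x - u y\<bar> \<le> L * norm (x - y)"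
    and lv: "\<And>x y. x \<in> closure \<theta> \<Longrightarrow> y \<in> closure \<theta> \<Longrightarrow> \<bar>v x - v y\<bar> \<le> L * norm (x - y)"
    and sub: "\<And>x p X. x \<in> \<theta> \<Longrightarrow> X \<in> sym_matrices \<Longrightarrow> quad_above \<theta> u x p X \<Longrightarrow> \<mu> * u x + H x p X \<le> 0"
    and super: "\<And>x p X. x \<in> closure \<theta> \<Longrightarrow> X \<in> sym_matrices \<Longrightarrow>
      quad_above (closure \<theta>) (\<lambda>y. - v y) x (- p) (- X) \<Longrightarrow> \<mu> * v x + H x p X \<ge> 0"
    and x0: "x0 \<in> closure \<theta>"
  shows "u x0 \<le> v x0"
proof (rule ccontr)
  assume contr: "\<not> u x0 \<le> v x0"
  let ?S = "closure \<theta>"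
  have lip_cont: "continuous_on ?S w" if "\<And>x y. x \<in> ?S \<Longrightarrow> y \<in> ?S \<Longrightarrow> \<bar>w x - w y\<bar> \<le> L * norm (x - y)" for w
  proof -
    have "L-lipschitz_on ?S w" using that L by (intro lipschitz_onI) (auto simp: dist_real_def dist_norm)
    then show ?thesis by (rule lipschitz_on_continuous_on)
  qed
  have cu: "continuous_on ?S u" and cv: "continuous_on ?S v" using lip_cont lu lv by blast+
  have Sne: "?S \<noteq> {}" using x0 by (metis empty_iff)
  obtain z where z: "z \<in> ?S" "\<And>y. y \<in> ?S \<Longrightarrow> u y - v y \<le> u z - v z"
    using continuous_attains_sup[OF comp Sne continuous_on_diff[OF cu cv]] by blast
  define \<sigma> where "\<sigma> = u z - v z"
  have sig: "\<sigma> > 0" using z(2)[OF x0] contr by (simp add: \<sigma>_def)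
  obtain um where um: "um \<in> ?S" "\<And>y. y \<in> ?S \<Longrightarrow> u y \<le> u um" using continuous_attains_sup[OF comp Sne cu] by blast
  obtain vm where vm: "vm \<in> ?S" "\<And>y. y \<in> ?S \<Longrightarrow> v vm \<le> v y" using continuous_attains_inf[OF comp Sne cv] by blast
  define Bd where "Bd = \<bar>u um - v vm\<bar>"
  have Bd: "Bd \<ge> 0" "\<And>a b. a \<in> ?S \<Longrightarrow> b \<in> ?S \<Longrightarrow> u a - v b \<le> Bd"
    using um(2) vm(2) by (auto simp: Bd_def) (smt (verit))
  obtain m r where m: "uniformly_continuous_on ?S m" "\<And>x. x \<in> ?S \<Longrightarrow> norm (m x) \<le> 1" "r > 0"
    "\<And>x s. x \<in> ?S \<Longrightarrow> s \<in> {0<..r} \<Longrightarrow> ball (x + s *\<^sub>R m x) (r * s) \<subseteq> \<theta>"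
    using dom unfolding domain_condition_def by metis
  have "\<mu> * \<sigma> / 2 > 0" using mu sig by simp
  from uniformly_continuous_onE[OF uc this] obtain \<gamma> where gam: "\<gamma> > 0"
    and gam': "\<And>t t'. t \<in> UNIV \<times> UNIV \<times> sym_matrices \<Longrightarrow> t' \<in> UNIV \<times> UNIV \<times> sym_matrices \<Longrightarrow> dist t' t < \<gamma>
       \<Longrightarrow> dist (case t' of (x, p, A) \<Rightarrow> H x p A) (case t of (x, p, A) \<Rightarrow> H x p A) < \<mu> * \<sigma> / 2"
    by metis
  have Huc: "\<bar>H x p A - H x' p' A'\<bar> < \<mu> * \<sigma> / 2"
    if "A \<in> sym_matrices" "A' \<in> sym_matrices" "dist x x' + dist p p' + dist A A' < \<gamma>" for x p A x' p' A'
    using gam'[of "(x', p', A')" "(x, p, A)"] that dist_triple_le[of x p A x' p' A'] by (simp add: dist_real_def)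
  have "r / 2 > 0" using m(3) by simp
  from uniformly_continuous_onE[OF m(1) this] obtain d0 where d0: "d0 > 0"
    "\<And>y y'. y \<in> ?S \<Longrightarrow> y' \<in> ?S \<Longrightarrow> dist y' y < d0 \<Longrightarrow> dist (m y') (m y) < r / 2" by metis
  \<comment> \<open>Within distance \<eta>0 of z the field m varies by less than r / 2, so the
    single vector \<open>m z\<close> can be the shift direction; \<eta>0 \<le> 1 bounds the gradient
    of the penalty.\<close>
  define \<eta>0 where "\<eta>0 = min 1 (d0 / 2)"
  have eta0: "\<eta>0 > 0" "\<eta>0 \<le> 1" "\<eta>0 < d0" using d0(1) by (auto simp: \<eta>0_def)
  define n0 where "n0 = norm (mat 1 :: real ^ 'n ^ 'n)"
  have n0: "n0 \<ge> 0" by (simp add: n0_def)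
  \<comment> \<open>The penalty perturbs the slope by at most 2 \<delta> and the matrix by 2
    \<delta> times the identity, together \<gamma> / 8 of the continuity budget \<gamma>.\<close>
  define \<delta> where "\<delta> = \<gamma> / (16 * (1 + n0))"
  have delta: "\<delta> > 0" "2 * \<delta> * (1 + n0) = \<gamma> / 8" using gam n0 by (auto simp: \<delta>_def field_simps)
  \<comment> \<open>The penalty at distance \<eta>0 from z. The errors of shift, doubling and jets
    are kept below it, so that the near maximum cannot reach the boundary of this ball.\<close>
  define q0 where "q0 = \<delta> * \<eta>0\<^sup>2"
  have q0: "q0 > 0" using delta eta0 by (simp add: q0_def)
  define s where "s = min r (min (\<gamma> / 8) (min (\<sigma> / (8 * L)) (q0 / (8 * L))))"
  have s: "s > 0" "s \<le> r" "s \<le> \<gamma> / 8" using gam sig L q0 m(3) by (auto simp: s_def)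
  have "s \<le> \<sigma> / (8 * L)" "s \<le> q0 / (8 * L)" by (auto simp: s_def)
  then have sL: "8 * (L * s) \<le> \<sigma>" "8 * (L * s) \<le> q0" using L by (simp_all add: field_simps)
  \<comment> \<open>A displacement of norm \<rho> and the variation of m cost at most r s / 4 + r s
    / 2, less than the radius r s of the interior ball.\<close>
  define \<rho> where "\<rho> = r * s / 4"
  have rho: "\<rho> > 0" using s m(3) by (simp add: \<rho>_def)
  define \<tau> where "\<tau> = min \<rho> (min (\<gamma> / 8) (q0 / (8 * L)))"
  have tau: "\<tau> > 0" "\<tau> \<le> \<rho>" "\<tau> \<le> \<gamma> / 8" using rho gam q0 L by (auto simp: \<tau>_def)
  have "\<tau> \<le> q0 / (8 * L)" by (auto simp: \<tau>_def)
  then have tL: "8 * (L * \<tau>) \<le> q0" using L by (simp add: field_simps)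
  \<comment> \<open>The sup-convolution penalties at x1 and x2 will be at most Bd, so the maximisers
    lie within \<open>sqrt (2 * \<epsilon> * Bd)\<close> of these points, which is less than \<tau>
    / 4.\<close>
  define \<epsilon> where "\<epsilon> = \<tau>\<^sup>2 / (64 * (Bd + 1))"
  have eps: "\<epsilon> > 0" using tau Bd(1) by (simp add: \<epsilon>_def add_nonneg_pos)
  have epsB: "2 * \<epsilon> * Bd < (\<tau> / 4)\<^sup>2"
  proof -
    have "64 * (\<epsilon> * (Bd + 1)) = \<tau>\<^sup>2" using Bd(1) by (simp add: \<epsilon>_def field_simps)
    then have "64 * (\<epsilon> * Bd) \<le> \<tau>\<^sup>2" using eps by (simp add: algebra_simps)
    moreover have "\<tau>\<^sup>2 > 0" using tau by simp
    moreover have "2 * \<epsilon> * Bd = 2 * (\<epsilon> * Bd)" "(\<tau> / 4)\<^sup>2 = \<tau>\<^sup>2 / 16" by (simp_all add: power_divide)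
    moreover have "\<epsilon> * Bd \<ge> 0" using eps Bd(1) by simp
    ultimately show ?thesis by linarith
  qed
  define \<eta> where "\<eta> = min (\<tau> / 4) (min (\<gamma> / (8 * (1 + n0))) (min (\<sigma> / 8) (q0 / 8)))"
  have eta: "\<eta> > 0" "\<eta> \<le> \<tau> / 4" "\<eta> \<le> \<sigma> / 8" "\<eta> \<le> q0 / 8"
    using tau gam n0 sig q0 unfolding \<eta>_def min_le_iff_disj by (simp_all add: add_pos_nonneg)
  have "\<eta> \<le> \<gamma> / (8 * (1 + n0))" by (auto simp: \<eta>_def)
  then have etan: "\<eta> * (1 + n0) \<le> \<gamma> / 8" using n0 by (simp add: field_simps)
  define S' where "S' = ?S \<inter> cball z \<eta>0"
  \<comment> \<open>A \<rho>-thickening of S': the maximiser y1 will be closer than \<rho> to y2 in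
    S', hence interior to K1, so the shifted subsolution is tested on a full neighbourhood. The
    supersolution keeps S', where tests at boundary points of \<theta> are allowed.\<close>
  define K1 where "K1 = {y + w | y w. y \<in> S' \<and> w \<in> cball 0 \<rho>}"
  have S'c: "compact S'" unfolding S'_def using comp by (simp add: compact_Int)
  have K1c: "compact K1" unfolding K1_def by (rule compact_sums[OF S'c compact_cball])
  have zS': "z \<in> S'" using z(1) eta0 by (simp add: S'_def)
  then have zK1: "z \<in> K1" using rho unfolding K1_def by force
  have K1\<theta>: "y + s *\<^sub>R m z \<in> \<theta>" if yK: "y \<in> K1" for y
  proof -
    obtain y' w where y': "y = y' + w" "y' \<in> ?S" "dist z y' \<le> \<eta>0" "norm w \<le> \<rho>"
      using yK by (auto simp: K1_def S'_def)
    have "norm (m z - m y') < r / 2" using d0(2)[OF y'(2) z(1)] y'(3) eta0 by (simp add: dist_norm)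
    then have "s * norm (m z - m y') < s * (r / 2)" using s by simp
    moreover have "norm (w + s *\<^sub>R (m z - m y')) \<le> norm w + s * norm (m z - m y')"
      using norm_triangle_ineq[of w "s *\<^sub>R (m z - m y')"] s by simp
    moreover have "dist (y' + s *\<^sub>R m y') (y + s *\<^sub>R m z) = norm (w + s *\<^sub>R (m z - m y'))"
    proof -
      have "y + s *\<^sub>R m z - (y' + s *\<^sub>R m y') = w + s *\<^sub>R (m z - m y')"
        by (simp add: y'(1) scaleR_diff_right)
      then show ?thesis by (metis dist_commute dist_norm)
    qed
    ultimately have "dist (y' + s *\<^sub>R m y') (y + s *\<^sub>R m z) < \<rho> + s * (r / 2)"
      using y'(4) by linarith
    also have "\<dots> < r * s" using s m(3) by (simp add: \<rho>_def)
    finally show ?thesis using m(4)[OF y'(2), of s] s by auto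
  qed
  have \<theta>S: "y \<in> ?S" if "y \<in> \<theta>" for y using that closure_subset by blast
  define h1 where "h1 y = u (y + s *\<^sub>R m z)" for y
  define h2 where "h2 y = - v y - \<delta> * (norm (y - z))\<^sup>2" for y
  have ch1: "continuous_on K1 h1" unfolding h1_def
    by (intro continuous_on_compose2[OF cu] continuous_intros) (use K1\<theta> \<theta>S in auto)
  have ch2: "continuous_on S' h2" unfolding h2_def
    by (intro continuous_intros continuous_on_subset[OF cv]) (auto simp: S'_def)
  have K1ne: "K1 \<noteq> {}" and S'ne: "S' \<noteq> {}" using zK1 zS' by blast+
  define f where "f = sup_conv K1 h1 \<epsilon>"
  define g where "g = sup_conv S' h2 \<epsilon>"
  obtain B1 where B1: "\<And>x. f x \<le> B1 - 1 / (4 * \<epsilon>) * (norm x)\<^sup>2"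
    by (rule sup_conv_growth[OF K1c K1ne ch1 eps, folded f_def]) (rule that)
  obtain B2 where B2: "\<And>x. g x \<le> B2 - 1 / (4 * \<epsilon>) * (norm x)\<^sup>2"
    by (rule sup_conv_growth[OF S'c S'ne ch2 eps, folded g_def]) (rule that)
  have growth: "f x + g x \<le> (B1 + B2) - 1 / (2 * \<epsilon>) * (norm x)\<^sup>2" for x
    using B1[of x] B2[of x] eps by (simp add: field_simps)
  obtain x1 x2 p q X Y where J: "X \<in> sym_matrices" "Y \<in> sym_matrices" "dist x1 x2 < \<eta>" "norm (p + q) < \<eta>"
    "\<And>v. v \<bullet> ((X + Y) *v v) \<le> \<eta> * (norm v)\<^sup>2"
    "quad_above UNIV f x1 p X" "quad_above UNIV g x2 q Y" "\<And>x. f x + g x - \<eta> \<le> f x1 + g x2"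
  proof (rule semiconvex_sum_jets)
    show "continuous_on UNIV f" "continuous_on UNIV g" unfolding f_def g_def
      by (intro sup_conv_continuous K1c K1ne ch1 S'c S'ne ch2 eps)+
    show "semiconvex (1 / (2 * \<epsilon>)) f" "semiconvex (1 / (2 * \<epsilon>)) g" unfolding f_def g_def
      by (intro sup_conv_semiconvex K1c K1ne ch1 S'c S'ne ch2 eps)+
    show "1 / (2 * \<epsilon>) \<ge> 0" "1 / (2 * \<epsilon>) > 0" using eps by simp_all
  qed (rule growth, rule eta(1), rule that)
  obtain y1 where y1: "y1 \<in> K1" "f x1 = h1 y1 - (norm (x1 - y1))\<^sup>2 / (2 * \<epsilon>)"
    by (rule sup_conv_attained[where e = \<epsilon>, OF K1c K1ne ch1, folded f_def]) (rule that)
  obtain y2 where y2: "y2 \<in> S'" "g x2 = h2 y2 - (norm (x2 - y2))\<^sup>2 / (2 * \<epsilon>)"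
    by (rule sup_conv_attained[where e = \<epsilon>, OF S'c S'ne ch2, folded g_def]) (rule that)
  have ubf: "h1 z - (norm (x - z))\<^sup>2 / (2 * \<epsilon>) \<le> sup_conv K1 h1 \<epsilon> x" if "z \<in> K1" for x z
    by (rule sup_conv_attained[OF K1c K1ne ch1, of \<epsilon> x]) (use that in blast)
  have ubg: "h2 z - (norm (x - z))\<^sup>2 / (2 * \<epsilon>) \<le> sup_conv S' h2 \<epsilon> x" if "z \<in> S'" for x z
    by (rule sup_conv_attained[OF S'c S'ne ch2, of \<epsilon> x]) (use that in blast)
  define y1' where "y1' = y1 + s *\<^sub>R m z"
  have y1\<theta>: "y1' \<in> \<theta>" unfolding y1'_def by (rule K1\<theta>[OF y1(1)])
  have y1S: "y1' \<in> ?S" by (rule \<theta>S[OF y1\<theta>])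
  have y2S: "y2 \<in> ?S" using y2(1) by (simp add: S'_def)
  have base: "f z + g z \<ge> \<sigma> - L * s"
  proof -
    have "f z \<ge> h1 z" "g z \<ge> h2 z" using ubf[OF zK1, of z] ubg[OF zS', of z] by (simp_all add: f_def g_def)
    moreover have "h1 z \<ge> u z - L * s"
    proof -
      have "\<bar>u (z + s *\<^sub>R m z) - u z\<bar> \<le> L * norm (z + s *\<^sub>R m z - z)"
        by (rule lu[OF \<theta>S[OF K1\<theta>[OF zK1]] z(1)])
      also have "\<dots> \<le> L * s" using m(2)[OF z(1)] s L by (intro mult_left_mono) (auto simp: mult_left_le)
      finally show ?thesis by (simp add: h1_def)
    qed
    moreover have "h2 z = - v z" by (simp add: h2_def)
    ultimately show ?thesis by (simp add: \<sigma>_def)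
  qed
  define Q1 where "Q1 = (norm (x1 - y1))\<^sup>2 / (2 * \<epsilon>)"
  define Q2 where "Q2 = (norm (x2 - y2))\<^sup>2 / (2 * \<epsilon>)"
  have Qpos: "Q1 \<ge> 0" "Q2 \<ge> 0" using eps by (simp_all add: Q1_def Q2_def)
  have dpos: "\<delta> * (norm (y2 - z))\<^sup>2 \<ge> 0" using delta by simp
  have main: "u y1' - v y2 - \<delta> * (norm (y2 - z))\<^sup>2 - Q1 - Q2 \<ge> \<sigma> - L * s - \<eta>"
    using J(8)[of z] base y1(2) y2(2) by (simp add: h1_def h2_def y1'_def Q1_def Q2_def)
  have "u y1' - v y2 \<le> Bd" by (rule Bd(2)[OF y1S y2S])
  then have "Q1 \<le> Bd" "Q2 \<le> Bd" using main Qpos dpos sL eta sig by linarith+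
  then have "(norm (x1 - y1))\<^sup>2 \<le> 2 * \<epsilon> * Bd" "(norm (x2 - y2))\<^sup>2 \<le> 2 * \<epsilon> * Bd"
    using eps by (simp_all add: Q1_def Q2_def field_simps)
  then have lt: "(norm (x1 - y1))\<^sup>2 < (\<tau> / 4)\<^sup>2" "(norm (x2 - y2))\<^sup>2 < (\<tau> / 4)\<^sup>2" using epsB by linarith+
  have "\<tau> / 4 \<ge> 0" using tau by simp
  then have xy: "norm (x1 - y1) < \<tau> / 4" "norm (x2 - y2) < \<tau> / 4"
    using power2_less_imp_less[OF lt(1)] power2_less_imp_less[OF lt(2)] by blast+
  have y12: "norm (y1 - y2) < \<tau>"
  proof -
    have "norm (y1 - y2) \<le> norm (y1 - x1) + norm (x1 - x2) + norm (x2 - y2)"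
      using norm_triangle_ineq[of "y1 - x1" "x1 - x2"] norm_triangle_ineq[of "y1 - x2" "x2 - y2"] by simp
    then show ?thesis using xy J(3) eta(2) tau by (simp add: dist_norm norm_minus_commute)
  qed
  have y1'2: "norm (y1' - y2) \<le> \<tau> + s"
  proof -
    have "norm (s *\<^sub>R m z) \<le> s" using m(2)[OF z(1)] s by (simp add: mult_left_le)
    moreover have eq: "y1' - y2 = (y1 - y2) + s *\<^sub>R m z" by (simp add: y1'_def)
    ultimately show ?thesis unfolding eq using y12 norm_triangle_ineq[of "y1 - y2" "s *\<^sub>R m z"] by linarith
  qed
  \<comment> \<open>As z maximises u - v at common points, the penalty can only be paid for by the
    shift, the distance between y1' and y2 and the jet error, which stay below q0.\<close>
  have y2z: "norm (y2 - z) < \<eta>0"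
  proof -
    have "u y1' \<le> u y2 + L * norm (y1' - y2)" using lu[OF y1S y2S] by linarith
    also have "L * norm (y1' - y2) \<le> L * (\<tau> + s)" using y1'2 L by simp
    also have "L * (\<tau> + s) = L * \<tau> + L * s" by (simp add: distrib_left)
    finally have "\<delta> * (norm (y2 - z))\<^sup>2 \<le> L * \<tau> + 2 * (L * s) + \<eta>"
      using main Qpos z(2)[OF y2S] by (simp add: \<sigma>_def)
    also have "\<dots> < q0" using sL tL eta q0 by linarith
    finally have "(norm (y2 - z))\<^sup>2 < \<eta>0\<^sup>2" using delta by (simp add: q0_def)
    then show ?thesis by (rule power2_less_imp_less) (use eta0 in simp)
  qed
  have subtest: "quad_above \<theta> u y1' p X"
  proof -
    have "quad_above K1 h1 y1 p X"
      by (rule quad_above_sup_conv[OF J(6)[unfolded f_def] y1(1) y1(2)[unfolded f_def] ubf])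
    then have "quad_above UNIV h1 y1 p X"
    proof (rule quad_above_mono_set)
      show "y1 \<in> ball y2 \<rho>" using y12 tau by (simp add: dist_norm norm_minus_commute)
      show "UNIV \<inter> ball y2 \<rho> \<subseteq> K1"
      proof
        fix y assume "y \<in> UNIV \<inter> ball y2 \<rho>"
        then have "y - y2 \<in> cball 0 \<rho>" by (simp add: dist_norm norm_minus_commute)
        then show "y \<in> K1" unfolding K1_def using y2(1) by (intro CollectI exI[of _ y2] exI[of _ "y - y2"]) simp
      qed
    qed simp
    then have "quad_above UNIV u y1' p X"
      unfolding h1_def y1'_def by (rule quad_above_shift)
    then show ?thesis by (rule quad_above_mono_set[where U = UNIV]) auto
  qed
  define P where "P = q + (2 * \<delta>) *\<^sub>R (y2 - z)"
  define Z where "Z = Y + (2 * \<delta>) *\<^sub>R mat 1"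
  have Zs: "Z \<in> sym_matrices" unfolding Z_def by (intro sym_matrices_add J sym_matrices_scaled_id)
  have "quad_above S' h2 y2 q Y"
    by (rule quad_above_sup_conv[OF J(7)[unfolded g_def] y2(1) y2(2)[unfolded g_def] ubg])
  then have "quad_above S' (\<lambda>y. - v y) y2 P Z"
    unfolding h2_def P_def Z_def by (rule quad_above_add_square)
  then have "quad_above ?S (\<lambda>y. - v y) y2 P Z"
    by (rule quad_above_mono_set[where U = "ball z \<eta>0"])
      (use y2z in \<open>auto simp: S'_def dist_norm norm_minus_commute\<close>)
  then have sup_ineq: "\<mu> * v y2 + H y2 (- P) (- Z) \<ge> 0"
    by (intro super[OF y2S sym_matrices_minus[OF Zs]]) simp
  \<comment> \<open>X may lie far below -Z, so the two cannot be compared by continuity. Ellipticity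
    first replaces X by W, which is -Y plus a small multiple of the identity, and W is close to
    -Z.\<close>
  define W where "W = - Z + (2 * \<delta> + \<eta>) *\<^sub>R mat 1"
  have Ws: "W \<in> sym_matrices" unfolding W_def by (intro sym_matrices_add sym_matrices_minus Zs sym_matrices_scaled_id)
  have XW: "X \<preceq> W" unfolding loewner_le_def
  proof
    fix v
    have "W = - Y + \<eta> *\<^sub>R mat 1" by (simp add: W_def Z_def scaleR_left_distrib)
    then have "v \<bullet> (W *v v) = - (v \<bullet> (Y *v v)) + \<eta> * (v \<bullet> v)"
      by (simp only: matrix_vector_mult_add_rdistrib scaled_id_mult_vec minus_matrix_mult_vec
          inner_add_right inner_scaleR_right inner_minus_right)
    moreover have "v \<bullet> (X *v v) + v \<bullet> (Y *v v) \<le> \<eta> * (v \<bullet> v)"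
      using J(5)[of v] by (simp only: matrix_vector_mult_add_rdistrib inner_add_right power2_norm_eq_inner)
    ultimately show "v \<bullet> (X *v v) \<le> v \<bullet> (W *v v)" by linarith
  qed
  have "\<mu> * u y1' + H y1' p W \<le> 0"
    using sub[OF y1\<theta> J(1) subtest] ell[OF Ws J(1) XW, of y1' p] by linarith
  moreover have "\<bar>H y1' p W - H y2 (- P) (- Z)\<bar> < \<mu> * \<sigma> / 2"
  proof (rule Huc[OF Ws sym_matrices_minus[OF Zs]])
    have "dist y1' y2 \<le> \<gamma> / 4" using y1'2 tau s by (simp add: dist_norm)
    moreover have "dist p (- P) \<le> \<eta> + 2 * \<delta>"
    proof -
      have "norm ((2 * \<delta>) *\<^sub>R (y2 - z)) \<le> 2 * \<delta> * 1"
        unfolding norm_scaleR using delta y2z eta0 by (simp add: mult_left_le)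
      moreover have "p - - P = (p + q) + (2 * \<delta>) *\<^sub>R (y2 - z)" by (simp add: P_def)
      ultimately show ?thesis using J(4) norm_triangle_ineq[of "p + q" "(2 * \<delta>) *\<^sub>R (y2 - z)"]
        unfolding dist_norm by (simp only:)
    qed
    moreover have "dist W (- Z) = (2 * \<delta> + \<eta>) * n0"
    proof -
      have "W - - Z = (2 * \<delta> + \<eta>) *\<^sub>R mat 1" by (simp add: W_def)
      then show ?thesis unfolding dist_norm using delta eta by (simp add: n0_def)
    qed
    moreover have "(\<eta> + 2 * \<delta>) + (2 * \<delta> + \<eta>) * n0 \<le> \<gamma> / 4"
      using delta(2) etan by (simp add: algebra_simps)
    ultimately show "dist y1' y2 + dist p (- P) + dist W (- Z) < \<gamma>" using gam by linarith
  qed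
  ultimately have "\<mu> * u y1' - \<mu> * v y2 < \<mu> * \<sigma> / 2" using sup_ineq by linarith
  then have "\<mu> * (u y1' - v y2) < \<mu> * (\<sigma> / 2)" by (simp add: right_diff_distrib)
  then have "u y1' - v y2 < \<sigma> / 2" using mu by simp
  then show False using main Qpos dpos sL eta sig by linarith
qed

section \<open>Monotonicity and uniform convergence\<close>

lemma quadratic_C2:
  fixes X :: "real ^ 'n ^ 'n" and p x :: "real ^ 'n" and k :: real
  assumes X: "X \<in> sym_matrices"
  defines "\<phi> \<equiv> \<lambda>y. k + p \<bullet> (y - x) + ((y - x) \<bullet> (X *v (y - x))) / 2"
  shows "C2 \<phi>" "gradient \<phi> x = p" "hessian \<phi> x = X"
proof -
  have d1: "(\<phi> has_derivative (\<lambda>h. (p + X *v (y - x)) \<bullet> h)) (at y)" for y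
  proof -
    have lin: "((\<lambda>y. X *v (y - x)) has_derivative (\<lambda>h. X *v h)) (at y)"
      by (rule has_derivative_compose[OF _ bounded_linear_imp_has_derivative[OF matrix_vector_mul_bounded_linear], of "\<lambda>y. y - x"])
        (auto intro!: derivative_eq_intros)
    have "(\<phi> has_derivative (\<lambda>h. p \<bullet> h + ((y - x) \<bullet> (X *v h) + h \<bullet> (X *v (y - x))) / 2)) (at y)"
      unfolding \<phi>_def by (auto intro!: derivative_eq_intros lin)
    moreover have "(\<lambda>h. p \<bullet> h + ((y - x) \<bullet> (X *v h) + h \<bullet> (X *v (y - x))) / 2) = (\<lambda>h. (p + X *v (y - x)) \<bullet> h)"
    proof
      show "p \<bullet> h + ((y - x) \<bullet> (X *v h) + h \<bullet> (X *v (y - x))) / 2 = (p + X *v (y - x)) \<bullet> h" for h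
        using sym_matrix_inner[OF X, of "y - x" h] inner_commute[of h "X *v (y - x)"]
        by (simp only: inner_add_left) simp
    qed
    ultimately show ?thesis by simp
  qed
  have grad: "gradient \<phi> = (\<lambda>y. p + X *v (y - x))"
    unfolding gradient_def using frechet_derivative_at[OF d1]
    by (auto simp: fun_eq_iff vec_eq_iff inner_axis simp flip: frechet_derivative_at[OF d1])
  have d2: "(gradient \<phi> has_derivative (\<lambda>h. X *v h)) (at y)" for y
  proof -
    have "((\<lambda>y. X *v (y - x)) has_derivative (\<lambda>h. X *v h)) (at y)"
      by (rule has_derivative_compose[OF _ bounded_linear_imp_has_derivative[OF matrix_vector_mul_bounded_linear], of "\<lambda>y. y - x"])
        (auto intro!: derivative_eq_intros)
    then show ?thesis unfolding grad by (auto intro!: derivative_eq_intros)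
  qed
  have hess: "hessian \<phi> = (\<lambda>y. X)"
    by (rule ext) (simp only: hessian_def frechet_derivative_at[OF d2, symmetric] matrix_of_matrix_vector_mul)
  show "C2 \<phi>" unfolding C2_def hess
    by (intro conjI allI continuous_on_const differentiableI[OF d1] differentiableI[OF d2])
  show "gradient \<phi> x = p" by (simp add: grad)
  show "hessian \<phi> x = X" by (simp add: hess)
qed

text \<open>The filter of nearby points includes x itself, so it is nontrivial and the envelopes
  agree with a continuous V even at isolated points. Lipschitz solutions can then be tested
  directly.\<close>

lemma envelope_eq:
  fixes V :: "real ^ 'n \<Rightarrow> real"
  assumes cont: "continuous_on S V" and x: "x \<in> S"
  shows "upper_envelope S V x = V x" "lower_envelope S V x = V x"
proof -
  let ?F = "inf (nhds x) (principal S)"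
  have nt: "?F \<noteq> bot"
    unfolding trivial_limit_def eventually_inf_principal using x eventually_nhds_x_imp_x by fastforce
  have "(V \<longlongrightarrow> V x) ?F"
  proof (rule topological_tendstoI)
    fix U assume "open U" "V x \<in> U"
    then obtain A where "open A" "x \<in> A" "\<forall>y\<in>S. y \<in> A \<longrightarrow> V y \<in> U"
      using cont x unfolding continuous_on_topological by meson
    then show "\<forall>\<^sub>F y in ?F. V y \<in> U"
      unfolding eventually_inf_principal eventually_nhds by blast
  qed
  then have "((\<lambda>y. ereal (V y)) \<longlongrightarrow> ereal (V x)) ?F" by (simp add: lim_ereal)
  from lim_imp_Limsup[OF nt this] lim_imp_Liminf[OF nt this]
  show "upper_envelope S V x = V x" "lower_envelope S V x = V x"
    by (simp_all add: upper_envelope_def lower_envelope_def)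
qed

lemma eventually_at_within_mem: "\<forall>\<^sub>F y in at x within S. y \<in> S"
  by (simp add: eventually_at_filter)

lemma viscosity_subsolution_quadratic:
  fixes V :: "real ^ 'n \<Rightarrow> real"
  assumes vs: "viscosity_subsolution \<theta> H lam V" and cont: "continuous_on (closure \<theta>) V"
    and x: "x \<in> \<theta>" and X: "X \<in> sym_matrices" and touch: "quad_above \<theta> V x p X"
  shows "lam * V x + H x p X \<le> 0"
proof -
  let ?\<phi> = "\<lambda>y. 0 + p \<bullet> (y - x) + ((y - x) \<bullet> (X *v (y - x))) / 2"
  have sub: "y \<in> closure \<theta>" if "y \<in> \<theta>" for y using that closure_subset by blast
  have "local_max_on \<theta> (\<lambda>y. upper_envelope (closure \<theta>) V y - ?\<phi> y) x"
    unfolding local_max_on_def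
  proof (intro conjI x)
    show "\<forall>\<^sub>F y in at x within \<theta>. upper_envelope (closure \<theta>) V y - ?\<phi> y \<le> upper_envelope (closure \<theta>) V x - ?\<phi> x"
      using touch[unfolded quad_above_def] eventually_at_within_mem
      by eventually_elim (simp add: envelope_eq[OF cont] sub x)
  qed
  then have "lam * upper_envelope (closure \<theta>) V x + H x (gradient ?\<phi> x) (hessian ?\<phi> x) \<le> 0"
    using vs x quadratic_C2(1)[OF X, of 0 p x] unfolding viscosity_subsolution_def by blast
  then show ?thesis
    unfolding quadratic_C2(2)[OF X, of 0 p x] quadratic_C2(3)[OF X, of 0 p x] by (simp add: envelope_eq[OF cont] sub x)
qed

lemma viscosity_supersolution_quadratic:
  fixes V :: "real ^ 'n \<Rightarrow> real"
  assumes vs: "viscosity_supersolution \<theta> H lam V" and cont: "continuous_on (closure \<theta>) V"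
    and x: "x \<in> closure \<theta>" and X: "X \<in> sym_matrices"
    and touch: "quad_above (closure \<theta>) (\<lambda>y. - V y) x (- p) (- X)"
  shows "lam * V x + H x p X \<ge> 0"
proof -
  let ?\<phi> = "\<lambda>y. 0 + p \<bullet> (y - x) + ((y - x) \<bullet> (X *v (y - x))) / 2"
  have "local_min_on (closure \<theta>) (\<lambda>y. lower_envelope (closure \<theta>) V y - ?\<phi> y) x"
    unfolding local_min_on_def
  proof (intro conjI x)
    show "\<forall>\<^sub>F y in at x within closure \<theta>. lower_envelope (closure \<theta>) V x - ?\<phi> x \<le> lower_envelope (closure \<theta>) V y - ?\<phi> y"
      using touch[unfolded quad_above_def] eventually_at_within_mem
      by eventually_elim (simp add: envelope_eq[OF cont] x minus_matrix_mult_vec)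
  qed
  then have "lam * lower_envelope (closure \<theta>) V x + H x (gradient ?\<phi> x) (hessian ?\<phi> x) \<ge> 0"
    using vs x quadratic_C2(1)[OF X, of 0 p x] unfolding viscosity_supersolution_def by blast
  then show ?thesis
    unfolding quadratic_C2(2)[OF X, of 0 p x] quadratic_C2(3)[OF X, of 0 p x] by (simp add: envelope_eq[OF cont] x)
qed

lemma quad_above_scaleR:
  assumes "quad_above S f x p X" "l \<ge> 0"
  shows "quad_above S (\<lambda>y. l * f y) x (l *\<^sub>R p) (l *\<^sub>R X)"
  unfolding quad_above_def
proof (rule eventually_mono[OF assms(1)[unfolded quad_above_def]])
  fix y assume "f y \<le> f x + p \<bullet> (y - x) + (y - x) \<bullet> (X *v (y - x)) / 2"
  then have "l * f y \<le> l * (f x + p \<bullet> (y - x) + (y - x) \<bullet> (X *v (y - x)) / 2)"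
    using assms(2) by (rule mult_left_mono)
  then show "l * f y \<le> l * f x + (l *\<^sub>R p) \<bullet> (y - x) + (y - x) \<bullet> ((l *\<^sub>R X) *v (y - x)) / 2"
    by (simp add: distrib_left flip: scaleR_matrix_vector_assoc)
qed

text \<open>Monotonicity and the lower bound -M identify the limit as an infimum. The common
  Lipschitz constant reduces uniformity to a finite net: two Lipschitz errors and one pointwise
  error, e / 3 each.\<close>

lemma uniform_limit_mono_Lip:
  fixes u :: "real \<Rightarrow> real ^ 'n \<Rightarrow> real"
  assumes S: "compact S" and M: "M > 0"
    and mono: "\<And>x. x \<in> S \<Longrightarrow> mono_on {0<..} (\<lambda>lam. u lam x)"
    and lip: "\<And>lam. lam > 0 \<Longrightarrow> u lam \<in> Lip M S"
  shows "\<forall>x\<in>S. \<exists>L. ((\<lambda>lam. u lam x) \<longlongrightarrow> L) (at_right 0)"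
    and "uniform_limit S u (\<lambda>x. Lim (at_right 0) (\<lambda>lam. u lam x)) (at_right 0)"
proof -
  define L where "L x = Inf ((\<lambda>lam. u lam x) ` {0<..})" for x
  have lb: "- M \<le> u lam x" if "x \<in> S" "lam > 0" for x lam
    using lip[OF that(2)] that(1) by (fastforce simp: Lip_def)
  have lim: "((\<lambda>lam. u lam x) \<longlongrightarrow> L x) (at_right 0)" if x: "x \<in> S" for x
  proof (rule order_tendstoI)
    have bdd: "bdd_below ((\<lambda>lam. u lam x) ` {0<..})"
      by (rule bdd_belowI[of _ "- M"]) (use lb[OF x] in auto)
    have ge: "L x \<le> u lam x" if "lam > 0" for lam
      unfolding L_def by (rule cInf_lower[OF _ bdd]) (use that in auto)
    show "\<forall>\<^sub>F lam in at_right 0. a < u lam x" if "a < L x" for a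
      using ge that unfolding eventually_at_right_field by (intro exI[of _ 1]) (auto intro: less_le_trans)
    show "\<forall>\<^sub>F lam in at_right 0. u lam x < a" if a: "L x < a" for a
    proof -
      obtain b where b: "b > 0" "u b x < a"
        using cInf_less_iff[OF _ bdd, of a] a unfolding L_def by auto
      have "u lam x < a" if "0 < lam" "lam < b" for lam
        using mono_onD[OF mono[OF x], of lam b] that b by simp
      then show ?thesis unfolding eventually_at_right_field using b(1) by blast
    qed
  qed
  show "\<forall>x\<in>S. \<exists>L. ((\<lambda>lam. u lam x) \<longlongrightarrow> L) (at_right 0)" using lim by blast
  have LimL: "Lim (at_right 0) (\<lambda>lam. u lam x) = L x" if "x \<in> S" for x
    by (rule tendsto_Lim[OF _ lim[OF that]]) simp
  have ulip: "\<bar>u lam x - u lam y\<bar> \<le> M * norm (x - y)" if "x \<in> S" "y \<in> S" "lam > 0" for x y lam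
    using lip[OF that(3)] that(1,2) by (auto simp: Lip_def)
  have Llip: "\<bar>L x - L y\<bar> \<le> M * norm (x - y)" if xy: "x \<in> S" "y \<in> S" for x y
  proof (rule tendsto_upperbound)
    show "((\<lambda>lam. \<bar>u lam x - u lam y\<bar>) \<longlongrightarrow> \<bar>L x - L y\<bar>) (at_right 0)"
      by (intro tendsto_intros lim xy)
    show "\<forall>\<^sub>F lam in at_right 0. \<bar>u lam x - u lam y\<bar> \<le> M * norm (x - y)"
      using eventually_at_right_less by eventually_elim (rule ulip[OF xy])
  qed simp
  show "uniform_limit S u (\<lambda>x. Lim (at_right 0) (\<lambda>lam. u lam x)) (at_right 0)"
  proof (rule uniform_limitI)
    fix e :: real assume e: "e > 0"
    define d where "d = e / (3 * M)"
    have d: "d > 0" "M * d = e / 3" using e M by (auto simp: d_def)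
    have "S \<subseteq> (\<Union>x\<in>S. ball x d)" using d by force
    then obtain T where T: "T \<subseteq> S" "finite T" "S \<subseteq> (\<Union>x\<in>T. ball x d)"
      using compactE_image[OF S, of S "\<lambda>x. ball x d"] by auto
    have "\<forall>\<^sub>F lam in at_right 0. \<forall>x\<in>T. dist (u lam x) (L x) < e / 3"
      using T(1) e by (intro eventually_ball_finite[OF T(2)] ballI tendstoD[OF lim]) auto
    then show "\<forall>\<^sub>F lam in at_right 0. \<forall>x\<in>S. dist (u lam x) (Lim (at_right 0) (\<lambda>lam. u lam x)) < e"
      using eventually_at_right_less[of 0]
    proof eventually_elim
      case (elim lam)
      show ?case
      proof
        fix y assume y: "y \<in> S"
        then obtain x where x: "x \<in> T" "dist x y < d" using T(3) by auto
        have "M * norm (y - x) \<le> M * d" using x(2) M by (intro mult_left_mono) (auto simp: dist_norm norm_minus_commute)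
        then have "M * norm (y - x) \<le> e / 3" using d(2) by simp
        moreover have "\<bar>u lam x - L x\<bar> < e / 3" using elim(1) x(1) by (simp add: dist_real_def)
        moreover have "\<bar>u lam y - u lam x\<bar> \<le> M * norm (y - x)" "\<bar>L y - L x\<bar> \<le> M * norm (y - x)"
          using ulip[OF y _ elim(2), of x] Llip[OF y, of x] x(1) T(1) by auto
        ultimately show "dist (u lam y) (Lim (at_right 0) (\<lambda>lam. u lam y)) < e"
          unfolding LimL[OF y] dist_real_def by linarith
      qed
    qed
  qed
qed

theorem theorem3p3:
  fixes \<theta> :: "(real ^ 'n) set"
    and H :: "real ^ 'n \<Rightarrow> real ^ 'n \<Rightarrow> real ^ 'n ^ 'n \<Rightarrow> real"
    and M0 :: real
    and V :: "real \<Rightarrow> real ^ 'n \<Rightarrow> real"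
  assumes "\<theta> \<noteq> {}" and "open \<theta>" and "compact (closure \<theta>)"
    and "domain_condition \<theta>"
    and "uniformly_continuous_on (UNIV \<times> UNIV \<times> sym_matrices) (\<lambda>(x, p, A). H x p A)"
    and "hamiltonian_condition H"
    and "M0 > 0"
    and "solvability_hypothesis \<theta> H M0"
    and "radial_monotonicity \<theta> H"
    and "\<And>lam. lam > 0 \<Longrightarrow> constrained_viscosity_solution \<theta> H lam (V lam)"
    and "\<And>lam. lam > 0 \<Longrightarrow> (\<lambda>x. lam * V lam x) \<in> Lip M0 (closure \<theta>)"
  shows "(\<forall>x\<in>closure \<theta>. mono_on {0<..} (\<lambda>lam. lam * V lam x)) \<and>
    (\<forall>x\<in>closure \<theta>. \<exists>L. ((\<lambda>lam. lam * V lam x) \<longlongrightarrow> L) (at_right 0)) \<and>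
    uniform_limit (closure \<theta>) (\<lambda>lam x. lam * V lam x)
      (\<lambda>x. Lim (at_right 0) (\<lambda>lam. lam * V lam x)) (at_right 0)"
proof -
  let ?S = "closure \<theta>"
  have lip: "\<bar>lam * V lam x - lam * V lam y\<bar> \<le> M0 * norm (x - y)" if "lam > 0" "x \<in> ?S" "y \<in> ?S" for lam x y
    using assms(11)[OF that(1)] that(2,3) by (auto simp: Lip_def)
  have lipV: "\<bar>V lam x - V lam y\<bar> \<le> M0 / lam * norm (x - y)" if "lam > 0" "x \<in> ?S" "y \<in> ?S" for lam x y
  proof -
    have "lam * \<bar>V lam x - V lam y\<bar> \<le> M0 * norm (x - y)"
      using lip[OF that] that(1) by (simp add: abs_mult flip: right_diff_distrib)
    then show ?thesis using that(1) by (simp add: field_simps)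
  qed
  have cont: "continuous_on ?S (V lam)" if "lam > 0" for lam
  proof -
    have "(M0 / lam)-lipschitz_on ?S (V lam)"
      using lipV[OF that] that assms(7) by (intro lipschitz_onI) (auto simp: dist_real_def dist_norm)
    then show ?thesis by (rule lipschitz_on_continuous_on)
  qed
  have mono: "mono_on {0<..} (\<lambda>lam. lam * V lam x)" if x: "x \<in> ?S" for x
  proof (rule mono_onI)
    fix lam \<mu> :: real assume "lam \<in> {0<..}" "\<mu> \<in> {0<..}" and le: "lam \<le> \<mu>"
    then have pos: "lam > 0" "\<mu> > 0" by auto
    \<comment> \<open>\<open>u\<close> and \<open>V \<mu>\<close> are compared in the equation with
      coefficient \<mu>. Multiplying a jet of \<open>u\<close> by l gives a jet of
      \<open>V lam\<close>, and radial monotonicity bounds \<open>H\<close> at (p, X) by its value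
      at (l p, l X); the order of lam and \<mu> enters as l \<ge> 1.\<close>
    define l where "l = \<mu> / lam"
    have l: "l \<ge> 1" using le pos by (simp add: l_def)
    define u where "u y = lam / \<mu> * V lam y" for y
    have lu: "l * u y = V lam y" for y using pos by (simp add: l_def u_def)
    have "u x \<le> V \<mu> x"
    proof (rule comparison_principle[OF assms(3,4,5) _ pos(2)])
      show "H x p A \<le> H x p B" if "A \<in> sym_matrices" "B \<in> sym_matrices" "B \<preceq> A" for x p A B
        using assms(6) that unfolding hamiltonian_condition_def by blast
      show "M0 / \<mu> > 0" using assms(7) pos by simp
      show "\<bar>u a - u b\<bar> \<le> M0 / \<mu> * norm (a - b)" if "a \<in> ?S" "b \<in> ?S" for a b
      proof -
        have "u a - u b = (lam * V lam a - lam * V lam b) / \<mu>" by (simp add: u_def diff_divide_distrib)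
        then have "\<bar>u a - u b\<bar> = \<bar>lam * V lam a - lam * V lam b\<bar> / \<mu>" using pos by simp
        also have "\<dots> \<le> M0 * norm (a - b) / \<mu>" using lip[OF pos(1) that] pos by (intro divide_right_mono) auto
        finally show ?thesis by simp
      qed
      show "\<bar>V \<mu> a - V \<mu> b\<bar> \<le> M0 / \<mu> * norm (a - b)" if "a \<in> ?S" "b \<in> ?S" for a b
        by (rule lipV[OF pos(2) that])
      show "\<mu> * u a + H a p X \<le> 0" if a: "a \<in> \<theta>" and X: "X \<in> sym_matrices" and t: "quad_above \<theta> u a p X" for a p X
      proof -
        have lX: "l *\<^sub>R X \<in> sym_matrices"
          using X by (auto simp: sym_matrices_def transpose_def vec_eq_iff)
        have "quad_above \<theta> (V lam) a (l *\<^sub>R p) (l *\<^sub>R X)"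
          using quad_above_scaleR[OF t, of l] l by (simp add: lu)
        then have "lam * V lam a + H a (l *\<^sub>R p) (l *\<^sub>R X) \<le> 0"
          using viscosity_subsolution_quadratic[OF _ cont[OF pos(1)] a lX] assms(10)[OF pos(1)]
          unfolding constrained_viscosity_solution_def by blast
        moreover have "H a p X \<le> H a (l *\<^sub>R p) (l *\<^sub>R X)"
          using assms(9) l a X closure_subset unfolding radial_monotonicity_def by blast
        moreover have "\<mu> * u a = lam * V lam a" using pos by (simp add: u_def)
        ultimately show ?thesis by linarith
      qed
      show "0 \<le> \<mu> * V \<mu> a + H a p X" if a: "a \<in> ?S" and X: "X \<in> sym_matrices"
        and t: "quad_above ?S (\<lambda>y. - V \<mu> y) a (- p) (- X)" for a p X
        using viscosity_supersolution_quadratic[OF _ cont[OF pos(2)] a X t] assms(10)[OF pos(2)]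
        unfolding constrained_viscosity_solution_def by blast
    qed (rule x)
    then have "\<mu> * u x \<le> \<mu> * V \<mu> x" using pos by simp
    then show "lam * V lam x \<le> \<mu> * V \<mu> x" using pos by (simp add: u_def)
  qed
  show ?thesis
    using mono uniform_limit_mono_Lip[OF assms(3,7), of "\<lambda>lam x. lam * V lam x"] assms(11) by blast
qed

end
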